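(* Let $G$ be a finite abelian group, and $S\subseteq G\setminus\{0\}$ a symmetric subset with $|S|\ge 4$ for which $\Sigma(S)$ is aperiodic. Then $$|\Sigma(S)|\ge \frac{|S|(|S|-2)}{4}+5.$$ Furthermore, if $|G|$ is odd then $$|\Sigma(S)|\ge \frac{|S|(|S|+2)}{4}+2\xi'(S)-1.$$
   Context: For a subset $S$ of a finite abelian group $G$, $\Sigma(S)=\{\sum_{x\in X}x : X\subseteq S\}$ is the set of all subset sums of $S$ (the empty sum $0$ is included), and $\langle S\rangle$ is the subgroup generated by $S$. $S$ is symmetric if $S=-S$. A subset $X\subseteq G$ is aperiodic if $X+g=X$ holds only for $g=0$. For a subset $T\subseteq G$ define $\xi(T)$ as follows: if $|T|$ is even, $\xi(T)=1$; if $|T|$ is odd, $\xi(T)=1$ when $2|T|^2+3|T|\le 2|\langle T\rangle|+5$, and $\xi(T)=0$ when $2|T|^2+3|T|>2|\langle T\rangle|+5$. For a symmetric subset $S\subseteq G\setminus\{0\}$ with $|S|\ge 4$ for which $\Sigma(S)$ is aperiodic, $\xi'(S)$ denotes $\xi(S')$, where $S'$ is any subset of $S$ with $|S'|=|S|/2$ and $S=S'\cup(-S')$ (the value does not depend on the choice of $S'$). *)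

theory Defs
  imports Complex_Main "HOL-Computational_Algebra.Group_Closure"
begin

definition subset_sums :: "'a::ab_group_add set \<Rightarrow> 'a set"
  where "subset_sums S = {(\<Sum>x\<in>X. x) |X. X \<subseteq> S}"

definition symmetric_set :: "'a::ab_group_add set \<Rightarrow> bool"
  where "symmetric_set S \<longleftrightarrow> S = uminus ` S"

definition aperiodic :: "'a::ab_group_add set \<Rightarrow> bool"
  where "aperiodic X \<longleftrightarrow> (\<forall>g. (\<lambda>x. x + g) ` X = X \<longrightarrow> g = 0)"

definition xi :: "'a::ab_group_add set \<Rightarrow> nat"
  where "xi T =
    (if even (card T) then 1
     else if 2 * card T ^ 2 + 3 * card T \<le> 2 * card (group_closure T) + 5 then 1
     else 0)"

definition is_half :: "'a::ab_group_add set \<Rightarrow> 'a set \<Rightarrow> bool"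
  where "is_half S S' \<longleftrightarrow>
    S' \<subseteq> S \<and> 2 * card S' = card S \<and> S = S' \<union> uminus ` S'"

text \<open>
  Meaningful only when \<open>S\<close> has a half. For the sets of interest one exists
  (\<open>is_half_exists\<close>), and the value does not depend on which one is chosen
  (\<open>xi'_eq\<close>).
\<close>

definition xi' :: "'a::ab_group_add set \<Rightarrow> nat"
  where "xi' S = xi (SOME S'. is_half S S')"

lemma group_closure_half:
  assumes "is_half S S'"
  shows "group_closure S' = group_closure S"
proof
  have *: "S' \<subseteq> S" "S = S' \<union> uminus ` S'"
    using assms by (auto simp: is_half_def)
  show "group_closure S' \<subseteq> group_closure S"
  proof
    fix x assume "x \<in> group_closure S'"
    then show "x \<in> group_closure S"
      by induction (use *(1) in \<open>auto intro: group_closure.intros\<close>)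
  qed
  have S: "s \<in> group_closure S'" if "s \<in> S" for s
  proof -
    have "s \<in> S' \<or> - s \<in> S'"
      using that *(2) by auto
    then show ?thesis
      using group_closure.base[of s S'] group_closure.base[of "- s" S'] by auto
  qed
  show "group_closure S \<subseteq> group_closure S'"
  proof
    fix x assume "x \<in> group_closure S"
    then show "x \<in> group_closure S'"
      by induction (auto intro: S group_closure.diff)
  qed
qed

lemma xi'_eq:
  assumes "is_half S S'"
  shows "xi' S = xi S'"
proof -
  have h: "is_half S (SOME S'. is_half S S')"
    using assms by (rule someI)
  have "card (SOME S'. is_half S S') = card S'"
    using h assms unfolding is_half_def by linarith
  then show ?thesis
    using group_closure_half[OF h] group_closure_half[OF assms]
    by (simp add: xi'_def xi_def)
qed

lemma aperiodic_no_involution: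
  fixes S :: "'a::ab_group_add set"
  assumes "finite S" "0 \<notin> S" "aperiodic (subset_sums S)" "s \<in> S"
  shows "- s \<noteq> s"
proof
  assume inv: "- s = s"
  then have ss: "s + s = 0"
    by (metis add.right_inverse)
  have closed: "y + s \<in> subset_sums S" if y: "y \<in> subset_sums S" for y
  proof -
    obtain X where X: "X \<subseteq> S" "y = \<Sum>X"
      using y by (auto simp: subset_sums_def)
    have fin: "finite X"
      using X(1) assms(1) finite_subset by blast
    show ?thesis
    proof (cases "s \<in> X")
      case True
      have "y = s + \<Sum>(X - {s})"
        using sum.remove[OF fin True, of "\<lambda>x. x"] X(2) by simp
      then have "y + s = \<Sum>(X - {s})"
        using ss by (metis add.assoc add.commute add_0)
      then show ?thesis
        using X(1) by (auto simp: subset_sums_def)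
    next
      case False
      then have "y + s = \<Sum>(insert s X)"
        using fin X(2) by (simp add: add.commute)
      moreover have "insert s X \<subseteq> S"
        using X(1) assms(4) by simp
      ultimately show ?thesis
        unfolding subset_sums_def by blast
    qed
  qed
  have "(\<lambda>x. x + s) ` subset_sums S = subset_sums S"
  proof
    show "(\<lambda>x. x + s) ` subset_sums S \<subseteq> subset_sums S"
      using closed by auto
    show "subset_sums S \<subseteq> (\<lambda>x. x + s) ` subset_sums S"
    proof
      fix y assume "y \<in> subset_sums S"
      moreover have "y = (y + s) + s"
        using ss by (simp add: add.assoc)
      ultimately show "y \<in> (\<lambda>x. x + s) ` subset_sums S"
        using closed by blast
    qed
  qed
  then have "s = 0"
    using assms(3) by (simp add: aperiodic_def)
  then show False
    using assms(2,4) by simp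
qed

lemma half_exists_aux:
  fixes S :: "'a::ab_group_add set"
  assumes "finite S" "\<forall>s\<in>S. - s \<in> S \<and> - s \<noteq> s"
  shows "\<exists>S'. is_half S S'"
  using assms
proof (induction "card S" arbitrary: S rule: less_induct)
  case less
  show ?case
  proof (cases "S = {}")
    case True
    then have "is_half S {}"
      by (simp add: is_half_def)
    then show ?thesis ..
  next
    case False
    then obtain s where s: "s \<in> S" "- s \<in> S" "- s \<noteq> s"
      using less.prems(2) by blast
    define R where "R = S - {s, - s}"
    have fin: "finite R"
      using less.prems(1) by (simp add: R_def)
    have S: "S = insert s (insert (- s) R)" "s \<notin> R" "- s \<notin> R"
      using s by (auto simp: R_def)
    have cS: "card S = card R + 2"
      using S s(3) fin by (metis (no_types, lifting) card_insert_disjoint finite_insert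
          insert_iff add_2_eq_Suc')
    moreover have "\<forall>r\<in>R. - r \<in> R \<and> - r \<noteq> r"
      using less.prems(2) by (auto simp: R_def)
    ultimately obtain R' where R': "is_half R R'"
      using less.hyps[of R] fin by auto
    have "R' \<subseteq> R" "2 * card R' = card R" "R = R' \<union> uminus ` R'"
      using R' by (auto simp: is_half_def)
    moreover have "finite R'" "s \<notin> R'"
      using \<open>R' \<subseteq> R\<close> fin S(2) finite_subset by auto
    ultimately have "is_half S (insert s R')"
      using S(1) cS by (auto simp: is_half_def)
    then show ?thesis ..
  qed
qed

lemma is_half_exists:
  fixes S :: "'a::ab_group_add set"
  assumes "finite S" "0 \<notin> S" "symmetric_set S" "aperiodic (subset_sums S)"
  shows "\<exists>S'. is_half S S'"
proof (rule half_exists_aux)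
  show "\<forall>s\<in>S. - s \<in> S \<and> - s \<noteq> s"
    using assms aperiodic_no_involution[OF assms(1,2,4)]
    by (auto simp: symmetric_set_def)
qed (fact assms(1))

end

theory Submission
  imports Defs "HOL-Library.Set_Algebras"
begin

text \<open>
  Let \<open>Y\<close> be half of \<open>S\<close> and \<open>B = \<Sigma>(Y)\<close>, so that \<open>\<Sigma>(S) = B - B\<close>. The gain \<open>|(x + B) - B|\<close> is
  subadditive in \<open>x\<close>, while its complement \<open>|B \<inter> (x + B)|\<close> sums to at most \<open>|B|\<^sup>2\<close> over all \<open>x\<close>. If no
  subset of \<open>S\<close> is dense modulo a subgroup, iterated sums of \<open>S \<union> {0}\<close> grow quickly (atoms in the sense of
  Mann and Hamidoune), so some \<open>s \<in> S\<close> has a large gain (Olson); dropping \<open>s\<close> and \<open>-s\<close> bounds \<open>|B|\<close> by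
  induction, and Kneser's theorem for difference sets gives \<open>|\<Sigma>(S)| \<ge> 2|B| - 1\<close>.

  If a subset of \<open>S\<close> is dense modulo a subgroup \<open>P\<close>, the sums over one coset of \<open>P\<close> fill a coset, whence
  \<open>\<Sigma>(S - {z, -z}) + P \<subseteq> \<Sigma>(S)\<close> for some \<open>z\<close>. With \<open>L\<close> the stabilizer of the left-hand side,
  \<open>|\<Sigma>(S)|\<close> is bounded inductively through the part of \<open>S\<close> in \<open>L\<close> and the part outside \<open>L\<close> modulo \<open>L\<close>.
  For this induction everything is done relative to a subgroup \<open>K\<close>.

  In a group of odd order one replaces atoms by 2-atoms: except for arithmetic progressions, which are treated
  directly, the iterated sums then grow by two more elements in each step (Vosper).
\<close>

section \<open>Set sums and subgroups\<close>

text \<open>A bound in \<open>|S|\<close> alone does not survive the passage to a quotient, where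
  several elements may share a coset. \<open>coset_bound\<close> therefore counts multiplicities:
  its main term is the sum over \<open>t \<ge> 1\<close> of the squared number of cosets containing
  at least \<open>t\<close> elements of \<open>S\<close>, so that each layer of \<open>S\<close>
  counts like a set of distinct elements.

  The term \<open>- 4 (q - 4)\<close> for the \<open>q\<close> cosets met only once is the price of
  Olson's argument: among \<open>p\<close> pairs of opposite cosets the best shift may gain only
  \<open>p - 1\<close> instead of \<open>p\<close>, and for single elements this deficit is charged
  to the bound. The first four are free, whence the 5 of the theorem: for \<open>K = {0}\<close> one
  has \<open>q = |S|\<close>, and \<open>4 + 16 = 4 * 5\<close>.

  The threshold in \<open>xi\<close> comes from the last ball in Olson's inequality. For even
  \<open>n = |Y|\<close> it is ball number \<open>n / 2\<close>, of size about
  \<open>n (n + 1)\<close>, for which the generated group always has room. For odd \<open>n\<close>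
  it is ball number \<open>(n + 1) / 2\<close>, whose expected size \<open>(n + 1)^2 - 1\<close> may
  exceed the group; the ball is then the whole group, which has to be large enough by
  assumption.\<close>

definition is_subgroup :: "'a::ab_group_add set \<Rightarrow> bool"
  where "is_subgroup K \<longleftrightarrow> 0 \<in> K \<and> (\<forall>x\<in>K. \<forall>y\<in>K. x - y \<in> K)"

text \<open>\<open>A\<close> is the full preimage of an aperiodic subset of the quotient by
  \<open>K\<close>. In a finite group the inclusion \<open>g +o A \<subseteq> A\<close> is an
  equality, and the inclusion is what a vanishing \<open>shift_gain\<close> provides.\<close>

definition has_stabilizer :: "'a::ab_group_add set \<Rightarrow> 'a set \<Rightarrow> bool"
  where "has_stabilizer A K \<longleftrightarrow> is_subgroup K \<and> A + K = A \<and> (\<forall>g. g +o A \<subseteq> A \<longrightarrow> g \<in> K)"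

definition cosets_of :: "'a::ab_group_add set \<Rightarrow> 'a set \<Rightarrow> 'a set set"
  where "cosets_of K S = (\<lambda>s. s +o K) ` S"

lemma elt_set_plus_eq_image: "a +o B = (+) a ` B"
  by (auto simp: elt_set_plus_def)

lemma mem_elt_set_plus: "x \<in> a +o B \<longleftrightarrow> x - a \<in> B" for a x :: "'a::ab_group_add"
  by (simp add: set_minus_plus)

lemma card_elt_set_plus [simp]: "card (a +o B) = card B" for a :: "'a::ab_group_add"
  by (simp add: elt_set_plus_eq_image card_image)

lemma elt_set_plus_subset_iff: "a +o B \<subseteq> C \<longleftrightarrow> (\<forall>b\<in>B. a + b \<in> C)"
  by (auto simp: elt_set_plus_def)

lemma elt_set_plus_eq_if_subset:
  fixes A :: "'a::{ab_group_add,finite} set"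
  shows "g +o A \<subseteq> A \<Longrightarrow> g +o A = A"
  by (intro card_subset_eq) auto

lemma set_plus_two: "A + {a, b} = (a +o A) \<union> (b +o A)" for A :: "'a::ab_group_add set"
  by (auto simp: set_plus_def elt_set_plus_def add.commute)

lemma set_plus_zero_two: "A + {0, b} = A \<union> (b +o A)" for A :: "'a::ab_group_add set"
  by (simp add: set_plus_two)

lemma uminus_image_image [simp]: "uminus ` uminus ` A = A" for A :: "'a::group_add set"
  by (simp add: image_image)

lemma mem_uminus_image: "x \<in> uminus ` A \<longleftrightarrow> - x \<in> A" for x :: "'a::group_add"
  by (metis add.inverse_inverse image_iff)

lemma card_uminus_image [simp]: "card (uminus ` A) = card A" for A :: "'a::group_add set"
  by (simp add: card_image)

lemma uminus_set_plus: "uminus ` (A + B) = uminus ` A + uminus ` B" for A B :: "'a::ab_group_add set"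
proof -
  have "- (a + b) = - a + - b" for a b :: 'a by simp
  then show ?thesis unfolding set_plus_def by (auto simp del: minus_add_distrib) force+
qed

lemma set_plus_mono_left: "A \<subseteq> B \<Longrightarrow> A + C \<subseteq> B + C" for A B C :: "'a::plus set"
  by (rule set_plus_mono2) auto

lemma set_plus_superset: "0 \<in> B \<Longrightarrow> A \<subseteq> A + B" for A B :: "'a::comm_monoid_add set"
  using set_zero_plus2[of B A] by (simp add: add.commute)

lemma card_set_plus_ge:
  fixes A B :: "'a::{ab_group_add,finite} set"
  assumes "B \<noteq> {}"
  shows "card A \<le> card (A + B)"
proof -
  obtain b where "b \<in> B" using assms by blast
  then have "b +o A \<subseteq> A + B" by (rule set_plus_mono4)
  then show ?thesis by (metis card_elt_set_plus card_mono finite_class.finite)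
qed

text \<open>Pigeonhole: \<open>A\<close> and \<open>g - B\<close> lie in the same coset of
  \<open>L\<close> and are together too large to be disjoint. All later arguments that fill a coset
  with sums rest on this.\<close>

lemma card_add_gt_imp_mem_set_plus:
  fixes A B L :: "'a::{ab_group_add,finite} set"
  assumes L: "is_subgroup L" and A: "A \<subseteq> a +o L" and B: "B \<subseteq> b +o L"
    and gt: "card L < card A + card B" and g: "g \<in> (a + b) +o L"
  shows "g \<in> A + B"
proof -
  have "(\<lambda>x. g - x) ` B \<subseteq> a +o L"
  proof
    fix y assume "y \<in> (\<lambda>x. g - x) ` B"
    then obtain x where x: "x \<in> B" "y = g - x" by blast
    then have "x - b \<in> L" "g - (a + b) \<in> L"
      using B g by (auto simp: mem_elt_set_plus)
    then have "(g - (a + b)) - (x - b) \<in> L"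
      using L unfolding is_subgroup_def by blast
    then show "y \<in> a +o L"
      by (simp add: mem_elt_set_plus x algebra_simps)
  qed
  moreover have "card ((\<lambda>x. g - x) ` B) = card B"
    by (rule card_image) (simp add: inj_on_def)
  moreover have "card (A \<union> (\<lambda>x. g - x) ` B) \<le> card (a +o L)"
    using A calculation(1) by (intro card_mono) auto
  ultimately have "A \<inter> (\<lambda>x. g - x) ` B \<noteq> {}"
    using gt card_Un_disjoint[of A "(\<lambda>x. g - x) ` B"] by fastforce
  then obtain x where x: "x \<in> B" "g - x \<in> A" by blast
  have "g = (g - x) + x" by simp
  then show ?thesis using x by (metis set_plus_intro)
qed

section \<open>Subgroups, cosets and stabilizers\<close>

lemma is_subgroupD:
  assumes "is_subgroup K"
  shows "0 \<in> K" and "x \<in> K \<Longrightarrow> - x \<in> K"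
    and "x \<in> K \<Longrightarrow> y \<in> K \<Longrightarrow> x + y \<in> K" and "x \<in> K \<Longrightarrow> y \<in> K \<Longrightarrow> x - y \<in> K"
proof -
  show 0: "0 \<in> K" using assms by (simp add: is_subgroup_def)
  show d: "x \<in> K \<Longrightarrow> y \<in> K \<Longrightarrow> x - y \<in> K" for x y using assms by (simp add: is_subgroup_def)
  show n: "x \<in> K \<Longrightarrow> - x \<in> K" for x using d[of 0 x] 0 by simp
  show "x \<in> K \<Longrightarrow> y \<in> K \<Longrightarrow> x + y \<in> K" using d[of x "- y"] n[of y] by simp
qed

lemma is_subgroup_zero [simp]: "is_subgroup {0}"
  by (simp add: is_subgroup_def)

lemma is_subgroup_group_closure [simp]: "is_subgroup (group_closure S)"
  by (auto simp: is_subgroup_def intro: group_closure.diff)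

lemma group_closure_subset: "is_subgroup K \<Longrightarrow> S \<subseteq> K \<Longrightarrow> group_closure S \<subseteq> K"
proof
  fix x assume "is_subgroup K" "S \<subseteq> K" "x \<in> group_closure S"
  from this(3,1,2) show "x \<in> K" by induction (auto simp: is_subgroup_def)
qed

lemma subset_group_closure: "S \<subseteq> group_closure S"
  by (auto intro: group_closure.base)

lemma card_subgroup_pos: "is_subgroup K \<Longrightarrow> 0 < card K" for K :: "'a::{ab_group_add,finite} set"
  by (auto simp: is_subgroup_def card_gt_0_iff)

lemma subgroup_plus_self [simp]: "is_subgroup K \<Longrightarrow> K + K = K"
  using is_subgroupD(1,3)[of K] set_plus_superset[of K K]
  by (auto simp: set_plus_def)

lemma uminus_subgroup: "is_subgroup K \<Longrightarrow> uminus ` K = K"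
  using is_subgroupD(2)[of K] by (force simp: mem_uminus_image)

lemma subgroup_coset_eq: "is_subgroup K \<Longrightarrow> x +o K = y +o K \<longleftrightarrow> x - y \<in> K"
proof
  assume K: "is_subgroup K" and "x +o K = y +o K"
  moreover have "x \<in> x +o K" using is_subgroupD(1)[OF K] by (simp add: mem_elt_set_plus)
  ultimately show "x - y \<in> K" by (simp add: mem_elt_set_plus)
next
  assume K: "is_subgroup K" and xy: "x - y \<in> K"
  have "z - x \<in> K \<longleftrightarrow> z - y \<in> K" for z
  proof -
    have "z - y = (z - x) + (x - y)" "z - x = (z - y) - (x - y)" by simp_all
    then show ?thesis using xy is_subgroupD(3,4)[OF K] by metis
  qed
  then show "x +o K = y +o K" by (auto simp: mem_elt_set_plus)
qed

lemma subgroup_elt_plus: "is_subgroup K \<Longrightarrow> x \<in> K \<Longrightarrow> x +o K = K"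
  using subgroup_coset_eq[of K x 0] by simp

lemma subgroup_cosets_disjoint:
  assumes "is_subgroup K" "x +o K \<noteq> y +o K"
  shows "(x +o K) \<inter> (y +o K) = {}"
proof (rule ccontr)
  assume "(x +o K) \<inter> (y +o K) \<noteq> {}"
  then obtain z where "z - x \<in> K" "z - y \<in> K" by (auto simp: mem_elt_set_plus)
  then have "z +o K = x +o K" "z +o K = y +o K" using assms(1) by (simp_all add: subgroup_coset_eq)
  then show False using assms(2) by simp
qed

lemma plus_subgroup_superset: "is_subgroup K \<Longrightarrow> A \<subseteq> A + K"
  by (simp add: is_subgroupD(1) set_plus_superset)

lemma subgroup_plus_subset: "is_subgroup L \<Longrightarrow> K \<subseteq> L \<Longrightarrow> 0 \<in> K \<Longrightarrow> L + K = L"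
  using set_plus_mono2[of L L K L] set_plus_superset[of K L] by auto

lemma is_subgroup_plus:
  assumes "is_subgroup K" "is_subgroup L"
  shows "is_subgroup (K + L)"
proof -
  have "x - y \<in> K + L" if xy: "x \<in> K + L" "y \<in> K + L" for x y
  proof -
    obtain k l k' l' where "x = k + l" "y = k' + l'" "k \<in> K" "l \<in> L" "k' \<in> K" "l' \<in> L"
      using xy by (meson set_plus_elim)
    moreover from this have "x - y = (k - k') + (l - l')" by simp
    ultimately show ?thesis using assms unfolding is_subgroup_def
      by (metis set_plus_intro)
  qed
  moreover have "0 \<in> K + L" using assms set_plus_intro[of 0 K 0 L] by (auto simp: is_subgroup_def)
  ultimately show ?thesis by (auto simp: is_subgroup_def)
qed

lemma periodic_plus_mem: "A + K = A \<Longrightarrow> a \<in> A \<Longrightarrow> k \<in> K \<Longrightarrow> a + k \<in> A"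
  by (metis set_plus_intro)

lemma Union_cosets_of: "\<Union>(cosets_of K S) = S + K"
  by (auto simp: cosets_of_def set_plus_def elt_set_plus_def)

lemma card_plus_subgroup:
  fixes S :: "'a::{ab_group_add,finite} set"
  assumes "is_subgroup K"
  shows "card (S + K) = card K * card (cosets_of K S)"
proof -
  have "card K * card (cosets_of K S) = card (\<Union>(cosets_of K S))"
  proof (rule card_partition)
    show "c1 \<inter> c2 = {}" if "c1 \<in> cosets_of K S" "c2 \<in> cosets_of K S" "c1 \<noteq> c2" for c1 c2
      using that subgroup_cosets_disjoint[OF assms] by (auto simp: cosets_of_def simp del: disjoint_iff)
  qed (auto simp: cosets_of_def)
  then show ?thesis by (simp add: Union_cosets_of)
qed

lemma has_stabilizerD:
  assumes "has_stabilizer A K"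
  shows "is_subgroup K" "A + K = A" "g +o A \<subseteq> A \<Longrightarrow> g \<in> K"
  using assms by (auto simp: has_stabilizer_def)

lemma has_stabilizer_summand:
  fixes A B :: "'a::ab_group_add set"
  assumes "has_stabilizer (A + B) K" "A + K = A"
  shows "has_stabilizer A K"
proof -
  have "g \<in> K" if "g +o A \<subseteq> A" for g
  proof (rule has_stabilizerD(3)[OF assms(1)])
    show "g +o (A + B) \<subseteq> A + B"
      using that set_plus_mono_left[of "g +o A" A B] by (simp add: set_plus_rearrange3)
  qed
  then show ?thesis using assms by (auto simp: has_stabilizer_def)
qed

lemma stabilizer_exists:
  fixes A :: "'a::{ab_group_add,finite} set"
  assumes "A \<noteq> {}"
  shows "\<exists>K. has_stabilizer A K"
proof
  let ?K = "{g. g +o A \<subseteq> A}"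
  have eq: "g +o A = A" if "g \<in> ?K" for g using that elt_set_plus_eq_if_subset by blast
  have "g - h \<in> ?K" if "g \<in> ?K" "h \<in> ?K" for g h
  proof -
    have "(g - h) +o A = (g - h) +o (h +o A)" using eq[OF that(2)] by simp
    also have "\<dots> = A" using eq[OF that(1)] by (simp add: set_plus_rearrange2)
    finally show ?thesis by simp
  qed
  then have K: "is_subgroup ?K" by (simp add: is_subgroup_def)
  moreover have "A + ?K \<subseteq> A"
    by (auto simp: set_plus_def elt_set_plus_subset_iff add.commute)
  ultimately show "has_stabilizer A ?K"
    using plus_subgroup_superset[OF K, of A] by (auto simp: has_stabilizer_def)
qed

lemma periodic_subgroup_subset_stabilizer:
  assumes "has_stabilizer A K" "A + L = A"
  shows "L \<subseteq> K"
proof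
  fix g assume "g \<in> L"
  then have "g +o A \<subseteq> A + L" by (rule set_plus_mono4)
  then show "g \<in> K" using assms has_stabilizerD(3) by metis
qed

section \<open>Atoms and difference sets\<close>

text \<open>The competitors in Hamidoune's isoperimetric method; least \<open>boundary\<close> is
  demanded separately in \<open>atom_exists\<close>. The value \<open>r = 1\<close> leads to
  subgroups and Mann's theorem, \<open>r = 2\<close> to Vosper's.\<close>

definition fragments :: "nat \<Rightarrow> 'a::ab_group_add set \<Rightarrow> 'a set \<Rightarrow> 'a set set"
  where "fragments r H B = {X. X \<subseteq> H \<and> r \<le> card X \<and> r \<le> card (H - (X + B))}"

definition boundary :: "'a::ab_group_add set \<Rightarrow> 'a set \<Rightarrow> nat"
  where "boundary B X = card (X + B) - card X"

lemma card_set_plus_boundary: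
  fixes B :: "'a::{ab_group_add,finite} set"
  shows "B \<noteq> {} \<Longrightarrow> card (X + B) = card X + boundary B X"
  using card_set_plus_ge[of B X] by (simp add: boundary_def)

lemma fragments_dual:
  fixes B :: "'a::{ab_group_add,finite} set"
  assumes H: "is_subgroup H" and B: "B \<subseteq> H" "B \<noteq> {}" and A: "A \<in> fragments r H B"
  defines "D \<equiv> uminus ` (H - (A + B))"
  shows "D \<in> fragments r H B" and "boundary B D \<le> boundary B A"
    and "card A + boundary B A + card D = card H"
proof -
  have AH: "A \<subseteq> H" "A + B \<subseteq> H"
    using A B(1) set_plus_mono2[of A H B H] H by (auto simp: fragments_def)
  have "H - (A + B) \<subseteq> H" by blast
  then have DH: "D \<subseteq> H"
    using uminus_subgroup[OF H] unfolding D_def by blast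
  have disj: "(D + B) \<inter> uminus ` A = {}"
  proof (rule ccontr)
    assume "(D + B) \<inter> uminus ` A \<noteq> {}"
    then obtain x where "x \<in> D + B" "- x \<in> A" using mem_uminus_image by blast
    moreover from this(1) obtain z b where "x = z + b" "z \<in> D" "b \<in> B" by (rule set_plus_elim)
    moreover from this(2) have "- z \<notin> A + B" unfolding D_def mem_uminus_image by blast
    ultimately have z: "x = z + b" "- z \<notin> A + B" "b \<in> B" "- x \<in> A" by simp_all
    have "- z = - x + b" using z(1) by simp
    then show False using z by (metis set_plus_intro)
  qed
  have DB: "D + B \<subseteq> H" using set_plus_mono2[OF DH B(1)] H by simp
  have mA: "uminus ` A \<subseteq> H" using AH(1) uminus_subgroup[OF H] by blast
  have sub: "uminus ` A \<subseteq> H - (D + B)" using disj mA by blast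
  have cA: "card A \<le> card (H - (D + B))"
    using card_mono[OF _ sub] by simp
  have cD: "card D = card H - card (A + B)"
    unfolding D_def using AH(2) by (simp add: card_Diff_subset)
  have le: "card (A + B) \<le> card H" using AH(2) by (simp add: card_mono)
  show "card A + boundary B A + card D = card H"
    using cD le card_set_plus_boundary[OF B(2), of A] by simp
  show "D \<in> fragments r H B"
    using A DH cA by (auto simp: fragments_def D_def)
  have "card (H - (D + B)) = card H - card (D + B)" "card (D + B) \<le> card H"
    using DB by (auto simp: card_Diff_subset card_mono)
  then have "card (D + B) + card A \<le> card H" using cA by linarith
  then show "boundary B D \<le> boundary B A"
    using cD le card_set_plus_boundary[OF B(2), of A] card_set_plus_boundary[OF B(2), of D] by simp
qed

text \<open>
  An atom: of least boundary, and of least size among the fragments of least boundary. By duality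
  an atom is at most as large as the complement of its sum with \<open>B\<close>, so the union of two atoms
  with large intersection is again a fragment; submodularity makes the intersection one, too.
\<close>

lemma atom_exists:
  fixes B :: "'a::{ab_group_add,finite} set"
  assumes H: "is_subgroup H" and B: "B \<subseteq> H" "B \<noteq> {}" and X0: "X0 \<in> fragments r H B"
  obtains A where "A \<in> fragments r H B"
    and "\<And>X. X \<in> fragments r H B \<Longrightarrow> boundary B A \<le> boundary B X"
    and "\<And>A'. A' \<in> fragments r H B \<Longrightarrow> boundary B A' = boundary B A \<Longrightarrow> card A' = card A
          \<Longrightarrow> r \<le> card (A \<inter> A') \<Longrightarrow> A' = A"
proof -
  let ?F = "fragments r H B"
  obtain A1 where A1: "A1 \<in> ?F" "\<And>X. X \<in> ?F \<Longrightarrow> boundary B A1 \<le> boundary B X"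
    using ex_has_least_nat[of "\<lambda>X. X \<in> ?F" X0 "boundary B"] X0 by blast
  define G where "G X \<longleftrightarrow> X \<in> ?F \<and> boundary B X = boundary B A1" for X
  obtain A where A: "G A" "\<And>X. G X \<Longrightarrow> card A \<le> card X"
    using ex_has_least_nat[of G A1 card] A1(1) by (auto simp: G_def)
  have AF: "A \<in> ?F" and bA: "boundary B A = boundary B A1" using A(1) by (auto simp: G_def)
  have min: "boundary B A \<le> boundary B X" if "X \<in> ?F" for X using A1(2)[OF that] bA by simp
  define D where "D = uminus ` (H - (A + B))"
  have D: "D \<in> ?F" "boundary B D \<le> boundary B A" "card A + boundary B A + card D = card H"
    using fragments_dual[OF H B AF] by (auto simp: D_def)
  have "G D" using D(1,2) min[OF D(1)] bA by (simp add: G_def)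
  then have AD: "card A \<le> card D" by (rule A(2))
  show ?thesis
  proof (rule that[OF AF min])
    fix A' assume A': "A' \<in> ?F" "boundary B A' = boundary B A" "card A' = card A" "r \<le> card (A \<inter> A')"
    have sub: "A + B \<subseteq> H" "A' + B \<subseteq> H"
      using AF A'(1) set_plus_mono2[of _ H B H] B(1) H by (auto simp: fragments_def)
    have inter: "A \<inter> A' \<in> ?F"
    proof -
      have "H - (A + B) \<subseteq> H - ((A \<inter> A') + B)" using set_plus_mono_left[of "A \<inter> A'" A B] by blast
      then have "card (H - (A + B)) \<le> card (H - ((A \<inter> A') + B))" by (intro card_mono) auto
      then show ?thesis using AF A'(4) by (auto simp: fragments_def)
    qed
    have "(A \<inter> A') + B \<subseteq> (A + B) \<inter> (A' + B)"
      using set_plus_mono_left[of "A \<inter> A'" A B] set_plus_mono_left[of "A \<inter> A'" A' B] by blast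
    then have c1: "card ((A \<inter> A') + B) \<le> card ((A + B) \<inter> (A' + B))" by (intro card_mono) auto
    have c2: "card ((A \<union> A') + B) + card ((A + B) \<inter> (A' + B)) = card (A + B) + card (A' + B)"
      using card_Un_Int[of "A + B" "A' + B"] by (simp add: Un_set_plus)
    have c3: "card (A \<union> A') + card (A \<inter> A') = card A + card A'"
      using card_Un_Int[of A A'] by simp
    note bd = card_set_plus_boundary[OF B(2)]
    have c4: "card ((A \<union> A') + B) + card ((A \<inter> A') + B) \<le> card (A \<union> A') + card (A \<inter> A') + 2 * boundary B A"
      using c1 c2 c3 bd[of A] bd[of A'] A'(2) by linarith
    have "boundary B A \<le> boundary B (A \<inter> A')" by (rule min[OF inter])
    then have c5: "card ((A \<union> A') + B) \<le> card (A \<union> A') + boundary B A"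
      using c4 bd[of "A \<inter> A'"] by linarith
    \<comment> \<open>Here \<open>|A \<union> A'| \<le> 2 |A| - r\<close>, and
      \<open>|A| + boundary B A + |D| = |H|\<close> with \<open>|A| \<le> |D|\<close>.\<close>
    have "card ((A \<union> A') + B) + r \<le> card H"
      using c5 c3 A'(3,4) D(3) AD by linarith
    moreover have "(A \<union> A') + B \<subseteq> H" using sub by (simp add: Un_set_plus)
    ultimately have "r \<le> card (H - ((A \<union> A') + B))" by (simp add: card_Diff_subset)
    moreover have "card A \<le> card (A \<union> A')" by (intro card_mono) auto
    ultimately have "A \<union> A' \<in> ?F" using AF A'(1) by (auto simp: fragments_def)
    then have "boundary B A \<le> boundary B (A \<union> A')" by (rule min)
    then have "boundary B (A \<inter> A') \<le> boundary B A"
      using c4 bd[of "A \<inter> A'"] bd[of "A \<union> A'"] by linarith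
    then have "G (A \<inter> A')" using min[OF inter] inter bA by (simp add: G_def)
    then have "card A \<le> card (A \<inter> A')" by (rule A(2))
    then have "A \<inter> A' = A" by (metis Int_lower1 card_seteq finite_class.finite)
    then show "A' = A" using A'(3) by (metis Int_lower2 card_subset_eq finite_class.finite)
  qed
qed

lemma fragments_translate:
  fixes B :: "'a::{ab_group_add,finite} set"
  assumes H: "is_subgroup H" and g: "g \<in> H" and X: "X \<in> fragments r H B"
  shows "g +o X \<in> fragments r H B" and "boundary B (g +o X) = boundary B X"
proof -
  have eq: "H - ((g +o X) + B) = g +o (H - (X + B))"
  proof -
    have "g +o (H - (X + B)) = (g +o H) - (g +o (X + B))"
      by (auto simp: mem_elt_set_plus)
    then show ?thesis by (simp add: subgroup_elt_plus[OF H g] set_plus_rearrange3)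
  qed
  have "g +o X \<subseteq> H"
    using X set_plus_mono[of X H g] by (auto simp: fragments_def subgroup_elt_plus[OF H g])
  then show "g +o X \<in> fragments r H B" using X by (auto simp: fragments_def eq)
  show "boundary B (g +o X) = boundary B X"
    by (simp add: boundary_def set_plus_rearrange3)
qed

text \<open>Translates of a 1-atom are 1-atoms, and two that meet coincide. Hence the atom, moved to
  contain 0, is a subgroup, and its boundary is the least possible.\<close>

lemma mann_subgroup:
  fixes B :: "'a::{ab_group_add,finite} set"
  assumes H: "is_subgroup H" and B: "B \<subseteq> H" "B \<noteq> {}"
    and X: "X \<subseteq> H" "X \<noteq> {}" "X + B \<noteq> H"
  obtains P where "is_subgroup P" "P \<subseteq> H" "P + B \<noteq> H"
    and "card (P + B) + card X \<le> card (X + B) + card P"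
proof -
  have frag: "Y \<in> fragments 1 H B \<longleftrightarrow> Y \<subseteq> H \<and> Y \<noteq> {} \<and> Y + B \<noteq> H" for Y
  proof -
    have "Y + B \<subseteq> H" if "Y \<subseteq> H" using set_plus_mono2[OF that B(1)] H by simp
    then show ?thesis
      by (auto simp: fragments_def card_gt_0_iff Suc_le_eq)
  qed
  have "X \<in> fragments 1 H B" using X frag by blast
  then obtain A where A: "A \<in> fragments 1 H B"
    and min: "\<And>X. X \<in> fragments 1 H B \<Longrightarrow> boundary B A \<le> boundary B X"
    and uniq: "\<And>A'. A' \<in> fragments 1 H B \<Longrightarrow> boundary B A' = boundary B A \<Longrightarrow> card A' = card A
          \<Longrightarrow> 1 \<le> card (A \<inter> A') \<Longrightarrow> A' = A"
    by (rule atom_exists[OF H B]) blast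
  have eq: "(a - a') +o A = A" if "a \<in> A" "a' \<in> A" for a a'
  proof (rule uniq)
    have "a - a' \<in> H" using that A is_subgroupD(4)[OF H] by (auto simp: fragments_def)
    then show "(a - a') +o A \<in> fragments 1 H B" "boundary B ((a - a') +o A) = boundary B A"
      using fragments_translate[OF H _ A] by auto
    have "a \<in> A \<inter> ((a - a') +o A)" using that by (simp add: mem_elt_set_plus)
    then show "1 \<le> card (A \<inter> ((a - a') +o A))"
      by (metis One_nat_def Suc_leI card_gt_0_iff empty_iff finite_class.finite)
  qed simp
  obtain a0 where a0: "a0 \<in> A" using A frag by blast
  define P where "P = (- a0) +o A"
  have "- a0 \<in> H" using a0 A is_subgroupD(2)[OF H] by (auto simp: fragments_def)
  then have P: "P \<in> fragments 1 H B" "boundary B P = boundary B A"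
    using fragments_translate[OF H _ A] by (auto simp: P_def)
  have "x - y \<in> P" if "x \<in> P" "y \<in> P" for x y
  proof -
    have xy: "x + a0 \<in> A" "y + a0 \<in> A" using that by (auto simp: P_def mem_elt_set_plus)
    then have "((x + a0) - (y + a0)) + a0 \<in> A" using eq[OF xy] a0 by (metis set_plus_intro2)
    then show ?thesis by (simp add: P_def mem_elt_set_plus)
  qed
  moreover have "0 \<in> P" using a0 by (simp add: P_def mem_elt_set_plus)
  ultimately have "is_subgroup P" by (simp add: is_subgroup_def)
  moreover have "card (P + B) + card X \<le> card (X + B) + card P"
    using min[of X] X frag P(2) card_set_plus_boundary[OF B(2), of P] card_set_plus_boundary[OF B(2), of X]
    by simp
  ultimately show ?thesis using that[of P] P(1) frag by blast
qed

text \<open>Enlarging \<open>P\<close> to \<open>P + K\<close> does not change \<open>P + B\<close>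
  and can only increase \<open>|P|\<close>.\<close>

lemma mann_subgroup_periodic:
  fixes B :: "'a::{ab_group_add,finite} set"
  assumes H: "is_subgroup H" and K: "is_subgroup K" "K \<subseteq> H" and B: "B \<subseteq> H" "B \<noteq> {}" "B + K = B"
    and X: "X \<subseteq> H" "X \<noteq> {}" "X + B \<noteq> H"
  obtains P where "is_subgroup P" "K \<subseteq> P" "P \<subseteq> H" "P + B \<noteq> H"
    and "card (P + B) + card X \<le> card (X + B) + card P"
proof -
  obtain P where P: "is_subgroup P" "P \<subseteq> H" "P + B \<noteq> H"
    "card (P + B) + card X \<le> card (X + B) + card P"
    by (rule mann_subgroup[OF H B(1,2) X])
  show ?thesis
  proof (rule that[of "P + K"])
    show "is_subgroup (P + K)" using P(1) K(1) by (rule is_subgroup_plus)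
    show "K \<subseteq> P + K" using set_zero_plus2[of P K] is_subgroupD(1)[OF P(1)] by simp
    show "P + K \<subseteq> H" using set_plus_mono2[OF P(2) K(2)] H by simp
    have "(P + K) + B = P + B" using B(3) by (metis add.assoc add.commute)
    moreover have "card P \<le> card (P + K)" using plus_subgroup_superset[OF K(1)] by (intro card_mono) auto
    ultimately show "P + K + B \<noteq> H" "card ((P + K) + B) + card X \<le> card (X + B) + card (P + K)"
      using P(3,4) by simp_all
  qed
qed

text \<open>Kneser's theorem for a difference set.\<close>

lemma card_difference_set:
  fixes B :: "'a::{ab_group_add,finite} set"
  assumes stab: "has_stabilizer (B + uminus ` B) K" and B: "0 \<in> B" "B + K = B"
  shows "2 * card B \<le> card (B + uminus ` B) + card K"
proof -
  note K = has_stabilizerD(1)[OF stab]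
  define H where "H = group_closure B"
  have H: "is_subgroup H" and BH: "B \<subseteq> H" by (auto simp: H_def subset_group_closure group_closure.base)
  have "K \<subseteq> B" using set_zero_plus2[OF B(1), of K] B(2) by simp
  then have KH: "K \<subseteq> H" using BH by blast
  have mBH: "uminus ` B \<subseteq> H" using BH uminus_subgroup[OF H] by blast
  have comm: "uminus ` B + B = B + uminus ` B" by (rule add.commute)
  show ?thesis
  proof (cases "B + uminus ` B = H")
    case True
    then have "H \<subseteq> K" using periodic_subgroup_subset_stabilizer[OF stab] H by simp
    then have "B = K" using \<open>K \<subseteq> B\<close> BH by blast
    then show ?thesis using uminus_subgroup[OF K] K by simp
  next
    case False
    have ne: "B \<noteq> {}" "uminus ` B \<noteq> {}" using B(1) by auto
    have "uminus ` B + B \<noteq> H" using False comm by simp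
    then obtain P where P: "is_subgroup P" "K \<subseteq> P" "P \<subseteq> H" "P + B \<noteq> H"
      "card (P + B) + card B \<le> card (B + uminus ` B) + card P"
      by (rule mann_subgroup_periodic[OF H K KH BH ne(1) B(2) mBH ne(2)]) (auto simp: comm)
    show ?thesis
    proof (cases "card B + card P \<le> card (P + B) + card K")
      case True
      then show ?thesis using P(5) by linarith
    next
      case few: False
      \<comment> \<open>By \<open>few\<close>, less than \<open>|P| - |K|\<close> elements of
        \<open>P + B\<close> are missing from \<open>B\<close>, and the gaps in different cosets add
        up.\<close>
      have holes: "card ((a +o P) - B) + card ((c +o P) - B) + card K < card P"
        if "a \<in> B" "c \<in> B" "a +o P \<noteq> c +o P" for a c
      proof -
        have disj: "((a +o P) - B) \<inter> ((c +o P) - B) = {}"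
          using subgroup_cosets_disjoint[OF P(1) that(3)] by blast
        have "((a +o P) - B) \<union> ((c +o P) - B) \<subseteq> (P + B) - B"
          using set_plus_mono4[OF that(1), of P] set_plus_mono4[OF that(2), of P] by blast
        then have "card (((a +o P) - B) \<union> ((c +o P) - B)) \<le> card ((P + B) - B)"
          by (intro card_mono) auto
        moreover have "card ((P + B) - B) = card (P + B) - card B"
          using set_zero_plus2[of P B] is_subgroupD(1)[OF P(1)] by (intro card_Diff_subset) auto
        moreover have "card B \<le> card (P + B)"
          using set_zero_plus2[of P B] is_subgroupD(1)[OF P(1)] by (intro card_mono) auto
        ultimately show ?thesis using few disj by (simp add: card_Un_disjoint)
      qed
      have part: "card (B \<inter> (a +o P)) + card ((a +o P) - B) = card P" for a
        using card_Int_Diff[of "a +o P" B] by (simp add: Int_commute)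
      have cover: "g \<in> B + uminus ` B"
        if ac: "a \<in> B" "c \<in> B" "card P < card (B \<inter> (a +o P)) + card (B \<inter> (c +o P))"
          "g \<in> (a - c) +o P" for a c g
      proof -
        have "uminus ` (B \<inter> (c +o P)) \<subseteq> (- c) +o P"
        proof
          fix x assume "x \<in> uminus ` (B \<inter> (c +o P))"
          then have "- x - c \<in> P" by (auto simp: mem_uminus_image mem_elt_set_plus)
          then have "- (- x - c) \<in> P" by (rule is_subgroupD(2)[OF P(1)])
          then show "x \<in> (- c) +o P" by (simp add: mem_elt_set_plus add.commute)
        qed
        then have "g \<in> (B \<inter> (a +o P)) + uminus ` (B \<inter> (c +o P))"
          using ac by (intro card_add_gt_imp_mem_set_plus[OF P(1), where a = a and b = "- c"]) auto
        also have "\<dots> \<subseteq> B + uminus ` B" by (intro set_plus_mono2) auto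
        finally show ?thesis .
      qed
      have other: "\<exists>c\<in>B. a +o P \<noteq> c +o P" if "a \<in> B" for a
      proof (rule ccontr)
        assume "\<not> ?thesis"
        then have eq: "c +o P = 0 +o P" if "c \<in> B" for c using that B(1) by metis
        have "c \<in> P" if "c \<in> B" for c
          using eq[OF that] subgroup_coset_eq[OF P(1), of c 0] by simp
        then have "B \<subseteq> P" by blast
        then have "H \<subseteq> P" unfolding H_def by (rule group_closure_subset[OF P(1)])
        then have "P = H" using P(3) by blast
        then have "P + B = H" using subgroup_plus_subset[OF H BH B(1)] by simp
        then show False using P(4) by simp
      qed
      \<comment> \<open>This forces \<open>P \<subseteq> K\<close>, and \<open>few\<close> is
        impossible for \<open>P = K\<close>.\<close>
      have "(B + uminus ` B) + P \<subseteq> B + uminus ` B"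
      proof
        fix g assume "g \<in> (B + uminus ` B) + P"
        then obtain a b p where abp: "g = a + - b + p" "a \<in> B" "b \<in> B" "p \<in> P"
          by (auto elim!: set_plus_elim)
        then have g: "g \<in> (a - b) +o P" by (simp add: mem_elt_set_plus)
        show "g \<in> B + uminus ` B"
        proof (cases "a +o P = b +o P")
          case False
          then show ?thesis
            using holes[OF abp(2,3) False] part[of a] part[of b] cover[OF abp(2,3) _ g] by linarith
        next
          case True
          \<comment> \<open>The coset to be filled is \<open>P\<close> itself, which is the
            difference of any coset with itself. Of two different cosets at least one is more than
            half contained in \<open>B\<close>.\<close>
          obtain c where c: "c \<in> B" "a +o P \<noteq> c +o P" using other[OF abp(2)] by blast
          have eq: "(a - b) +o P = (d - d) +o P" for d
            using True by (simp add: subgroup_coset_eq[OF P(1)] subgroup_elt_plus[OF P(1)])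
          have "2 * card ((a +o P) - B) < card P \<or> 2 * card ((c +o P) - B) < card P"
            using holes[OF abp(2) c] by linarith
          then show ?thesis
          proof
            assume "2 * card ((a +o P) - B) < card P"
            then show ?thesis
              using part[of a] g eq[of a] by (intro cover[OF abp(2) abp(2)]) auto
          next
            assume "2 * card ((c +o P) - B) < card P"
            then show ?thesis
              using part[of c] g eq[of c] by (intro cover[OF c(1) c(1)]) auto
          qed
        qed
      qed
      then have "(B + uminus ` B) + P = B + uminus ` B"
        using plus_subgroup_superset[OF P(1)] by blast
      then have "P \<subseteq> K" by (rule periodic_subgroup_subset_stabilizer[OF stab])
      then have "P = K" using P(2) by blast
      moreover have "card B \<le> card (P + B)"
        using set_zero_plus2[of P B] is_subgroupD(1)[OF P(1)] by (intro card_mono) auto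
      ultimately show ?thesis using few by simp
    qed
  qed
qed

section \<open>Olson's inequality\<close>

text \<open>The function \<open>\<lambda>_B(x)\<close> of Erdos, Heilbronn and Olson. By
  \<open>card_plus_zero_two\<close> it is the number of new sums when \<open>x\<close> joins the set
  whose sums form \<open>B\<close>.\<close>

definition shift_gain :: "'a::ab_group_add set \<Rightarrow> 'a \<Rightarrow> nat"
  where "shift_gain B x = card ((x +o B) - B)"

text \<open>Starting from \<open>K\<close> instead of \<open>{0}\<close> makes every ball a union of
  cosets of \<open>K\<close>.\<close>

primrec ball :: "'a::ab_group_add set \<Rightarrow> 'a set \<Rightarrow> nat \<Rightarrow> 'a set"
  where "ball K S 0 = K"
  | "ball K S (Suc j) = ball K S j + insert 0 S"

lemma shift_gain_Int:
  fixes B :: "'a::{ab_group_add,finite} set"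
  shows "shift_gain B x + card (B \<inter> (x +o B)) = card B"
  using card_Int_Diff[of "x +o B" B] by (simp add: shift_gain_def Int_commute)

lemma shift_gain_uminus:
  fixes B :: "'a::{ab_group_add,finite} set"
  shows "shift_gain B (- x) = shift_gain B x"
proof -
  have "x +o (B \<inter> ((- x) +o B)) = B \<inter> (x +o B)"
    by (auto simp: mem_elt_set_plus)
  then have "card (B \<inter> ((- x) +o B)) = card (B \<inter> (x +o B))"
    by (metis card_elt_set_plus)
  then show ?thesis using shift_gain_Int[of B x] shift_gain_Int[of B "- x"] by simp
qed

text \<open>If \<open>x + y + b\<close> is outside \<open>B\<close>, then either
  \<open>y + b\<close> already is, or \<open>y + b \<in> B\<close> is carried out by
  \<open>x\<close>.\<close>

lemma shift_gain_add:
  fixes B :: "'a::{ab_group_add,finite} set"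
  shows "shift_gain B (x + y) \<le> shift_gain B x + shift_gain B y"
proof -
  have "((x + y) +o B) - B \<subseteq> (x +o ((y +o B) - B)) \<union> ((x +o B) - B)"
    by (auto simp: mem_elt_set_plus algebra_simps)
  then have "shift_gain B (x + y) \<le> card ((x +o ((y +o B) - B)) \<union> ((x +o B) - B))"
    unfolding shift_gain_def by (intro card_mono) auto
  also have "\<dots> \<le> card (x +o ((y +o B) - B)) + card ((x +o B) - B)" by (rule card_Un_le)
  finally show ?thesis by (simp add: shift_gain_def)
qed

lemma shift_gain_eq_0_iff:
  fixes B :: "'a::{ab_group_add,finite} set"
  shows "shift_gain B x = 0 \<longleftrightarrow> x +o B \<subseteq> B"
  by (simp add: shift_gain_def)

lemma card_plus_zero_two:
  fixes B :: "'a::{ab_group_add,finite} set"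
  shows "card (B + {0, x}) = card B + shift_gain B x"
proof -
  have "card (B \<union> (x +o B)) = card (B \<union> ((x +o B) - B))" by (simp add: Un_Diff_cancel)
  also have "\<dots> = card B + shift_gain B x" unfolding shift_gain_def by (rule card_Un_disjoint) auto
  finally show ?thesis by (simp add: set_plus_zero_two)
qed

text \<open>Elements \<open>b\<close> of \<open>A + {0, x}\<close> with \<open>b + x\<close> outside lie outside \<open>A\<close>.\<close>

lemma shift_gain_plus_zero_two:
  fixes B :: "'a::{ab_group_add,finite} set"
  shows "shift_gain (B + {0, x}) x \<le> shift_gain B x"
proof -
  have "(x +o (B + {0, x})) - (B + {0, x}) \<subseteq> x +o ((x +o B) - B)"
    by (auto simp: set_plus_zero_two mem_elt_set_plus)
  then show ?thesis
    unfolding shift_gain_def using card_mono[of "x +o ((x +o B) - B)"] by simp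
qed

lemma shift_gain_translate:
  fixes B :: "'a::{ab_group_add,finite} set"
  shows "shift_gain (a +o B) x = shift_gain B x"
proof -
  have "(x +o (a +o B)) - (a +o B) = a +o ((x +o B) - B)"
    by (auto simp: mem_elt_set_plus algebra_simps)
  then show ?thesis by (simp add: shift_gain_def)
qed

lemma shift_gain_plus_zero_uminus:
  fixes B :: "'a::{ab_group_add,finite} set"
  shows "shift_gain (B + {0, - x}) x \<le> shift_gain B x"
proof -
  have "x +o (B + {0, - x}) = B + {0, x}"
    by (auto simp: set_plus_zero_two mem_elt_set_plus)
  then have "shift_gain (B + {0, - x}) x = shift_gain (B + {0, x}) x"
    by (metis shift_gain_translate)
  then show ?thesis using shift_gain_plus_zero_two[of B x] by simp
qed

lemma shift_gain_periodic:
  assumes "is_subgroup K" "B + K = B" "x - y \<in> K"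
  shows "shift_gain B x = shift_gain B y"
proof -
  have "z +o B = (z +o K) + B" for z
    using assms(2) by (metis add.commute set_plus_rearrange3)
  then have "x +o B = y +o B" using assms subgroup_coset_eq[of K x y] by simp
  then show ?thesis by (simp add: shift_gain_def)
qed

lemma dvd_shift_gain:
  fixes B :: "'a::{ab_group_add,finite} set"
  assumes "is_subgroup K" "B + K = B"
  shows "card K dvd shift_gain B x"
proof -
  have "card K dvd card A" if "A + K = A" for A :: "'a set"
    using card_plus_subgroup[OF assms(1), of A] that by simp
  then have "card K dvd card B" "card K dvd card (B + {0, x})"
    using assms(2) by (metis add.assoc add.commute)+
  then show ?thesis using card_plus_zero_two[of B x] by (metis dvd_add_right_iff)
qed

text \<open>A pair of elements of \<open>B\<close> determines the shift that takes one to the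
  other.\<close>

lemma sum_card_Int_translate:
  fixes B :: "'a::{ab_group_add,finite} set"
  shows "(\<Sum>x\<in>T. card (B \<inter> (x +o B))) \<le> card B ^ 2"
proof -
  have "(\<Sum>x\<in>T. card (B \<inter> (x +o B))) = card (SIGMA x:T. B \<inter> (x +o B))"
    by simp
  also have "\<dots> = card ((\<lambda>(x, b). (b, b - x)) ` (SIGMA x:T. B \<inter> (x +o B)))"
    by (rule card_image[symmetric]) (auto simp: inj_on_def)
  also have "\<dots> \<le> card (B \<times> B)"
    by (rule card_mono) (auto simp: mem_elt_set_plus)
  finally show ?thesis by (simp add: card_cartesian_product power2_eq_square)
qed

text \<open>An \<open>x\<close> that first appears in \<open>T i\<close> overlaps by at least
  \<open>|B| - i m = (|B| - k m) + m (k - i)\<close>, and at most \<open>k - i\<close> of the sets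
  \<open>T j\<close> with \<open>j < k\<close> contain it. Summing over \<open>T k\<close> and
  exchanging the order of summation gives the left side; the total overlap is at most
  \<open>|B|^2\<close>.\<close>

lemma olson_inequality:
  fixes B :: "'a::{ab_group_add,finite} set" and T :: "nat \<Rightarrow> 'a set"
  assumes T: "\<And>j. j < k \<Longrightarrow> T j \<subseteq> T k" and gain: "\<And>j x. j \<le> k \<Longrightarrow> x \<in> T j \<Longrightarrow> shift_gain B x \<le> j * m"
    and km: "k * m \<le> card B"
  shows "(card B - k * m) * card (T k) + m * (\<Sum>j<k. card (T j)) \<le> card B ^ 2"
proof -
  have r: "(card B - k * m) + m * card {j. j < k \<and> x \<in> T j} \<le> card (B \<inter> (x +o B))" if "x \<in> T k" for x
  proof -
    define J where "J = {j. j \<le> k \<and> x \<in> T j}"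
    have J: "finite J" "J \<noteq> {}" using that by (auto simp: J_def)
    define i where "i = Min J"
    have i: "i \<le> k" "x \<in> T i" using Min_in[OF J] by (auto simp: i_def J_def)
    have "{j. j < k \<and> x \<in> T j} \<subseteq> {i..<k}"
      using Min_le[OF J(1)] by (auto simp: i_def J_def)
    then have "card {j. j < k \<and> x \<in> T j} \<le> k - i" using card_mono[of "{i..<k}"] by auto
    then have "m * card {j. j < k \<and> x \<in> T j} \<le> m * (k - i)" by (rule mult_left_mono) simp
    moreover have "m * (k - i) = k * m - i * m" "i * m \<le> k * m"
      using i(1) by (simp_all add: right_diff_distrib' mult.commute)
    ultimately show ?thesis
      using gain[OF i] shift_gain_Int[of B x] km by linarith
  qed
  have "(\<Sum>x\<in>T k. card {j. j < k \<and> x \<in> T j}) = card (SIGMA x:T k. {j. j < k \<and> x \<in> T j})" by simp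
  also have "\<dots> = card ((\<lambda>(x, j). (j, x)) ` (SIGMA x:T k. {j. j < k \<and> x \<in> T j}))"
    by (rule card_image[symmetric]) (auto simp: inj_on_def)
  also have "(\<lambda>(x, j). (j, x)) ` (SIGMA x:T k. {j. j < k \<and> x \<in> T j}) = (SIGMA j:{..<k}. T j)"
    using T by force
  finally have swap: "(\<Sum>x\<in>T k. card {j. j < k \<and> x \<in> T j}) = (\<Sum>j<k. card (T j))" by simp
  have "(card B - k * m) * card (T k) + m * (\<Sum>j<k. card (T j))
      = (\<Sum>x\<in>T k. (card B - k * m) + m * card {j. j < k \<and> x \<in> T j})"
    by (simp add: sum.distrib swap sum_distrib_left[symmetric])
  also have "\<dots> \<le> (\<Sum>x\<in>T k. card (B \<inter> (x +o B)))" by (rule sum_mono) (rule r)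
  also have "\<dots> \<le> card B ^ 2" by (rule sum_card_Int_translate)
  finally show ?thesis .
qed

lemma zero_mem_ball: "is_subgroup K \<Longrightarrow> 0 \<in> ball K S j"
proof (induction j)
  case (Suc j)
  then have "0 \<in> ball K S j" by simp
  then show ?case using set_plus_intro[of 0 "ball K S j" 0 "insert 0 S"] by simp
qed (simp add: is_subgroup_def)

lemma ball_mono: "i \<le> j \<Longrightarrow> ball K S i \<subseteq> ball K S j"
  by (induction j) (auto simp: le_Suc_eq intro: set_plus_superset[THEN subsetD])

lemma shift_gain_ball:
  fixes B :: "'a::{ab_group_add,finite} set"
  assumes K: "is_subgroup K" "B + K = B" and m: "\<And>s. s \<in> S \<Longrightarrow> shift_gain B s \<le> m"
  shows "x \<in> ball K S j \<Longrightarrow> shift_gain B x \<le> j * m"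
proof (induction j arbitrary: x)
  case 0
  have "shift_gain B x = shift_gain B 0" using 0 by (intro shift_gain_periodic[OF K]) simp
  then show ?case by (simp add: shift_gain_def)
next
  case (Suc j)
  then have "x \<in> ball K S j + insert 0 S" by simp
  then obtain y s where x: "x = y + s" "y \<in> ball K S j" "s \<in> insert 0 S" by (rule set_plus_elim)
  have "shift_gain B s \<le> m" using x(3) m by (auto simp: shift_gain_def)
  then show ?case using Suc.IH[OF x(2)] shift_gain_add[of B y s] by (simp add: x(1))
qed

section \<open>The number of balls in Olson's inequality\<close>

lemma sum_odd_progression: "(\<Sum>j<k. 2 * p * j + 1) + p * k = p * k * k + (k::nat)"
  by (induction k) (auto simp: algebra_simps)

text \<open>The parameter is \<open>\<beta> / p\<close> rounded up: the guaranteed ball size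
  \<open>2 p j + 1\<close> stays below \<open>2 \<beta>\<close> for \<open>j < k\<close> and passes
  it at \<open>j = k\<close>. The last inequality contradicts \<open>olson_inequality\<close>, so
  that the hypothesis on \<open>p (p - 1)\<close> fails for the largest gain
  \<open>\<mu>\<close>.\<close>

lemma olson_parameter_exists:
  fixes \<beta> \<mu> p :: nat
  assumes "0 < \<beta>" "\<mu> < p" "p * (p - 1) \<le> \<beta> * (p - \<mu>)"
  obtains k where "k * \<mu> \<le> \<beta>" "2 * \<beta> \<le> 2 * p * k" "\<And>j. j < k \<Longrightarrow> 2 * p * j + 1 \<le> 2 * \<beta>"
    and "\<beta> ^ 2 < (\<beta> - k * \<mu>) * (2 * \<beta>) + \<mu> * (\<Sum>j<k. 2 * p * j + 1)"
proof -
  define k where "k = (\<beta> + p - 1) div p"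
  have p: "0 < p" using assms by simp
  have k1: "p * k \<le> \<beta> + p - 1" unfolding k_def by (rule times_div_less_eq_dividend)
  have "\<beta> + p - 1 < p * k + p"
    unfolding k_def using dividend_less_times_div[OF p, of "\<beta> + p - 1"] by linarith
  then have k2: "\<beta> \<le> p * k" using p by linarith
  have k0: "0 < k" using k2 assms(1) by (cases k) auto
  have "p * (k * \<mu>) \<le> (\<beta> + p - 1) * \<mu>" using k1 by (metis mult.assoc mult_le_mono1)
  moreover have "(\<beta> + p - 1) * \<mu> + \<beta> * (p - \<mu>) = \<beta> * p + (p - 1) * \<mu>"
  proof -
    obtain d where "p = Suc (\<mu> + d)" using less_imp_Suc_add[OF assms(2)] by blast
    then show ?thesis by (simp add: algebra_simps)
  qed
  moreover have "(p - 1) * \<mu> \<le> p * (p - 1)" using assms(2) by (simp add: mult.commute)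
  ultimately have "p * (k * \<mu>) \<le> p * \<beta>" using assms(3) mult.commute[of \<beta> p] by linarith
  then have k3: "k * \<mu> \<le> \<beta>" using p by simp
  show ?thesis
  proof (rule that[OF k3])
    show "2 * \<beta> \<le> 2 * p * k" using k2 by simp
    show "2 * p * j + 1 \<le> 2 * \<beta>" if "j < k" for j
    proof -
      have "p * j + p \<le> p * k" using that by (metis Suc_leI mult_Suc_right mult_le_mono2 add.commute)
      then show ?thesis using k1 assms(1) p by simp
    qed
    define y where "y = int \<beta> - int k * int \<mu>"
    define w where "w = int k * (int p - int \<mu>)"
    have y0: "0 \<le> y" using k3 by (simp add: y_def flip: of_nat_mult)
    have h: "int p * (int p - 1) \<le> int \<beta> * (int p - int \<mu>)"
      using assms(2,3) by (simp add: of_nat_diff flip: of_nat_mult)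
         (metis (no_types) of_nat_mult of_nat_diff less_imp_le of_nat_le_iff One_nat_def Suc_leI of_nat_1 p)
    have "int \<beta> * (int p - int \<mu>) \<le> int p * w"
      using k2 assms(2) mult_right_mono[of "int \<beta>" "int p * int k" "int p - int \<mu>"]
      by (simp add: w_def mult.assoc flip: of_nat_mult)
    then have "int p * (int p - 1) \<le> int p * w" using h by linarith
    then have w: "int p - 1 \<le> w" using p by simp
    \<comment> \<open>With \<open>\<beta> = y + k \<mu>\<close>, this is the difference of the two
      sides to be compared. The hypothesis gives \<open>w \<ge> p - 1\<close>, so both summands are
      nonnegative; if \<open>w = p - 1\<close> and \<open>y = 0\<close>, then \<open>p = 1\<close>
      and \<open>\<mu> = 0\<close>, hence \<open>\<beta> = 0\<close>.\<close>
    have pos: "0 < y * y + int k * int \<mu> * (w - int p + 1)"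
    proof (cases "w = int p - 1 \<and> y = 0")
      case True
      then have b: "int \<beta> = int k * int \<mu>" by (simp add: y_def)
      have "int \<beta> * (int p - int \<mu>) = int \<mu> * w" by (simp add: b w_def)
      also have "\<dots> = int \<mu> * (int p - 1)" using True by simp
      finally have "int p * (int p - 1) \<le> int \<mu> * (int p - 1)" using h by simp
      then have "p \<le> 1" using assms(2) by (cases "p \<le> 1") (auto simp: mult_le_cancel_right)
      then have "\<mu> = 0" "p = 1" using assms(2) by auto
      then show ?thesis using b assms(1) by simp
    next
      case False
      show ?thesis
      proof (cases "\<mu> = 0")
        case True
        then have "y > 0" using assms(1) by (simp add: y_def)
        then show ?thesis using True by simp
      next
        case mu: False
        have "0 \<le> int k * int \<mu> * (w - int p + 1)" using w by simp
        moreover have "0 < int k * int \<mu> * (w - int p + 1)" if "w \<noteq> int p - 1"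
          using that w k0 mu by simp
        moreover have "0 < y * y" if "y \<noteq> 0" using that y0 by simp
        moreover have "0 \<le> y * y" by simp
        ultimately show ?thesis using False by linarith
      qed
    qed
    have S: "int (\<Sum>j<k. 2 * p * j + 1) = int p * int k * int k + int k - int p * int k"
      using arg_cong[OF sum_odd_progression[of p k], of int] by simp
    have "int \<beta> ^ 2 < y * (2 * int \<beta>) + int \<mu> * (int p * int k * int k + int k - int p * int k)"
    proof -
      have b: "int \<beta> = y + int k * int \<mu>" by (simp add: y_def)
      show ?thesis using pos unfolding b w_def by (simp add: power2_eq_square algebra_simps)
    qed
    then have "int (\<beta> ^ 2) < int ((\<beta> - k * \<mu>) * (2 * \<beta>) + \<mu> * (\<Sum>j<k. 2 * p * j + 1))"
      unfolding of_nat_power of_nat_add of_nat_mult S of_nat_diff[OF k3] of_nat_numeral y_def .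
    then show "\<beta> ^ 2 < (\<beta> - k * \<mu>) * (2 * \<beta>) + \<mu> * (\<Sum>j<k. 2 * p * j + 1)"
      by (simp only: of_nat_less_iff)
  qed
qed

text \<open>
  If every shift by an element of \<open>S\<close> gains at most \<open>\<mu> |K|\<close>, shifts by elements of the \<open>j\<close>-th ball
  gain at most \<open>j \<mu> |K|\<close>; when the balls grow, this is too little for all the shifts together.
\<close>

lemma shift_gain_large:
  fixes B :: "'a::{ab_group_add,finite} set"
  assumes K: "is_subgroup K" "B + K = B" and \<beta>: "card B = card K * \<beta>" "0 < \<beta>"
    and growth: "\<And>j. min (2 * card B) (card K * (2 * p * j + 1)) \<le> card (ball K S j)"
    and gain: "\<And>s. s \<in> S \<Longrightarrow> shift_gain B s \<le> card K * \<mu>"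
    and \<mu>: "\<mu> < p" "p * (p - 1) \<le> \<beta> * (p - \<mu>)"
  shows False
proof -
  obtain k where k: "k * \<mu> \<le> \<beta>" "2 * \<beta> \<le> 2 * p * k" "\<And>j. j < k \<Longrightarrow> 2 * p * j + 1 \<le> 2 * \<beta>"
    "\<beta> ^ 2 < (\<beta> - k * \<mu>) * (2 * \<beta>) + \<mu> * (\<Sum>j<k. 2 * p * j + 1)"
    using olson_parameter_exists[OF \<beta>(2) \<mu>] by blast
  let ?\<kappa> = "card K"
  have pos: "0 < ?\<kappa>" by (rule card_subgroup_pos[OF K(1)])
  have small: "?\<kappa> * (2 * p * j + 1) \<le> card (ball K S j)" if "j < k" for j
  proof -
    have "?\<kappa> * (2 * p * j + 1) \<le> ?\<kappa> * (2 * \<beta>)" using k(3)[OF that] by (rule mult_le_mono2)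
    then show ?thesis using growth[of j] \<beta>(1) by simp
  qed
  have "?\<kappa> * (2 * \<beta>) \<le> ?\<kappa> * (2 * p * k + 1)" using k(2) by (intro mult_le_mono2) simp
  then have big: "?\<kappa> * (2 * \<beta>) \<le> card (ball K S k)" using growth[of k] \<beta>(1) by simp
  have "(card B - k * (?\<kappa> * \<mu>)) * card (ball K S k) + ?\<kappa> * \<mu> * (\<Sum>j<k. card (ball K S j)) \<le> card B ^ 2"
  proof (rule olson_inequality)
    show "ball K S j \<subseteq> ball K S k" if "j < k" for j using that by (intro ball_mono) simp
    show "shift_gain B x \<le> j * (?\<kappa> * \<mu>)" if "x \<in> ball K S j" for j x
      using shift_gain_ball[OF K gain that] .
    show "k * (?\<kappa> * \<mu>) \<le> card B" using k(1) by (simp add: \<beta>(1))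
  qed
  moreover have "card B - k * (?\<kappa> * \<mu>) = ?\<kappa> * (\<beta> - k * \<mu>)"
    by (simp add: \<beta>(1) right_diff_distrib' mult.left_commute)
  moreover have "?\<kappa> * (\<beta> - k * \<mu>) * (?\<kappa> * (2 * \<beta>)) \<le> ?\<kappa> * (\<beta> - k * \<mu>) * card (ball K S k)"
    using big by (rule mult_le_mono2)
  moreover have "?\<kappa> * \<mu> * (\<Sum>j<k. ?\<kappa> * (2 * p * j + 1)) \<le> ?\<kappa> * \<mu> * (\<Sum>j<k. card (ball K S j))"
    using small by (intro mult_le_mono2 sum_mono) simp
  moreover have "?\<kappa> * (\<beta> - k * \<mu>) * (?\<kappa> * (2 * \<beta>)) + ?\<kappa> * \<mu> * (\<Sum>j<k. ?\<kappa> * (2 * p * j + 1))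
     = ?\<kappa> ^ 2 * ((\<beta> - k * \<mu>) * (2 * \<beta>) + \<mu> * (\<Sum>j<k. 2 * p * j + 1))"
  proof -
    have "(\<Sum>j<k. ?\<kappa> * (2 * p * j + 1)) = ?\<kappa> * (\<Sum>j<k. 2 * p * j + 1)"
      by (rule sum_distrib_left[symmetric])
    then show ?thesis by (simp only: power2_eq_square distrib_left ac_simps)
  qed
  ultimately have "?\<kappa> ^ 2 * ((\<beta> - k * \<mu>) * (2 * \<beta>) + \<mu> * (\<Sum>j<k. 2 * p * j + 1)) \<le> ?\<kappa> ^ 2 * \<beta> ^ 2"
    unfolding \<beta>(1) power_mult_distrib by (simp only:)
  then show False using k(4) pos by (simp only: mult_le_cancel1 zero_less_power) simp
qed

section \<open>Subset sums\<close>

lemma subset_sums_empty [simp]: "subset_sums {} = {0}"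
  by (auto simp: subset_sums_def)

lemma zero_mem_subset_sums [simp]: "0 \<in> subset_sums S"
  unfolding subset_sums_def by (rule CollectI, rule exI[of _ "{}"]) simp

lemma sum_mem_subset_sums: "U \<subseteq> S \<Longrightarrow> \<Sum>U \<in> subset_sums S"
  by (auto simp: subset_sums_def)

lemma subset_sums_mono: "S \<subseteq> T \<Longrightarrow> subset_sums S \<subseteq> subset_sums T"
  unfolding subset_sums_def by blast

lemma subset_subset_sums: "S \<subseteq> subset_sums S"
proof
  fix s assume "s \<in> S"
  then show "s \<in> subset_sums S" using sum_mem_subset_sums[of "{s}" S] by simp
qed

lemma subset_sums_Un:
  fixes S T :: "'a::{ab_group_add,finite} set"
  assumes "S \<inter> T = {}"
  shows "subset_sums (S \<union> T) = subset_sums S + subset_sums T"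
proof
  show "subset_sums (S \<union> T) \<subseteq> subset_sums S + subset_sums T"
  proof
    fix x assume "x \<in> subset_sums (S \<union> T)"
    then obtain X where X: "X \<subseteq> S \<union> T" "x = \<Sum>X" by (auto simp: subset_sums_def)
    have "X = (X \<inter> S) \<union> (X \<inter> T)" using X(1) by blast
    then have "x = \<Sum>(X \<inter> S) + \<Sum>(X \<inter> T)"
      using assms X(2) sum.union_disjoint[of "X \<inter> S" "X \<inter> T" "\<lambda>x. x"] by auto
    then show "x \<in> subset_sums S + subset_sums T"
      using sum_mem_subset_sums[of "X \<inter> S" S] sum_mem_subset_sums[of "X \<inter> T" T] by auto
  qed
  show "subset_sums S + subset_sums T \<subseteq> subset_sums (S \<union> T)"
  proof
    fix x assume "x \<in> subset_sums S + subset_sums T"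
    then obtain X Y where "x = \<Sum>X + \<Sum>Y" "X \<subseteq> S" "Y \<subseteq> T"
      by (auto simp: subset_sums_def elim!: set_plus_elim)
    moreover from this have "x = \<Sum>(X \<union> Y)"
      using assms by (subst sum.union_disjoint) auto
    ultimately show "x \<in> subset_sums (S \<union> T)"
      using sum_mem_subset_sums[of "X \<union> Y" "S \<union> T"] by auto
  qed
qed

lemma subset_sums_singleton: "subset_sums {y} = {0, y}" for y :: "'a::ab_group_add"
proof -
  have "{X. X \<subseteq> {y}} = {{}, {y}}" by (auto simp: subset_singleton_iff)
  moreover have "subset_sums {y} = (\<lambda>X. \<Sum>X) ` {X. X \<subseteq> {y}}" by (auto simp: subset_sums_def)
  ultimately show ?thesis by simp
qed

lemma subset_sums_insert:
  fixes S :: "'a::{ab_group_add,finite} set"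
  assumes "y \<notin> S"
  shows "subset_sums (insert y S) = subset_sums S + {0, y}"
  using subset_sums_Un[of S "{y}"] assms by (simp add: subset_sums_singleton)

lemma subset_sums_remove:
  fixes S :: "'a::{ab_group_add,finite} set"
  assumes "y \<in> S"
  shows "subset_sums S = subset_sums (S - {y}) + {0, y}"
  using subset_sums_insert[of y "S - {y}"] assms by (simp add: insert_absorb)

lemma subset_sums_Diff:
  fixes S :: "'a::{ab_group_add,finite} set"
  assumes "T \<subseteq> S"
  shows "subset_sums S = subset_sums T + subset_sums (S - T)"
  using subset_sums_Un[of T "S - T"] assms by (simp add: Un_absorb1)

lemma subset_sums_uminus:
  fixes S :: "'a::ab_group_add set"
  shows "subset_sums (uminus ` S) = uminus ` subset_sums S"
proof -
  have *: "\<Sum>(uminus ` X) = - \<Sum>X" for X :: "'a set"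
    by (simp add: sum.reindex sum_negf)
  show ?thesis
    unfolding subset_sums_def by (auto simp: subset_image_iff * image_iff) (metis * )
qed

lemma subset_sums_subset_subgroup:
  fixes L :: "'a::{ab_group_add,finite} set"
  assumes "is_subgroup L" "S \<subseteq> L"
  shows "subset_sums S \<subseteq> L"
proof -
  have "\<Sum>X \<in> L" if "finite X" "X \<subseteq> L" for X
    using that by (induction X rule: finite_induct) (auto simp: is_subgroupD[OF assms(1)])
  then show ?thesis using assms(2) by (auto simp: subset_sums_def)
qed

lemma symmetric_set_mem: "symmetric_set S \<Longrightarrow> - s \<in> S \<longleftrightarrow> s \<in> S"
  unfolding symmetric_set_def by (metis mem_uminus_image)

lemma symmetric_setI: "(\<And>s. s \<in> S \<Longrightarrow> - s \<in> S) \<Longrightarrow> symmetric_set S"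
  unfolding symmetric_set_def by (metis (no_types, opaque_lifting) add.inverse_inverse mem_uminus_image set_eqI)

lemma symmetric_set_Int_subgroup: "symmetric_set S \<Longrightarrow> is_subgroup L \<Longrightarrow> symmetric_set (S \<inter> L)"
  by (rule symmetric_setI) (auto simp: symmetric_set_mem is_subgroupD)

lemma symmetric_set_Diff: "symmetric_set S \<Longrightarrow> symmetric_set T \<Longrightarrow> symmetric_set (S - T)"
  by (rule symmetric_setI) (auto simp: symmetric_set_mem)

lemma symmetric_set_pair: "symmetric_set {z, - z}" for z :: "'a::ab_group_add"
  by (rule symmetric_setI) auto

section \<open>Subset sums aperiodic modulo a subgroup\<close>

text \<open>\<open>subset_sums T\<close> is a summand of \<open>subset_sums S\<close>, and a period
  of a summand is a period of the sum. This lets all inductions pass to subsets.\<close>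

lemma has_stabilizer_subset:
  fixes S :: "'a::{ab_group_add,finite} set"
  assumes "has_stabilizer (subset_sums S + K) K" "T \<subseteq> S"
  shows "has_stabilizer (subset_sums T + K) K"
proof -
  note K = has_stabilizerD(1)[OF assms(1)]
  have "subset_sums S + K = (subset_sums T + K) + subset_sums (S - T)"
    unfolding subset_sums_Diff[OF assms(2)] by (simp add: ac_simps)
  then have "has_stabilizer ((subset_sums T + K) + subset_sums (S - T)) K" using assms(1) by simp
  then show ?thesis
    by (rule has_stabilizer_summand) (simp add: add.assoc K)
qed

text \<open>Otherwise the sums of the single element \<open>s\<close> are invariant under
  \<open>s\<close> modulo \<open>K\<close>.\<close>

lemma double_notin_stabilizer:
  fixes S :: "'a::{ab_group_add,finite} set"
  assumes "has_stabilizer (subset_sums S + K) K" "s \<in> S" "s \<notin> K"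
  shows "s + s \<notin> K"
proof
  assume ss: "s + s \<in> K"
  have st: "has_stabilizer ({0, s} + K) K"
    using has_stabilizer_subset[OF assms(1), of "{s}"] assms(2) by (simp add: subset_sums_singleton)
  note K = has_stabilizerD(1)[OF st]
  have "s +o ({0, s} + K) = (s +o K) \<union> ((s + s) +o K)"
    by (simp add: set_plus_rearrange4[symmetric] add.commute[of "{0, s}"] set_plus_two
        set_plus_rearrange2 image_Un elt_set_plus_eq_image image_image add.assoc)
  also have "\<dots> \<subseteq> {0, s} + K"
    by (simp add: add.commute[of "{0, s}"] set_plus_zero_two subgroup_elt_plus[OF K ss])
  finally show False using has_stabilizerD(3)[OF st] assms(3) by blast
qed

text \<open>Taking one representative per class, each new one has nonzero gain by aperiodicity, and
  gains are multiples of \<open>|K|\<close>. The additional \<open>|K|\<close> comes from the empty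
  sum.\<close>

lemma card_subset_sums_ge:
  fixes S :: "'a::{ab_group_add,finite} set"
  assumes st: "has_stabilizer (subset_sums S + K) K" and SK: "S \<inter> K = {}"
  shows "card K + card (S + K) \<le> card (subset_sums S + K)"
proof -
  note K = has_stabilizerD(1)[OF st]
  obtain T where T: "T \<subseteq> S" "inj_on (\<lambda>s. s +o K) T" "cosets_of K S = (\<lambda>s. s +o K) ` T"
    using subset_image_inj[of "cosets_of K S" "\<lambda>s. s +o K" S] by (auto simp: cosets_of_def)
  have cT: "card T = card (cosets_of K S)" unfolding T(3) by (rule card_image[symmetric, OF T(2)])
  have "card K * (1 + card U) \<le> card (subset_sums U + K)" if "finite U" "U \<subseteq> S" for U
    using that
  proof (induction U rule: finite_induct)
    case (insert s U)
    let ?D = "subset_sums U + K"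
    have D: "has_stabilizer ?D K" using insert.prems by (intro has_stabilizer_subset[OF st]) simp
    have "s \<notin> K" using insert.prems SK by blast
    then have "shift_gain ?D s \<noteq> 0" using has_stabilizerD(3)[OF D] by (auto simp: shift_gain_eq_0_iff)
    moreover have "card K dvd shift_gain ?D s" by (rule dvd_shift_gain[OF K has_stabilizerD(2)[OF D]])
    ultimately have "card K \<le> shift_gain ?D s" by (simp add: dvd_imp_le)
    moreover have "subset_sums (insert s U) + K = ?D + {0, s}"
      using insert.hyps(2) by (simp add: subset_sums_insert ac_simps)
    ultimately show ?case using insert card_plus_zero_two[of ?D s] by simp
  qed (simp add: K)
  then have "card K * (1 + card T) \<le> card (subset_sums T + K)" using T(1) by simp
  also have "\<dots> \<le> card (subset_sums S + K)"
    using subset_sums_mono[OF T(1)] by (intro card_mono set_plus_mono_left) auto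
  finally show ?thesis by (simp add: card_plus_subgroup[OF K] cT)
qed

lemma is_halfD:
  fixes S :: "'a::{ab_group_add,finite} set"
  assumes "is_half S Y"
  shows "Y \<subseteq> S" "S = Y \<union> uminus ` Y" "2 * card Y = card S" "Y \<inter> uminus ` Y = {}"
proof -
  show *: "Y \<subseteq> S" "S = Y \<union> uminus ` Y" "2 * card Y = card S" using assms by (auto simp: is_half_def)
  have "card (Y \<union> uminus ` Y) + card (Y \<inter> uminus ` Y) = 2 * card Y"
    using card_Un_Int[of Y "uminus ` Y"] by simp
  then have "card (Y \<inter> uminus ` Y) = 0" using * by simp
  then show "Y \<inter> uminus ` Y = {}" by simp
qed

lemma half_exists_relative:
  fixes S :: "'a::{ab_group_add,finite} set"
  assumes "has_stabilizer (subset_sums S + K) K" "S \<inter> K = {}" "symmetric_set S"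
  shows "\<exists>Y. is_half S Y"
proof (rule half_exists_aux)
  note K = has_stabilizerD(1)[OF assms(1)]
  show "\<forall>s\<in>S. - s \<in> S \<and> - s \<noteq> s"
  proof
    fix s assume s: "s \<in> S"
    then have "s + s \<notin> K" using double_notin_stabilizer[OF assms(1)] assms(2) by blast
    then have "- s \<noteq> s" using is_subgroupD(1)[OF K] by (metis add.right_inverse)
    then show "- s \<in> S \<and> - s \<noteq> s" using s symmetric_set_mem[OF assms(3)] by blast
  qed
qed simp

lemma subset_sums_half:
  fixes S :: "'a::{ab_group_add,finite} set"
  assumes "is_half S Y" "is_subgroup K"
  shows "subset_sums S + K = (subset_sums Y + K) + uminus ` (subset_sums Y + K)"
proof -
  have "subset_sums S = subset_sums Y + uminus ` subset_sums Y"
    using is_halfD(2,4)[OF assms(1)] subset_sums_Un[of Y "uminus ` Y"] by (simp add: subset_sums_uminus)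
  moreover have "K + K = K" "uminus ` K = K" using assms(2) uminus_subgroup by auto
  ultimately show ?thesis by (metis (no_types, lifting) uminus_set_plus add.assoc add.commute)
qed

section \<open>Filling cosets with sums\<close>

lemma sum_const_card: "(\<Sum>u\<in>U. z) = (\<Sum>i<card U. z)" if "finite U"
  using that by (induction U rule: finite_induct) (auto simp: add.commute)

lemma sum_in_coset:
  assumes "is_subgroup P" "finite U" "U \<subseteq> z +o P"
  shows "\<Sum>U - (\<Sum>i<card U. z) \<in> P"
proof -
  have "(\<Sum>u\<in>U. u - z) \<in> P"
    using assms(2,3) by (induction U rule: finite_induct) (auto simp: is_subgroupD[OF assms(1)] mem_elt_set_plus)
  then show ?thesis by (simp add: sum_subtractf sum_const_card[OF assms(2)])
qed

text \<open>
  A sum over a coset \<open>z + P\<close> with at least as many positive as negative terms can be rearranged to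
  involve one more positive term and one free negative term; the latter ranges over almost the whole coset.
\<close>

lemma coset_sums_absorb_aux:
  fixes T :: "'a::{ab_group_add,finite} set"
  assumes P: "is_subgroup P" and T: "T \<subseteq> z +o P" "z \<in> T" and R: "R \<subseteq> P" "R + K = R"
    and K: "is_subgroup K" "K \<subseteq> P"
    and gt: "card P < card (T + K) + card R"
    and U: "U \<subseteq> T - {z}" "V \<subseteq> T - {z}" "card V \<le> card U" and p: "p \<in> P"
  shows "\<Sum>U - \<Sum>V + p \<in> subset_sums T + uminus ` subset_sums T + R"
proof -
  let ?n = "\<lambda>j::nat. \<Sum>i<j. z"
  define l where "l = card U - card V"
  \<comment> \<open>\<open>U\<close> avoids \<open>z\<close>, so \<open>T\<close> has room for the
    \<open>l + 1\<close> terms of \<open>W\<close>. The sums \<open>\<Sum>W - t\<close> with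
    \<open>t \<in> T\<close> then lie in the same coset of \<open>P\<close> as
    \<open>\<Sum>U - \<Sum>V\<close>.\<close>
  have "card U \<le> card (T - {z})" using U(1) by (intro card_mono) simp_all
  then have "l + 1 \<le> card T" using T(2) card_Diff_singleton[of z T] card_gt_0_iff[of T] unfolding l_def by auto
  then obtain W where W: "W \<subseteq> T" "card W = l + 1"
    using obtain_subset_with_card_n by metis
  have "?n (a + b) = ?n a + ?n b" for a b
    by (induction b) (auto simp: ac_simps)
  then have nU: "?n (card U) = ?n l + ?n (card V)"
    using U(3) by (metis l_def le_add_diff_inverse2)
  have "\<Sum>U - ?n (card U) \<in> P" "\<Sum>V - ?n (card V) \<in> P" "\<Sum>W - ?n (card W) \<in> P"
    using T(1) U W(1) by (auto intro!: sum_in_coset[OF P])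
  then have "((\<Sum>U - ?n (card U)) - (\<Sum>V - ?n (card V))) - (\<Sum>W - ?n (card W)) + p \<in> P"
    using p is_subgroupD[OF P] by metis
  moreover have "((\<Sum>U - ?n (card U)) - (\<Sum>V - ?n (card V))) - (\<Sum>W - ?n (card W)) + p
      = (\<Sum>U - \<Sum>V + p) - ((\<Sum>W - z) + 0)"
    unfolding nU W(2) by (simp add: algebra_simps)
  ultimately have g: "\<Sum>U - \<Sum>V + p \<in> ((\<Sum>W - z) + 0) +o P" by (simp add: mem_elt_set_plus)
  define A where "A = \<Sum>W +o uminus ` (T + K)"
  have "T + K \<subseteq> (z +o P) + P" using T(1) K(2) by (rule set_plus_mono2)
  then have TK: "T + K \<subseteq> z +o P" using P by (simp add: set_plus_rearrange3)
  have "A \<subseteq> (\<Sum>W - z) +o P"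
  proof
    fix x assume "x \<in> A"
    then have "\<Sum>W - x \<in> T + K" by (auto simp: A_def mem_elt_set_plus mem_uminus_image)
    then have "\<Sum>W - x - z \<in> P" using TK by (auto simp: mem_elt_set_plus)
    then have "- (\<Sum>W - x - z) \<in> P" by (rule is_subgroupD(2)[OF P])
    then show "x \<in> (\<Sum>W - z) +o P" by (simp add: mem_elt_set_plus algebra_simps)
  qed
  moreover have "card P < card A + card R" using gt by (simp add: A_def)
  ultimately have "\<Sum>U - \<Sum>V + p \<in> A + R"
    using R(1) g by (intro card_add_gt_imp_mem_set_plus[OF P, where a = "\<Sum>W - z" and b = 0]) auto
  also have "A + R = (\<Sum>W +o uminus ` T) + (R + K)"
    by (simp add: A_def uminus_set_plus uminus_subgroup[OF K(1)] set_plus_rearrange3 add.assoc add.commute[of K R])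
  also have "\<dots> \<subseteq> (subset_sums T + uminus ` subset_sums T) + R"
    unfolding R(2)
  proof (rule set_plus_mono_left)
    have "uminus ` T \<subseteq> uminus ` subset_sums T" using subset_subset_sums[of T] by (rule image_mono)
    then show "\<Sum>W +o uminus ` T \<subseteq> subset_sums T + uminus ` subset_sums T"
      using sum_mem_subset_sums[OF W(1)] by (rule set_plus_mono5[rotated])
  qed
  finally show ?thesis .
qed

text \<open>\<open>S\<close> splits into the part over \<open>z + P\<close> and its negative,
  disjoint since \<open>z + z \<notin> P\<close>, the part in \<open>P\<close>, and a rest that is
  carried along. Sums over the first part without \<open>z\<close> and \<open>- z\<close> have the
  form \<open>\<Sum>U - \<Sum>V\<close>; \<open>coset_sums_absorb_aux\<close> shifts them by all of
  \<open>P\<close>, drawing on the full part. If \<open>V\<close> has more elements than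
  \<open>U\<close>, it is applied to the negative.\<close>

lemma coset_sums_absorb:
  fixes S :: "'a::{ab_group_add,finite} set"
  assumes K: "is_subgroup K" "K \<subseteq> P" and P: "is_subgroup P" and S: "symmetric_set S"
    and z: "z \<in> S" "z + z \<notin> P"
    and gt: "card P < card ((S \<inter> (z +o P)) + K) + card (subset_sums (S \<inter> P) + K)"
  shows "subset_sums (S - {z, - z}) + P \<subseteq> subset_sums S + K"
proof -
  define T where "T = S \<inter> (z +o P)"
  define R where "R = subset_sums (S \<inter> P) + K"
  define Q where "Q = S - T - uminus ` T - P"
  let ?\<Sigma> = "subset_sums :: 'a set \<Rightarrow> 'a set"
  have zP: "z \<notin> P" using z(2) is_subgroupD(3)[OF P] by blast
  have zT: "z \<in> T" using z(1) is_subgroupD(1)[OF P] by (simp add: T_def mem_elt_set_plus)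
  have mT: "x \<in> uminus ` T \<longleftrightarrow> x \<in> S \<and> x + z \<in> P" for x
  proof -
    have "- x - z \<in> P \<longleftrightarrow> x + z \<in> P"
      using is_subgroupD(2)[OF P, of "- x - z"] is_subgroupD(2)[OF P, of "x + z"] by (auto simp: add.commute)
    then show ?thesis by (simp add: mem_uminus_image T_def mem_elt_set_plus symmetric_set_mem[OF S])
  qed
  have T: "x \<in> T \<longleftrightarrow> x \<in> S \<and> x - z \<in> P" for x by (simp add: T_def mem_elt_set_plus)
  have d1: "T \<inter> uminus ` T = {}"
  proof -
    have False if "x \<in> T" "x \<in> uminus ` T" for x
    proof -
      have "(x + z) - (x - z) \<in> P" using that T mT is_subgroupD(4)[OF P] by blast
      then show False using z(2) by simp
    qed
    then show ?thesis by blast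
  qed
  have d2: "P \<inter> (T \<union> uminus ` T) = {}"
  proof -
    have False if "x \<in> P" "x \<in> T \<union> uminus ` T" for x
    proof -
      have "x - (x - z) \<in> P \<or> (x + z) - x \<in> P"
        using that T mT is_subgroupD(4)[OF P] by blast
      then show False using zP by simp
    qed
    then show ?thesis by blast
  qed
  have sub: "T \<union> uminus ` T \<subseteq> S" using T mT by blast
  have d3: "(S \<inter> P) \<inter> Q = {}" by (auto simp: Q_def)
  have d4: "(T \<union> uminus ` T) \<inter> ((S \<inter> P) \<union> Q) = {}" using d2 unfolding Q_def by blast
  have S_eq: "S = (T \<union> uminus ` T) \<union> ((S \<inter> P) \<union> Q)" using sub by (auto simp: Q_def)
  have four: "?\<Sigma> ((A \<union> B) \<union> (C \<union> D)) = (?\<Sigma> A + ?\<Sigma> B) + (?\<Sigma> C + ?\<Sigma> D)"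
    if "A \<inter> B = {}" "C \<inter> D = {}" "(A \<union> B) \<inter> (C \<union> D) = {}" for A B C D
    using that by (simp add: subset_sums_Un)
  have "?\<Sigma> ((T \<union> uminus ` T) \<union> ((S \<inter> P) \<union> Q)) = (?\<Sigma> T + uminus ` ?\<Sigma> T) + (?\<Sigma> (S \<inter> P) + ?\<Sigma> Q)"
    unfolding subset_sums_uminus[symmetric]
    by (rule four[OF d1 d3 d4])
  then have S_sum: "?\<Sigma> S = (?\<Sigma> T + uminus ` ?\<Sigma> T) + (?\<Sigma> (S \<inter> P) + ?\<Sigma> Q)" using S_eq by simp
  define T' where "T' = T - {z}"
  have T': "T' \<subseteq> T" "uminus ` T' \<subseteq> uminus ` T" by (auto simp: T'_def)
  have d1': "T' \<inter> uminus ` T' = {}" using T' d1 by blast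
  have d4': "(T' \<union> uminus ` T') \<inter> ((S \<inter> P) \<union> Q) = {}" using T' d4 by blast
  have "S - {z, - z} = (T' \<union> uminus ` T') \<union> ((S \<inter> P) \<union> Q)"
  proof -
    have "z \<notin> (S \<inter> P) \<union> Q" "- z \<notin> (S \<inter> P) \<union> Q" "z \<notin> uminus ` T" "- z \<notin> T"
      using d1 d2 zT by (auto simp: Q_def)
    moreover have "uminus ` T' = uminus ` T - {- z}" by (auto simp: T'_def)
    ultimately show ?thesis by (subst S_eq) (auto simp: T'_def)
  qed
  then have S'_sum: "?\<Sigma> (S - {z, - z}) = (?\<Sigma> T' + uminus ` ?\<Sigma> T') + (?\<Sigma> (S \<inter> P) + ?\<Sigma> Q)"
    unfolding subset_sums_uminus[symmetric]
    using four[OF d1' d3 d4'] by (simp only:)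
  have RP: "R \<subseteq> P"
    using set_plus_mono2[OF subset_sums_subset_subgroup[OF P, of "S \<inter> P"] K(2)] P by (simp add: R_def)
  have RK: "R + K = R" using K(1) by (simp add: R_def add.assoc)
  have aux: "\<Sum>U - \<Sum>V + p \<in> ?\<Sigma> T + uminus ` ?\<Sigma> T + R"
    if "U \<subseteq> T'" "V \<subseteq> T'" "p \<in> P" "card V \<le> card U" for U V p
    using that gt coset_sums_absorb_aux[OF P _ zT RP RK K, of U V p]
    by (auto simp: T'_def T_def R_def)
  have symR: "uminus ` R = R"
    using symmetric_set_Int_subgroup[OF S P] uminus_subgroup[OF K(1)]
    by (simp add: R_def uminus_set_plus subset_sums_uminus[symmetric] symmetric_set_def[symmetric])
       (metis symmetric_set_def)
  have claim: "(?\<Sigma> T' + uminus ` ?\<Sigma> T') + P \<subseteq> ?\<Sigma> T + uminus ` ?\<Sigma> T + R" (is "_ \<subseteq> ?rhs")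
  proof
    fix g assume "g \<in> (?\<Sigma> T' + uminus ` ?\<Sigma> T') + P"
    then obtain u v p where "g = u + v + p" "u \<in> ?\<Sigma> T'" "v \<in> uminus ` ?\<Sigma> T'" "p \<in> P"
      unfolding set_plus_def by blast
    then obtain U V where UV: "U \<subseteq> T'" "V \<subseteq> T'" "p \<in> P" "g = \<Sum>U - \<Sum>V + p"
      by (auto simp: subset_sums_def)
    show "g \<in> ?rhs"
    proof (cases "card V \<le> card U")
      case True
      then show ?thesis using aux[OF UV(1,2,3)] UV(4) by simp
    next
      case False
      then have "\<Sum>V - \<Sum>U + - p \<in> ?rhs"
        using aux[OF UV(2,1) is_subgroupD(2)[OF P UV(3)]] by simp
      moreover have "\<Sum>V - \<Sum>U + - p = - g" by (simp add: UV(4))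
      ultimately have "g \<in> uminus ` ?rhs" by (simp add: mem_uminus_image)
      then show ?thesis by (simp add: uminus_set_plus symR add.commute)
    qed
  qed
  have "?\<Sigma> (S \<inter> P) + P = P"
  proof -
    have "?\<Sigma> (S \<inter> P) \<subseteq> P" by (rule subset_sums_subset_subgroup[OF P]) simp
    then have "P + ?\<Sigma> (S \<inter> P) = P" by (rule subgroup_plus_subset[OF P]) simp
    then show ?thesis by (simp add: add.commute)
  qed
  moreover have "(X + (A + C)) + P = (X + (A + P)) + C" for X A C :: "'a set" by (simp only: ac_simps)
  ultimately have "?\<Sigma> (S - {z, - z}) + P = ((?\<Sigma> T' + uminus ` ?\<Sigma> T') + P) + ?\<Sigma> Q"
    unfolding S'_sum by (simp only:)
  also have "\<dots> \<subseteq> (?\<Sigma> T + uminus ` ?\<Sigma> T + R) + ?\<Sigma> Q" by (rule set_plus_mono_left[OF claim])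
  also have "\<dots> = ?\<Sigma> S + K" unfolding S_sum R_def by (simp add: ac_simps)
  finally show ?thesis .
qed

section \<open>Dense subgroups and growth\<close>

lemma plus_absorb_right:
  fixes X A K :: "'a::ab_semigroup_add set"
  assumes "X + K = X"
  shows "X + (A + K) = X + A" "(A + K) + X = A + X"
proof -
  have "X + (A + K) = (X + K) + A" by (simp only: ac_simps)
  then show "X + (A + K) = X + A" using assms by simp
  then show "(A + K) + X = A + X" by (simp only: ac_simps)
qed

lemma dvd_less_imp_add_le:
  fixes a b k :: nat
  assumes "a < b" "k dvd a" "k dvd b"
  shows "a + k \<le> b"
proof -
  have "k dvd b - a" using assms by (simp add: dvd_diff_nat)
  then have "k \<le> b - a" using assms(1) by (intro dvd_imp_le) auto
  then show ?thesis using assms(1) by simp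
qed

lemma card_subgroup_plus_insert:
  fixes S :: "'a::{ab_group_add,finite} set"
  assumes P: "is_subgroup P"
  shows "card (P + insert 0 S) = card P + card ((S - P) + P)"
proof -
  have "s + p \<in> P" if "s \<in> P" "p \<in> P" for s p using is_subgroupD(3)[OF P that] .
  then have "(S \<inter> P) + P \<subseteq> P" by (auto elim!: set_plus_elim)
  moreover have "S + P = ((S \<inter> P) + P) \<union> ((S - P) + P)"
    unfolding Un_set_plus[symmetric] by (rule arg_cong2[where f = "(+)"]) auto
  moreover have "P + insert 0 S = P \<union> (S + P)"
    by (simp add: set_plus_insert Un_commute add.commute image_Un)
  ultimately have "P + insert 0 S = P \<union> ((S - P) + P)" by blast
  moreover have "P \<inter> ((S - P) + P) = {}"
  proof -
    have False if "s \<notin> P" "p \<in> P" "s + p \<in> P" for s p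
      using that is_subgroupD(4)[OF P that(3,2)] by simp
    then show ?thesis by (auto elim!: set_plus_elim)
  qed
  ultimately show ?thesis by (simp add: card_Un_disjoint)
qed

text \<open>Outside \<open>P\<close> and \<open>z + P\<close>, the set \<open>S + K\<close> has at
  most the elements of the other cosets of \<open>P\<close> met by \<open>S\<close>. So if
  \<open>S\<close> is dense modulo \<open>P\<close>, its parts in \<open>P\<close> and in
  \<open>z + P\<close> together have at least about \<open>|P|\<close> elements.\<close>

lemma card_dense_coset:
  fixes S :: "'a::{ab_group_add,finite} set"
  assumes K: "is_subgroup K" "K \<subseteq> P" and P: "is_subgroup P" and z: "z \<in> S" "z \<notin> P"
  shows "card P + card (S + K) \<le> card ((S \<inter> (z +o P)) + K) + card ((S \<inter> P) + K) + card ((S - P) + P)"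
proof -
  define T where "T = S \<inter> (z +o P)"
  define W where "W = S - P - T"
  have "S + K = ((S \<inter> P) + K) \<union> ((T + K) \<union> (W + K))"
    unfolding Un_set_plus[symmetric] by (rule arg_cong2[where f = "(+)"]) (auto simp: W_def T_def)
  then have c: "card (S + K) \<le> card ((S \<inter> P) + K) + (card (T + K) + card (W + K))"
    using card_Un_le[of "(S \<inter> P) + K" "(T + K) \<union> (W + K)"] card_Un_le[of "T + K" "W + K"] by simp
  have "W + K \<subseteq> ((S - P) + P) - (z +o P)"
  proof
    fix x assume "x \<in> W + K"
    then obtain w k where x: "x = w + k" "w \<in> W" "k \<in> K" by (rule set_plus_elim)
    have "w + k \<in> (S - P) + P" using x K(2) by (intro set_plus_intro) (auto simp: W_def)
    moreover have "w + k - z \<notin> P"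
    proof
      assume "w + k - z \<in> P"
      then have "(w + k - z) - k \<in> P" using x(3) K(2) is_subgroupD(4)[OF P] by blast
      then show False using x(2) by (auto simp: W_def T_def mem_elt_set_plus)
    qed
    ultimately show "x \<in> ((S - P) + P) - (z +o P)" by (simp add: x(1) mem_elt_set_plus)
  qed
  then have "card (W + K) \<le> card (((S - P) + P) - (z +o P))" by (intro card_mono) auto
  moreover have sub: "z +o P \<subseteq> (S - P) + P" using z by (intro set_plus_mono3) simp
  moreover have "card (((S - P) + P) - (z +o P)) = card ((S - P) + P) - card P"
    using sub by (subst card_Diff_subset) auto
  moreover have "card P \<le> card ((S - P) + P)" using card_mono[OF _ sub] by simp
  ultimately show ?thesis using c unfolding T_def by linarith
qed

lemma subset_sums_Int_subgroup_bound:
  fixes S :: "'a::{ab_group_add,finite} set"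
  assumes st: "has_stabilizer (subset_sums S + K) K" and SK: "S \<inter> K = {}"
  shows "card K + card ((S \<inter> P) + K) \<le> card (subset_sums (S \<inter> P) + K)"
  by (rule card_subset_sums_ge[OF has_stabilizer_subset[OF st]]) (use SK in auto)

text \<open>Density without strictness suffices: the sums in \<open>P\<close> outnumber the elements
  in \<open>P\<close> by at least \<open>|K|\<close>, owing to the empty sum.\<close>

lemma dense_subgroup_absorb:
  fixes S :: "'a::{ab_group_add,finite} set"
  assumes st: "has_stabilizer (subset_sums S + K) K" and S: "symmetric_set S" "S \<inter> K = {}"
    and P: "is_subgroup P" "K \<subseteq> P" and z: "z \<in> S" "z + z \<notin> P"
    and dense: "card (P + insert 0 S) \<le> card P + card (S + K)"
  shows "subset_sums (S - {z, - z}) + P \<subseteq> subset_sums S + K"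
proof (rule coset_sums_absorb)
  show K: "is_subgroup K" by (rule has_stabilizerD(1)[OF st])
  have "z \<notin> P" using z(2) is_subgroupD(3)[OF P(1)] by blast
  then show "card P < card ((S \<inter> (z +o P)) + K) + card (subset_sums (S \<inter> P) + K)"
    using card_dense_coset[OF K P(2,1) z(1)] card_subgroup_plus_insert[OF P(1), of S] dense
      subset_sums_Int_subgroup_bound[OF st S(2), of P] card_subgroup_pos[OF K] by linarith
qed (use P S z in auto)

text \<open>
  For a strictly dense subgroup a self-inverse coset \<open>z + P\<close> is impossible: the sums over \<open>S \<inter> (z + P)\<close>
  and \<open>S \<inter> P\<close> would fill the subgroup \<open>P \<union> (z + P)\<close>.
\<close>

lemma strictly_dense_subgroup_double:
  fixes S :: "'a::{ab_group_add,finite} set"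
  assumes st: "has_stabilizer (subset_sums S + K) K" and S: "S \<inter> K = {}"
    and P: "is_subgroup P" "K \<subseteq> P" and z: "z \<in> S" "z \<notin> P"
    and dense: "card (P + insert 0 S) < card P + card (S + K)"
  shows "z + z \<notin> P"
proof
  assume zz: "z + z \<in> P"
  note K = has_stabilizerD(1)[OF st]
  define T where "T = S \<inter> (z +o P)"
  define R where "R = subset_sums (S \<inter> P) + K"
  have RP: "R \<subseteq> P"
    using set_plus_mono2[OF subset_sums_subset_subgroup[OF P(1), of "S \<inter> P"] P(2)] P by (simp add: R_def)
  have RK: "R + K = R" using K by (simp add: R_def add.assoc)
  have dvd: "card K dvd card A" if "A + K = A" for A :: "'a set"
    using card_plus_subgroup[OF K, of A] that by simp
  have "card P < card (T + K) + card ((S \<inter> P) + K)"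
    using card_dense_coset[OF K P(2,1) z] card_subgroup_plus_insert[OF P(1), of S] dense
    unfolding T_def by linarith
  moreover have "card K dvd card P" "card K dvd card (T + K) + card ((S \<inter> P) + K)"
  proof -
    show "card K dvd card P" by (rule dvd) (rule subgroup_plus_subset[OF P is_subgroupD(1)[OF K]])
    show "card K dvd card (T + K) + card ((S \<inter> P) + K)"
      by (intro dvd_add dvd) (simp_all only: add.assoc subgroup_plus_self[OF K])
  qed
  ultimately have "card P + card K \<le> card (T + K) + card ((S \<inter> P) + K)"
    by (rule dvd_less_imp_add_le)
  \<comment> \<open>One \<open>|K|\<close> of the surplus comes from strict density and
    divisibility, the other from the empty sum. The first proof below needs only one of them; the
    second gives one up by removing \<open>z\<close> from \<open>T\<close>.\<close>
  then have big: "card P + 2 * card K \<le> card (T + K) + card R"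
    using subset_sums_Int_subgroup_bound[OF st S, of P] unfolding R_def by linarith
  have pos: "0 < card K" by (rule card_subgroup_pos[OF K])
  have TzP: "T \<subseteq> z +o P" by (simp add: T_def)
  have TKzP: "X + K \<subseteq> z +o P" if "X \<subseteq> z +o P" for X
    using set_plus_mono2[OF that P(2)] P by (simp add: set_plus_rearrange3)
  have zT: "z \<in> T" using z is_subgroupD(1)[OF P(1)] by (simp add: T_def mem_elt_set_plus)
  have st': "has_stabilizer (subset_sums (T \<union> (S \<inter> P)) + K) K"
    by (rule has_stabilizer_subset[OF st]) (auto simp: T_def)
  have "T \<inter> (S \<inter> P) = {}"
  proof -
    have False if "x - z \<in> P" "x \<in> P" for x
      using z(2) is_subgroupD(4)[OF P(1) that(2,1)] by simp
    then show ?thesis by (auto simp: T_def mem_elt_set_plus)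
  qed
  then have sumTR: "subset_sums (T \<union> (S \<inter> P)) + K = subset_sums T + R"
    by (simp add: subset_sums_Un R_def add.assoc)
  define Q where "Q = P \<union> (z +o P)"
  have E: "z +o P \<subseteq> subset_sums T + R"
  proof
    fix g assume g: "g \<in> z +o P"
    have "g \<in> (T + K) + R"
    proof (rule card_add_gt_imp_mem_set_plus[OF P(1) TKzP[OF TzP], where b = 0])
      show "card P < card (T + K) + card R" using big pos by linarith
      show "R \<subseteq> 0 +o P" "g \<in> (z + 0) +o P" using RP g by simp_all
    qed
    also have "(T + K) + R = T + R" by (rule plus_absorb_right[OF RK])
    also have "\<dots> \<subseteq> subset_sums T + R" by (intro set_plus_mono_left subset_subset_sums)
    finally show "g \<in> subset_sums T + R" .
  qed
  \<comment> \<open>Sums with two terms from \<open>T\<close> lie in \<open>P\<close>; one term is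
    fixed to be \<open>z\<close>, the other ranges over \<open>T - {z}\<close>.\<close>
  have F: "P \<subseteq> subset_sums T + R"
  proof
    fix g assume g: "g \<in> P"
    have "T + K = ((T - {z}) + K) \<union> (z +o K)"
      using zT by (auto simp: set_plus_def elt_set_plus_def)
    then have "card (T + K) \<le> card ((T - {z}) + K) + card K"
      using card_Un_le[of "(T - {z}) + K" "z +o K"] by simp
    then have gt: "card P < card ((T - {z}) + K) + card R" using big pos by linarith
    have "g - z \<in> z +o P"
      using is_subgroupD(4)[OF P(1) g zz] by (simp add: mem_elt_set_plus algebra_simps)
    then have gz: "g - z \<in> (z + 0) +o P" by simp
    have "T - {z} \<subseteq> z +o P" using TzP by blast
    then have "g - z \<in> ((T - {z}) + K) + R"
      using RP gt gz by (intro card_add_gt_imp_mem_set_plus[OF P(1) TKzP, where b = 0]) simp_all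
    also have "((T - {z}) + K) + R = (T - {z}) + R" by (rule plus_absorb_right[OF RK])
    finally obtain t r where t: "g - z = t + r" "t \<in> T - {z}" "r \<in> R" by (rule set_plus_elim)
    have "z + t \<in> subset_sums T"
      using sum_mem_subset_sums[of "{z, t}" T] t(2) zT by auto
    moreover have "g = (z + t) + r" using t(1) by (simp add: algebra_simps)
    ultimately show "g \<in> subset_sums T + R" using t(3) by blast
  qed
  have Q: "is_subgroup Q"
  proof -
    have "x - y \<in> Q" if "x \<in> Q" "y \<in> Q" for x y
    proof -
      have "z - - z \<in> P" using zz by simp
      then have zz': "w + z \<in> P \<longleftrightarrow> w - z \<in> P" for w
        using is_subgroupD(4)[OF P(1) _ zz, of "w + z"] is_subgroupD(3)[OF P(1) _ zz, of "w - z"]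
        by auto
      have "x \<in> P \<or> x - z \<in> P" "y \<in> P \<or> y - z \<in> P" using that by (auto simp: Q_def mem_elt_set_plus)
      then have "x - y \<in> P \<or> (x - y) - z \<in> P \<or> (x - y) + z \<in> P"
      proof -
        have eqs: "x - (y - z) = (x - y) + z" "(x - z) - y = (x - y) - z" "(x - z) - (y - z) = x - y"
          by (simp_all add: algebra_simps)
        have "x - y \<in> P" if "x \<in> P" "y \<in> P" using that by (rule is_subgroupD(4)[OF P(1)])
        moreover have "(x - y) + z \<in> P" if "x \<in> P" "y - z \<in> P"
          using is_subgroupD(4)[OF P(1) that] unfolding eqs .
        moreover have "(x - y) - z \<in> P" if "x - z \<in> P" "y \<in> P"
          using is_subgroupD(4)[OF P(1) that] unfolding eqs .
        moreover have "x - y \<in> P" if "x - z \<in> P" "y - z \<in> P"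
          using is_subgroupD(4)[OF P(1) that] unfolding eqs .
        ultimately show ?thesis using \<open>x \<in> P \<or> x - z \<in> P\<close> \<open>y \<in> P \<or> y - z \<in> P\<close> by blast
      qed
      then show ?thesis using zz'[of "x - y"] by (auto simp: Q_def mem_elt_set_plus)
    qed
    then show ?thesis using is_subgroupD(1)[OF P(1)] by (auto simp: is_subgroup_def Q_def)
  qed
  have "T \<subseteq> Q" "R \<subseteq> Q" using TzP RP by (auto simp: Q_def)
  then have "subset_sums T + R \<subseteq> Q + Q" by (intro set_plus_mono2 subset_sums_subset_subgroup[OF Q])
  then have "subset_sums T + R \<subseteq> Q" unfolding subgroup_plus_self[OF Q] .
  then have "subset_sums T + R = Q" using E F by (auto simp: Q_def)
  moreover have "z \<in> Q" using zT TzP by (auto simp: Q_def)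
  ultimately have "z +o (subset_sums (T \<union> (S \<inter> P)) + K) \<subseteq> subset_sums (T \<union> (S \<inter> P)) + K"
    using subgroup_elt_plus[OF Q] sumTR by simp
  then have "z \<in> K" by (rule has_stabilizerD(3)[OF st'])
  then show False using z S by blast
qed

section \<open>Sets without dense subgroups and the growth of balls\<close>

definition coset_closed :: "'a::ab_group_add set \<Rightarrow> 'a set \<Rightarrow> 'a set \<Rightarrow> bool"
  where "coset_closed K S T \<longleftrightarrow> T \<subseteq> S \<and> symmetric_set T \<and> (\<forall>t\<in>T. S \<inter> (t +o K) \<subseteq> T)"

text \<open>Hereditary by definition, because \<open>coset_bound_half\<close> deletes classes one
  after another.\<close>

definition spread :: "'a::ab_group_add set \<Rightarrow> 'a set \<Rightarrow> bool"
  where "spread K S \<longleftrightarrow> (\<forall>T P. coset_closed K S T \<longrightarrow> is_subgroup P \<longrightarrow> K \<subset> P \<longrightarrow> \<not> T \<subseteq> P \<longrightarrow>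
    card P + card (T + K) \<le> card (P + insert 0 T))"

lemma spread_coset_closed:
  assumes "spread K S" "coset_closed K S T"
  shows "spread K T"
proof -
  have "coset_closed K S U" if "coset_closed K T U" for U
    using that assms(2) unfolding coset_closed_def by blast
  then show ?thesis using assms(1) by (simp add: spread_def)
qed

text \<open>Mann's theorem reduces the growth of \<open>X\<close> to that of a subgroup
  \<open>P \<supseteq> K\<close>. For \<open>P = K\<close> it is clear since \<open>S\<close> avoids
  \<open>K\<close>; \<open>S \<subseteq> P\<close> would give \<open>P = H\<close>; the other cases
  are the hypothesis.\<close>

lemma ball_growth_step:
  fixes S :: "'a::{ab_group_add,finite} set"
  assumes K: "is_subgroup K" and S: "S \<inter> K = {}"
    and dense: "\<And>P. is_subgroup P \<Longrightarrow> K \<subset> P \<Longrightarrow> \<not> S \<subseteq> P \<Longrightarrow> card P + card (S + K) \<le> card (P + insert 0 S)"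
    and H: "H = group_closure (S \<union> K)"
    and X: "X \<subseteq> H" "X \<noteq> {}" "X + K = X" "X + insert 0 S \<noteq> H"
  shows "card X + card (S + K) \<le> card (X + insert 0 S)"
proof -
  have Hs: "is_subgroup H" and SKH: "S \<union> K \<subseteq> H"
    unfolding H using subset_group_closure[of "S \<union> K"] by auto
  define B where "B = insert 0 S + K"
  have BH: "B \<subseteq> H"
    using set_plus_mono2[of "insert 0 S" H K H] SKH is_subgroupD(1)[OF Hs] Hs by (simp add: B_def)
  have BK: "B + K = B" using K by (simp add: B_def add.assoc)
  have B0: "B \<noteq> {}" using is_subgroupD(1)[OF K] by (auto simp: B_def set_plus_def)
  have XB: "X + B = X + insert 0 S" unfolding B_def by (rule plus_absorb_right[OF X(3)])
  obtain P where P: "is_subgroup P" "K \<subseteq> P" "P \<subseteq> H" "P + B \<noteq> H"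
    "card (P + B) + card X \<le> card (X + B) + card P"
    by (rule mann_subgroup_periodic[OF Hs K _ BH B0 BK X(1,2)]) (use SKH X(4) XB in auto)
  have PB: "P + B = P + insert 0 S"
  proof -
    have "P + K = P" using subgroup_plus_subset[OF P(1,2)] is_subgroupD(1)[OF K] by simp
    then show ?thesis unfolding B_def by (rule plus_absorb_right)
  qed
  have "card P + card (S + K) \<le> card (P + B)"
  proof (cases "P = K")
    case True
    have "S - K = S" using S by blast
    then show ?thesis using card_subgroup_plus_insert[OF K, of S] PB True by simp
  next
    case False
    have "\<not> S \<subseteq> P"
    proof
      assume "S \<subseteq> P"
      then have "P = H" using P(2,3) group_closure_subset[OF P(1), of "S \<union> K"] unfolding H by auto
      then have "P + B = H" using subgroup_plus_subset[OF Hs BH] is_subgroupD(1)[OF K]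
        by (auto simp: B_def set_plus_def)
      then show False using P(4) by simp
    qed
    then show ?thesis using dense[OF P(1)] P(2) False unfolding PB by blast
  qed
  then show ?thesis using P(5) unfolding XB by linarith
qed

lemma ball_properties:
  assumes K: "is_subgroup K"
  shows "ball K S j \<subseteq> group_closure (S \<union> K)" "ball K S j \<noteq> {}" "ball K S j + K = ball K S j"
proof -
  let ?H = "group_closure (S \<union> K)"
  show "ball K S j \<subseteq> ?H"
  proof (induction j)
    case 0
    show ?case using subset_group_closure[of "S \<union> K"] by simp
  next
    case (Suc j)
    have "insert 0 S \<subseteq> ?H" using subset_group_closure[of "S \<union> K"] by auto
    then show ?case using set_plus_mono2[OF Suc, of "insert 0 S" ?H] by simp
  qed
  show "ball K S j \<noteq> {}" using zero_mem_ball[OF K] by blast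
  show "ball K S j + K = ball K S j"
  proof (induction j)
    case (Suc j)
    have "(ball K S j + insert 0 S) + K = (ball K S j + K) + insert 0 S" by (simp only: ac_simps)
    then show ?case using Suc by (simp only: ball.simps)
  qed (simp add: K)
qed

lemma ball_growth:
  fixes S :: "'a::{ab_group_add,finite} set"
  assumes K: "is_subgroup K" and S: "S \<inter> K = {}"
    and dense: "\<And>P. is_subgroup P \<Longrightarrow> K \<subset> P \<Longrightarrow> \<not> S \<subseteq> P \<Longrightarrow> card P + card (S + K) \<le> card (P + insert 0 S)"
    and p: "card (S + K) = card K * (2 * p)" and b: "2 * b \<le> card (group_closure (S \<union> K))"
  shows "min (2 * b) (card K * (2 * p * j + 1)) \<le> card (ball K S j)"
proof (induction j)
  case (Suc j)
  show ?case
  proof (cases "ball K S (Suc j) = group_closure (S \<union> K)")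
    case True
    then have "2 * b \<le> card (ball K S (Suc j))" using b by (simp only:)
    then show ?thesis by linarith
  next
    case False
    then have "card (ball K S j) + card K * (2 * p) \<le> card (ball K S (Suc j))"
      using ball_growth_step[OF K S _ refl ball_properties[OF K], of j] dense p by simp
    moreover have "card K * (2 * p * Suc j + 1) = card K * (2 * p * j + 1) + card K * (2 * p)"
      by (simp add: algebra_simps)
    ultimately show ?thesis using Suc.IH by linarith
  qed
qed simp

text \<open>If the sums of \<open>Y\<close> fill more than half of the group \<open>H\<close>
  generated by \<open>S\<close> and \<open>K\<close>, their differences are all of \<open>H\<close>,
  so the sums of \<open>S\<close> are periodic under \<open>H\<close>.\<close>

lemma card_half_sums_le:
  fixes S :: "'a::{ab_group_add,finite} set"
  assumes st: "has_stabilizer (subset_sums S + K) K" and S: "S \<inter> K = {}" "S \<noteq> {}" and Y: "is_half S Y"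
  shows "2 * card (subset_sums Y + K) \<le> card (group_closure (S \<union> K))"
proof (rule ccontr)
  assume neg: "\<not> ?thesis"
  note K = has_stabilizerD(1)[OF st]
  let ?H = "group_closure (S \<union> K)" and ?B = "subset_sums Y + K"
  have SKH: "S \<subseteq> ?H" "K \<subseteq> ?H" using subset_group_closure[of "S \<union> K"] by auto
  have BH: "?B \<subseteq> ?H"
    using set_plus_mono2[OF subset_sums_subset_subgroup[of ?H Y] SKH(2)] is_halfD(1)[OF Y] SKH(1) by simp
  then have mBH: "uminus ` ?B \<subseteq> ?H"
    using image_mono[OF BH, of uminus] uminus_subgroup[of ?H] by simp
  have "?H \<subseteq> ?B + uminus ` ?B"
  proof
    fix g assume "g \<in> ?H"
    then show "g \<in> ?B + uminus ` ?B"
      using neg BH mBH by (intro card_add_gt_imp_mem_set_plus[of ?H ?B 0 "uminus ` ?B" 0 g]) auto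
  qed
  moreover have "?B + uminus ` ?B \<subseteq> ?H" using set_plus_mono2[OF BH mBH] by simp
  ultimately have "subset_sums S + K = ?H" using subset_sums_half[OF Y K] by blast
  then have "?H \<subseteq> K" using periodic_subgroup_subset_stabilizer[OF st, of ?H] by simp
  then show False using SKH(1) S by blast
qed

section \<open>The bound for half of a symmetric set\<close>

text \<open>Equals the sum over \<open>t \<ge> 1\<close> of the squares of
  \<open>|{a \<in> C. t \<le> f a}|\<close>.\<close>

definition min_weight_sum :: "'b set \<Rightarrow> ('b \<Rightarrow> nat) \<Rightarrow> nat"
  where "min_weight_sum C f = (\<Sum>a\<in>C. \<Sum>b\<in>C. min (f a) (f b))"

definition singles :: "'a::ab_group_add set \<Rightarrow> 'a set \<Rightarrow> nat"
  where "singles K S = card {C \<in> cosets_of K S. card (S \<inter> C) = 1}"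

text \<open>For \<open>K = {0}\<close> and \<open>|S| \<ge> 4\<close> this is \<open>|S| (|S| - 2) + 20\<close>, four times the general bound.\<close>

definition coset_bound :: "'a::ab_group_add set \<Rightarrow> 'a set \<Rightarrow> int"
  where "coset_bound K S = 4 + int (min_weight_sum (cosets_of K S) (\<lambda>C. card (S \<inter> C)))
     + 2 * int (card S) - 4 * int (singles K S - 4)"

lemma even_card_involution:
  assumes "finite A" "\<And>a. a \<in> A \<Longrightarrow> f a \<in> A" "\<And>a. a \<in> A \<Longrightarrow> f (f a) = a" "\<And>a. a \<in> A \<Longrightarrow> f a \<noteq> a"
  shows "even (card A)"
  using assms
proof (induction "card A" arbitrary: A rule: less_induct)
  case less
  show ?case
  proof (cases "A = {}")
    case False
    then obtain a where a: "a \<in> A" by blast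
    define A' where "A' = A - {a, f a}"
    have sub: "{a, f a} \<subseteq> A" "card {a, f a} = 2"
      using less.prems(2,4)[OF a] a by (auto simp: card_insert_if)
    then have c: "card A = card A' + 2"
      using less.prems(1) card_mono[OF less.prems(1) sub(1)] by (simp add: A'_def card_Diff_subset)
    have "even (card A')"
    proof (rule less.hyps)
      show "f b \<in> A'" if "b \<in> A'" for b
      proof -
        have "f b \<noteq> a" "f b \<noteq> f a"
          using that less.prems(3)[of b] less.prems(3)[OF a] by (auto simp: A'_def)
        then show ?thesis using that less.prems(2) by (auto simp: A'_def)
      qed
    qed (use c less.prems in \<open>auto simp: A'_def\<close>)
    then show ?thesis using c by simp
  qed simp
qed

lemma min_weight_sum_insert2:
  assumes "finite C" "a \<notin> C" "b \<notin> C" "a \<noteq> b" "f a = x" "f b = x"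
  shows "min_weight_sum (insert a (insert b C)) f = min_weight_sum C f + 4 * (\<Sum>c\<in>C. min x (f c)) + 4 * x"
  using assms by (simp add: min_weight_sum_def sum.distrib min.commute[of _ x])

text \<open>Only the first two layers are kept: the minimum is at least 1, and at least 2 if both
  weights are.\<close>

lemma min_weight_sum_ge:
  assumes "finite C" "\<And>c. c \<in> C \<Longrightarrow> 1 \<le> f c"
  shows "card C ^ 2 + card {c \<in> C. f c \<noteq> 1} ^ 2 \<le> min_weight_sum C f"
proof -
  let ?e = "\<lambda>c. if f c \<noteq> 1 then 1 else 0 :: nat"
  have e: "(\<Sum>c\<in>C. ?e c) = card {c \<in> C. f c \<noteq> 1}"
    using assms(1) by (simp add: sum.If_cases Int_def)
  have "(\<Sum>a\<in>C. \<Sum>b\<in>C. 1 + ?e a * ?e b) \<le> min_weight_sum C f"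
    unfolding min_weight_sum_def
  proof (intro sum_mono)
    fix a b assume "a \<in> C" "b \<in> C"
    then show "1 + ?e a * ?e b \<le> min (f a) (f b)" using assms(2)[of a] assms(2)[of b] by auto
  qed
  moreover have "(\<Sum>a\<in>C. \<Sum>b\<in>C. 1 + ?e a * ?e b) = card C ^ 2 + card {c \<in> C. f c \<noteq> 1} ^ 2"
    unfolding sum.distrib sum_distrib_left[symmetric] sum_distrib_right[symmetric] e
    by (simp add: power2_eq_square)
  ultimately show ?thesis by simp
qed

section \<open>Classes modulo \<open>K\<close> and their negatives\<close>

lemma uminus_coset: "is_subgroup K \<Longrightarrow> uminus ` (s +o K) = (- s) +o K"
proof (rule set_eqI)
  fix x assume K: "is_subgroup K"
  have "- x - s = - (x + s)" "x + s = - (- x - s)" by simp_all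
  then have "- x - s \<in> K \<longleftrightarrow> x + s \<in> K" using is_subgroupD(2)[OF K] by metis
  then show "x \<in> uminus ` (s +o K) \<longleftrightarrow> x \<in> (- s) +o K"
    by (simp add: mem_uminus_image mem_elt_set_plus)
qed

lemma card_Int_uminus_coset:
  fixes S :: "'a::{ab_group_add,finite} set"
  assumes "symmetric_set S"
  shows "card (S \<inter> uminus ` C) = card (S \<inter> C)"
proof -
  have "S \<inter> uminus ` C = uminus ` (S \<inter> C)"
    using symmetric_set_mem[OF assms] by (auto simp: mem_uminus_image)
  then show ?thesis by simp
qed

lemma coset_of_mem: "is_subgroup K \<Longrightarrow> C \<in> cosets_of K S \<Longrightarrow> s \<in> C \<Longrightarrow> C = s +o K"
proof -
  assume K: "is_subgroup K" and C: "C \<in> cosets_of K S" and s: "s \<in> C"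
  obtain t where "C = t +o K" using C by (auto simp: cosets_of_def)
  then show ?thesis using s subgroup_coset_eq[OF K, of s t] by (simp add: mem_elt_set_plus)
qed

lemma card_Int_coset_pos:
  fixes S :: "'a::{ab_group_add,finite} set"
  assumes "is_subgroup K" "C \<in> cosets_of K S"
  shows "1 \<le> card (S \<inter> C)"
proof -
  obtain s where "s \<in> S" "C = s +o K" using assms(2) by (auto simp: cosets_of_def)
  then have "s \<in> S \<inter> C" using is_subgroupD(1)[OF assms(1)] by (simp add: mem_elt_set_plus)
  then show ?thesis by (metis One_nat_def Suc_leI card_gt_0_iff empty_iff finite_class.finite)
qed

lemma card_eq_sum_cosets:
  fixes S :: "'a::{ab_group_add,finite} set"
  assumes K: "is_subgroup K"
  shows "card S = (\<Sum>C\<in>cosets_of K S. card (S \<inter> C))"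
proof -
  have "S = (\<Union>C\<in>cosets_of K S. S \<inter> C)"
    using is_subgroupD(1)[OF K] by (auto simp: cosets_of_def mem_elt_set_plus)
  moreover have "card (\<Union>C\<in>cosets_of K S. S \<inter> C) = (\<Sum>C\<in>cosets_of K S. card (S \<inter> C))"
  proof (rule card_UN_disjoint)
    show "\<forall>C\<in>cosets_of K S. \<forall>C'\<in>cosets_of K S. C \<noteq> C' \<longrightarrow> (S \<inter> C) \<inter> (S \<inter> C') = {}"
      using subgroup_cosets_disjoint[OF K] unfolding cosets_of_def by blast
  qed auto
  ultimately show ?thesis by simp
qed

lemma uminus_mem_cosets_of:
  assumes "is_subgroup K" "symmetric_set S" "C \<in> cosets_of K S"
  shows "uminus ` C \<in> cosets_of K S"
proof -
  obtain s where "s \<in> S" "C = s +o K" using assms(3) by (auto simp: cosets_of_def)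
  then show ?thesis
    using uminus_coset[OF assms(1), of s] symmetric_set_mem[OF assms(2), of s]
    by (auto simp: cosets_of_def)
qed

lemma uminus_coset_neq:
  fixes S :: "'a::{ab_group_add,finite} set"
  assumes st: "has_stabilizer (subset_sums S + K) K" and SK: "S \<inter> K = {}" and C: "C \<in> cosets_of K S"
  shows "uminus ` C \<noteq> C"
proof
  note K = has_stabilizerD(1)[OF st]
  assume eq: "uminus ` C = C"
  obtain s where s: "s \<in> S" "C = s +o K" using C by (auto simp: cosets_of_def)
  then have "s +o K = (- s) +o K" using eq uminus_coset[OF K, of s] by simp
  then have "s + s \<in> K" by (simp add: subgroup_coset_eq[OF K])
  then show False using double_notin_stabilizer[OF st s(1)] s(1) SK by blast
qed

lemma even_card_cosets:
  fixes S :: "'a::{ab_group_add,finite} set"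
  assumes st: "has_stabilizer (subset_sums S + K) K" and S: "symmetric_set S" "S \<inter> K = {}"
  shows "even (card (cosets_of K S))" "even (singles K S)"
proof -
  note K = has_stabilizerD(1)[OF st]
  show "even (card (cosets_of K S))"
    by (rule even_card_involution[where f = "image uminus"])
       (use uminus_mem_cosets_of[OF K S(1)] uminus_coset_neq[OF st S(2)] in auto)
  show "even (singles K S)" unfolding singles_def
    by (rule even_card_involution[where f = "image uminus"])
       (use uminus_mem_cosets_of[OF K S(1)] uminus_coset_neq[OF st S(2)] card_Int_uminus_coset[OF S(1)] in auto)
qed

lemma plus_zero_two_coset:
  fixes X :: "'a::ab_group_add set"
  assumes "is_subgroup K" "X + K = X" "y - s \<in> K"
  shows "X + {0, y} = X + {0, s}"
proof -
  have "z +o X = (z +o K) + X" for z using assms(2) by (metis add.commute set_plus_rearrange3)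
  then have "y +o X = s +o X" using subgroup_coset_eq[OF assms(1), of y s] assms(3) by simp
  then show ?thesis by (simp add: set_plus_zero_two)
qed

lemma shift_gain_class:
  fixes X :: "'a::{ab_group_add,finite} set"
  assumes K: "is_subgroup K" "X + K = X" and y: "y - s \<in> K \<or> y + s \<in> K"
  shows "shift_gain X y = shift_gain X s" "shift_gain (X + {0, y}) s \<le> shift_gain X s"
proof -
  show "shift_gain X y = shift_gain X s"
    using y shift_gain_periodic[OF K, of y s] shift_gain_periodic[OF K, of y "- s"]
    by (auto simp: shift_gain_uminus)
  show "shift_gain (X + {0, y}) s \<le> shift_gain X s"
    using y plus_zero_two_coset[OF K, of y s] plus_zero_two_coset[OF K, of y "- s"]
      shift_gain_plus_zero_two[of X s] shift_gain_plus_zero_uminus[of X s] by auto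
qed

text \<open>When the elements of the class are put back one by one, the gain of \<open>s\<close>
  never increases. So each of them contributes at least the final gain; the induction carries this
  monotonicity as a second claim.\<close>

lemma card_subset_sums_remove_class:
  fixes Y :: "'a::{ab_group_add,finite} set"
  assumes K: "is_subgroup K" and V: "V \<subseteq> Y" and s: "\<And>y. y \<in> V \<Longrightarrow> y - s \<in> K \<or> y + s \<in> K"
  shows "card (subset_sums (Y - V) + K) + card V * shift_gain (subset_sums Y + K) s \<le> card (subset_sums Y + K)"
proof -
  have "card (subset_sums (Y - V) + K) + card V * shift_gain (subset_sums Y + K) s \<le> card (subset_sums Y + K)
      \<and> shift_gain (subset_sums Y + K) s \<le> shift_gain (subset_sums (Y - V) + K) s"
    using finite[of V] V s
  proof (induction V rule: finite_induct)
    case (insert y V)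
    let ?X = "subset_sums (Y - insert y V) + K"
    have y: "y \<in> Y - V" "Y - insert y V = (Y - V) - {y}" using insert.prems insert.hyps by auto
    have X: "?X + K = ?X" using K by (simp add: add.assoc)
    have eq: "subset_sums (Y - V) + K = ?X + {0, y}"
      unfolding y(2) subset_sums_remove[OF y(1)] by (simp add: ac_simps)
    have "y - s \<in> K \<or> y + s \<in> K" using insert.prems by simp
    note cl = shift_gain_class[OF K X this]
    show ?case
      using insert card_plus_zero_two[of ?X y] cl unfolding eq by auto
  qed simp
  then show ?thesis ..
qed

text \<open>
  The gain of removing the whole class of the maximal shift is compared with the decrease of
  \<open>coset_bound\<close>: \<open>p\<close> is the number of classes, \<open>\<mu> |K|\<close> the maximal gain, \<open>x\<close> the weight of the class
  and \<open>q\<close>, \<open>q'\<close> the number of classes of weight one before and after.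
\<close>

lemma peel_arithmetic:
  fixes p \<mu> x q q' \<beta> \<beta>' m n :: nat and T :: int
  assumes p: "0 < p" and x: "0 < x" and q: "even q" "q' \<le> 2 * (p - 1)" "q = (if x = 1 then q' + 2 else q')"
    and T: "T + 4 \<le> 8 * int \<beta>'" and T_def: "T = 4 + int m + 2 * int n - 4 * int (q' - 4)"
    and m: "(2 * (p - 1)) ^ 2 + (2 * (p - 1) - q') ^ 2 \<le> m" and n: "2 * (p - 1) + (2 * (p - 1) - q') \<le> n"
    and \<beta>: "\<beta>' + \<mu> * x \<le> \<beta>"
    and olson: "\<mu> < p \<Longrightarrow> \<beta> * (p - \<mu>) < p * (p - 1)"
    and m': "m' \<le> m + 4 * (q' + (2 * (p - 1) - q') * x) + 4 * x"
  shows "4 + int m' + 2 * int (n + 2 * x) - 4 * int (q - 4) + 4 \<le> 8 * int \<beta>"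
proof -
  obtain r where p': "p = Suc r" using p by (cases p) auto
  have m1: "4 * int r ^ 2 + (2 * int r - int q') ^ 2 \<le> int m"
  proof -
    have "int ((2 * (p - 1)) ^ 2 + (2 * (p - 1) - q') ^ 2) \<le> int m" using m by (simp only: of_nat_le_iff)
    then show ?thesis using q(2) by (simp add: p' of_nat_diff power_mult_distrib)
  qed
  have n1: "4 * int r - int q' \<le> int n" using n q(2) by (simp add: p')
  have m2: "int m' \<le> int m + 4 * (int q' + (2 * int r - int q') * int x) + 4 * int x"
  proof -
    have "int m' \<le> int (m + 4 * (q' + (2 * (p - 1) - q') * x) + 4 * x)" using m' by (simp only: of_nat_le_iff)
    then show ?thesis using q(2) by (simp add: p' of_nat_diff)
  qed
  have x1: "1 \<le> int x" using x by simp
  have b8: "8 * int \<beta>' + 8 * (int \<mu> * int x) \<le> 8 * int \<beta>"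
  proof -
    have "int (\<beta>' + \<mu> * x) \<le> int \<beta>" using \<beta> by (simp only: of_nat_le_iff)
    then show ?thesis by simp
  qed
  show ?thesis
  proof (cases "p \<le> \<mu>")
    \<comment> \<open>Full gain: the bound grows by at most \<open>8 p x\<close>, which
      \<open>x\<close> elements gaining \<open>p\<close> each provide.\<close>
    case True
    then have "(int r + 1) * int x \<le> int \<mu> * int x" by (intro mult_right_mono) (auto simp: p')
    moreover have "int q' + (2 * int r - int q') * int x \<le> 2 * int r * int x"
      using mult_left_mono[OF x1, of "int q'"] by (simp add: algebra_simps)
    moreover have "int (q' - 4) \<le> int (q - 4)" using q(3) by auto
    ultimately show ?thesis using m2 T b8 unfolding T_def by (simp add: algebra_simps)
  next
    case False
    define d where "d = p - \<mu>"
    have d: "1 \<le> d" "d \<le> p" "int \<mu> = int r + 1 - int d" using False by (auto simp: d_def p')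
    have ol: "int \<beta> * int d < (int r + 1) * int r"
    proof -
      have "int (\<beta> * d) < int (Suc r * r)" using olson False unfolding d_def p' by (simp only: of_nat_less_iff not_le) simp
      then show ?thesis by (simp add: algebra_simps)
    qed
    have mu_le: "int \<mu> \<le> int \<mu> * int x" using mult_left_mono[OF x1, of "int \<mu>"] by simp
    define h where "h = 2 * int r - int q'"
    have h0: "0 \<le> h" using q(2) by (simp add: h_def p')
    have b': "8 + 4 * int r ^ 2 + h ^ 2 + 4 * int r + 2 * h - 4 * int (q' - 4) \<le> 8 * int \<beta>'"
      using T m1 n1 unfolding T_def h_def by (simp add: algebra_simps)
    have r0: False if "r = 0" using ol that d by (auto simp: mult_less_0_iff)
    show ?thesis
    proof (cases "d = 1")
      \<comment> \<open>With gain \<open>p - 1\<close> there is a deficit of \<open>8 x\<close>. For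
        \<open>q' \<ge> 4\<close> it is covered, for \<open>x = 1\<close> by the growth of the
        correction term and for \<open>x \<ge> 2\<close> by the \<open>q'\<close> single classes,
        whose minimum with \<open>x\<close> is only 1. For smaller \<open>q'\<close> the bound for
        \<open>\<beta>'\<close> contradicts Olson's bound for \<open>\<beta>\<close>.\<close>
      case True
      then have mu: "int \<mu> = int r" and ol1: "int \<beta> < int r ^ 2 + int r"
        using d(3) ol by (simp_all add: power2_eq_square algebra_simps)
      show ?thesis
      proof (cases "4 \<le> q'")
        case big: True
        then have q4: "int (q' - 4) = int q' - 4" by simp
        show ?thesis
        proof (cases "x = 1")
          case True
          then have "int (q - 4) = int q' - 2" using q(3) big by auto
          then show ?thesis using m2 T b8 True unfolding T_def q4 mu by simp
        next
          case False
          then have qq: "int (q - 4) = int q' - 4" using q(3) big by simp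
          have "2 * 1 \<le> (int q' - 2) * (int x - 1)" using big False x by (intro mult_mono) auto
          then have "int q' + 2 * int x \<le> int q' * int x" by (simp add: algebra_simps)
          then show ?thesis using m2 T b8 unfolding T_def q4 qq mu by (simp add: algebra_simps)
        qed
      next
        case False
        then have "q' \<le> 2" using q(1,3) by (cases "q' = 3") (auto split: if_splits)
        then have "2 * int r - 2 \<le> h" "int (q' - 4) = 0" by (auto simp: h_def)
        moreover have "(2 * int r - 2) ^ 2 \<le> h ^ 2"
        proof (rule power_mono)
          have "r \<noteq> 0" using r0 by blast
          then show "0 \<le> 2 * int r - 2" by simp
        qed (rule calculation(1))
        ultimately have "8 * int r ^ 2 + 8 \<le> 8 * int \<beta>'"
          using b' by (simp add: power2_eq_square algebra_simps)
        then show ?thesis using b8 mu_le ol1 mu by linarith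
      qed
    next
      case False
      then have d2: "2 \<le> int d" using d(1) by simp
      have dr: "int d \<le> int r + 1" using d(2) by (simp add: p')
      have b1: "8 * int \<beta>' + 8 * (int r + 1 - int d) \<le> 8 * int \<beta>" unfolding d(3)[symmetric] using b8 mu_le by linarith
      have hh: "0 \<le> h ^ 2" by simp
      have "24 + 4 * int r ^ 2 - 4 * int r \<le> 8 * int \<beta>' \<or> r = 1 \<and> 16 \<le> 8 * int \<beta>'"
      proof (cases "4 \<le> q'")
        case True
        then have "int (q' - 4) = int q' - 4" by simp
        then show ?thesis using b' hh h0 h_def by linarith
      next
        case small: False
        then have q4: "int (q' - 4) = 0" by simp
        show ?thesis
        proof (cases "r = 1")
          case True
          then have "int r ^ 2 = 1" "int r = 1" by simp_all
          then show ?thesis using b' hh h0 q4 True by linarith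
        next
          case False
          moreover have "r \<noteq> 0" using r0 by blast
          ultimately have "2 \<le> int r" by simp
          then show ?thesis using b' hh h0 q4 by linarith
        qed
      qed
      then have False
      proof
        assume "24 + 4 * int r ^ 2 - 4 * int r \<le> 8 * int \<beta>'"
        then have "4 * int r ^ 2 + 4 * int r + 32 - 8 * int d \<le> 8 * int \<beta>" using b1 by (simp add: algebra_simps)
        then have e1: "(4 * int r ^ 2 + 4 * int r + 32 - 8 * int d) * int d \<le> 8 * int \<beta> * int d"
          by (rule mult_right_mono) simp
        have "int d * (int d - 1) \<le> (int r + 1) * int r" using dr d2 by (intro mult_mono) auto
        then have e2: "(int d - 2) * (int d * (int d - 1)) \<le> (int d - 2) * ((int r + 1) * int r)"
          using d2 by (intro mult_left_mono) auto
        have "0 \<le> (int d - 2) * (int d - 3)" using d2 by (cases "int d = 2") auto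
        then have e3: "0 \<le> int d * ((int d - 2) * (int d - 3))" by simp
        show False using e1 e2 e3 ol d2 by (simp add: algebra_simps power2_eq_square)
      next
        assume a: "r = 1 \<and> 16 \<le> 8 * int \<beta>'"
        then have "int d = 2" using dr d2 by simp
        then show False using ol a b1 by simp
      qed
      then show ?thesis ..
    qed
  qed
qed

lemma cosets_of_remove_class:
  fixes S :: "'a::{ab_group_add,finite} set"
  assumes K: "is_subgroup K" and C: "C \<in> cosets_of K S" "uminus ` C \<in> cosets_of K S"
  defines "S' \<equiv> S - (C \<union> uminus ` C)"
  shows "cosets_of K S = insert C (insert (uminus ` C) (cosets_of K S'))"
    and "C \<notin> cosets_of K S'" "uminus ` C \<notin> cosets_of K S'"
    and "D \<in> cosets_of K S' \<Longrightarrow> S' \<inter> D = S \<inter> D"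
proof -
  have mem: "s \<in> s +o K" for s using is_subgroupD(1)[OF K] by (simp add: mem_elt_set_plus)
  have notin: "D \<notin> cosets_of K S'" if "D = C \<or> D = uminus ` C" for D
  proof
    assume "D \<in> cosets_of K S'"
    then obtain s where "s \<in> S'" "D = s +o K" by (auto simp: cosets_of_def)
    then show False using mem[of s] that by (auto simp: S'_def)
  qed
  then show "C \<notin> cosets_of K S'" "uminus ` C \<notin> cosets_of K S'" by blast+
  show "cosets_of K S = insert C (insert (uminus ` C) (cosets_of K S'))"
  proof
    show "cosets_of K S \<subseteq> insert C (insert (uminus ` C) (cosets_of K S'))"
    proof
      fix D assume "D \<in> cosets_of K S"
      then obtain s where s: "s \<in> S" "D = s +o K" by (auto simp: cosets_of_def)
      show "D \<in> insert C (insert (uminus ` C) (cosets_of K S'))"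
      proof (cases "s \<in> S'")
        case True
        then show ?thesis using s(2) by (auto simp: cosets_of_def)
      next
        case False
        then have "s \<in> C \<or> s \<in> uminus ` C" using s(1) by (auto simp: S'_def)
        then show ?thesis using coset_of_mem[OF K C(1)] coset_of_mem[OF K C(2)] s(2) by blast
      qed
    qed
    show "insert C (insert (uminus ` C) (cosets_of K S')) \<subseteq> cosets_of K S"
      using C by (auto simp: cosets_of_def S'_def)
  qed
  assume D: "D \<in> cosets_of K S'"
  then have DS: "D \<in> cosets_of K S" by (auto simp: cosets_of_def S'_def)
  have disj: "D \<inter> E = {}" if "E \<in> cosets_of K S" "E = C \<or> E = uminus ` C" for E
  proof (rule ccontr)
    assume "D \<inter> E \<noteq> {}"
    then obtain x where "x \<in> D" "x \<in> E" by blast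
    then have "E = D" using coset_of_mem[OF K DS] coset_of_mem[OF K that(1)] by metis
    then show False using notin[OF that(2)] D by simp
  qed
  have "D \<inter> (C \<union> uminus ` C) = {}" using disj[OF C(1)] disj[OF C(2)] by (simp add: Int_Un_distrib)
  then show "S' \<inter> D = S \<inter> D" unfolding S'_def by blast
qed

lemma sum_min_le:
  fixes f :: "'b \<Rightarrow> nat"
  assumes "finite C" "0 < x" "\<And>c. c \<in> C \<Longrightarrow> 1 \<le> f c"
  shows "(\<Sum>c\<in>C. min x (f c)) \<le> card {c \<in> C. f c = 1} + (card C - card {c \<in> C. f c = 1}) * x"
proof -
  have "(\<Sum>c\<in>C. min x (f c)) \<le> (\<Sum>c\<in>C. if f c = 1 then 1 else x)"
    by (rule sum_mono) auto
  also have "\<dots> = card {c \<in> C. f c = 1} + card {c \<in> C. f c \<noteq> 1} * x"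
    using assms(1) by (simp add: sum.If_cases Int_def)
  also have "card {c \<in> C. f c \<noteq> 1} = card C - card {c \<in> C. f c = 1}"
  proof -
    have "{c \<in> C. f c \<noteq> 1} = C - {c \<in> C. f c = 1}" by auto
    then show ?thesis using assms(1) by (simp add: card_Diff_subset)
  qed
  finally show ?thesis .
qed

lemma maximizer_exists:
  fixes f :: "'a \<Rightarrow> 'b::linorder"
  assumes "finite S" "S \<noteq> {}"
  shows "\<exists>s\<in>S. \<forall>t\<in>S. f t \<le> f s"
proof -
  have "Max (f ` S) \<in> f ` S" using assms by (intro Max_in) auto
  then obtain s where "s \<in> S" "Max (f ` S) = f s" by blast
  moreover from this(2) have "f t \<le> f s" if "t \<in> S" for t
    using that assms(1) by (metis Max_ge finite_imageI imageI)
  ultimately show ?thesis by blast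
qed

text \<open>Induction on \<open>|S|\<close>, deleting both classes of an element with the largest
  gain: what remains is a union of classes, hence again spread, and \<open>shift_gain_large\<close>
  keeps the gain from being small. The summand 4 pays for the \<open>|K|\<close> lost in
  \<open>card_difference_set\<close>.\<close>

theorem coset_bound_half:
  fixes S :: "'a::{ab_group_add,finite} set"
  assumes "has_stabilizer (subset_sums S + K) K" "symmetric_set S" "S \<inter> K = {}" "spread K S" "is_half S Y"
  shows "int (card K) * (coset_bound K S + 4) \<le> 8 * int (card (subset_sums Y + K))"
  using assms
proof (induction "card S" arbitrary: S Y rule: less_induct)
  case less
  note st = less.prems(1) and S = less.prems(2,3) and spr = less.prems(4) and Y = less.prems(5)
  note K = has_stabilizerD(1)[OF st]
  show ?case
  proof (cases "S = {}")
    case True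
    then have "Y = {}" using is_halfD(1)[OF Y] by simp
    then show ?thesis using True
      by (simp add: coset_bound_def cosets_of_def min_weight_sum_def singles_def)
  next
    case False
    let ?w = "\<lambda>C. card (S \<inter> C)"
    define B where "B = subset_sums Y + K"
    have BK: "B + K = B" using K by (simp add: B_def add.assoc)
    obtain s where s: "s \<in> S" "\<And>t. t \<in> S \<Longrightarrow> shift_gain B t \<le> shift_gain B s"
      using maximizer_exists[of S "shift_gain B"] False by auto
    define C where "C = s +o K"
    define x where "x = ?w C"
    define D where "D = C \<union> uminus ` C"
    define S' where "S' = S - D"
    define Y' where "Y' = Y - D"
    have CS: "C \<in> cosets_of K S" using s(1) by (simp add: C_def cosets_of_def)
    note mCS = uminus_mem_cosets_of[OF K S(1) CS] and mC = uminus_coset_neq[OF st S(2) CS]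
    note rc = cosets_of_remove_class[OF K CS mCS, folded D_def, folded S'_def]
    have disjC: "C \<inter> uminus ` C = {}"
      using subgroup_cosets_disjoint[OF K, of s "- s"] mC unfolding C_def uminus_coset[OF K] by metis
    have wm: "?w (uminus ` C) = x" unfolding x_def by (rule card_Int_uminus_coset[OF S(1)])
    have SD: "card (S \<inter> D) = 2 * x"
    proof -
      have "S \<inter> D = (S \<inter> C) \<union> (S \<inter> uminus ` C)" by (auto simp: D_def)
      moreover have "(S \<inter> C) \<inter> (S \<inter> uminus ` C) = {}" using disjC by blast
      ultimately show ?thesis using wm by (simp add: card_Un_disjoint x_def)
    qed
    have symD: "symmetric_set D" by (rule symmetric_setI) (auto simp: D_def mem_uminus_image)
    have S'sub: "S' \<subseteq> S" by (auto simp: S'_def)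
    have S'sym: "symmetric_set S'" unfolding S'_def by (rule symmetric_set_Diff[OF S(1) symD])
    have cS: "card S = card S' + 2 * x"
      using card_Int_Diff[of S D] SD by (simp add: S'_def)
    have x0: "0 < x" using card_Int_coset_pos[OF K CS] by (simp add: x_def)
    have Yh: "is_half (S \<inter> E) (Y \<inter> E)" if "symmetric_set E" for E
    proof -
      have eq: "S \<inter> E = (Y \<inter> E) \<union> uminus ` (Y \<inter> E)"
        using is_halfD(2)[OF Y] symmetric_set_mem[OF that] by (auto simp: mem_uminus_image)
      have "(Y \<inter> E) \<inter> uminus ` (Y \<inter> E) = {}" using is_halfD(4)[OF Y] by blast
      then show ?thesis using eq is_halfD(1)[OF Y] by (auto simp: is_half_def card_Un_disjoint)
    qed
    have Y'h: "is_half S' Y'"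
    proof -
      have "symmetric_set (- D)" by (rule symmetric_setI) (auto simp: symmetric_set_mem[OF symD])
      then show ?thesis using Yh[of "- D"] by (simp add: S'_def Y'_def Diff_eq)
    qed
    have cYD: "card (Y \<inter> D) = x" using is_halfD(3)[OF Yh[OF symD]] SD by simp
    have cc: "coset_closed K S S'"
    proof -
      have "S \<inter> (t +o K) \<subseteq> S'" if "t \<in> S'" for t
      proof -
        have "t +o K \<in> cosets_of K S'" using that by (simp add: cosets_of_def)
        from rc(4)[OF this] show ?thesis by blast
      qed
      then show ?thesis using S'sub S'sym by (simp add: coset_closed_def)
    qed
    define B' where "B' = subset_sums Y' + K"
    have IH: "int (card K) * (coset_bound K S' + 4) \<le> 8 * int (card B')"
      unfolding B'_def
    proof (rule less.hyps[OF _ _ S'sym _ _ Y'h])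
      show "card S' < card S" using cS x0 by simp
      show "has_stabilizer (subset_sums S' + K) K" by (rule has_stabilizer_subset[OF st S'sub])
      show "S' \<inter> K = {}" using S(2) S'sub by blast
      show "spread K S'" by (rule spread_coset_closed[OF spr cc])
    qed
    have dvdB: "card K dvd card A" if "A + K = A" for A :: "'a set"
      using card_plus_subgroup[OF K, of A] that by simp
    obtain \<beta> where \<beta>: "card B = card K * \<beta>" using dvdB[OF BK] by (rule dvdE)
    have "B' + K = B'" using K by (simp add: B'_def add.assoc)
    then obtain \<beta>' where \<beta>': "card B' = card K * \<beta>'" using dvdB by (blast elim: dvdE)
    obtain \<mu> where \<mu>: "shift_gain B s = card K * \<mu>" using dvd_shift_gain[OF K BK] by (rule dvdE)
    have pos: "0 < card K" by (rule card_subgroup_pos[OF K])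
    have gain: "card B' + x * shift_gain B s \<le> card B"
    proof -
      have "y - s \<in> K \<or> y + s \<in> K" if "y \<in> Y \<inter> D" for y
        using that unfolding D_def C_def uminus_coset[OF K] by (auto simp: mem_elt_set_plus)
      from card_subset_sums_remove_class[of K "Y \<inter> D" Y s, OF K Int_lower1 this]
      have "card (subset_sums (Y - Y \<inter> D) + K) + x * shift_gain B s \<le> card B"
        by (simp add: B_def cYD)
      moreover have "Y - Y \<inter> D = Y'" by (auto simp: Y'_def)
      ultimately show ?thesis by (simp add: B'_def)
    qed
    have gain': "\<beta>' + \<mu> * x \<le> \<beta>"
    proof -
      have "card K * (\<beta>' + \<mu> * x) \<le> card K * \<beta>"
        using gain unfolding \<beta> \<beta>' \<mu> by (simp add: algebra_simps)
      then show ?thesis using pos by simp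
    qed
    have IH': "coset_bound K S' + 4 \<le> 8 * int \<beta>'"
    proof -
      have "int (card K) * (coset_bound K S' + 4) \<le> int (card K) * (8 * int \<beta>')"
        using IH unfolding \<beta>' by (simp add: algebra_simps)
      then show ?thesis using pos by simp
    qed
    obtain p where p: "card (cosets_of K S) = 2 * p" using even_card_cosets(1)[OF st S] by (rule evenE)
    have cS': "card (cosets_of K S) = card (cosets_of K S') + 2"
      using rc(2,3) mC by (subst rc(1)) (simp add: card_insert_if)
    have p0: "0 < p" and p': "card (cosets_of K S') = 2 * (p - 1)" using cS' p by auto
    have SK: "card (S + K) = card K * (2 * p)" using card_plus_subgroup[OF K, of S] p by simp
    have w': "card (S' \<inter> E) = ?w E" if "E \<in> cosets_of K S'" for E using rc(4)[OF that] by simp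
    define q' where "q' = singles K S'"
    have q'_eq: "q' = card {E \<in> cosets_of K S'. ?w E = 1}"
      unfolding q'_def singles_def using w' by (metis (mono_tags, lifting) Collect_cong)
    have q_eq: "singles K S = (if x = 1 then q' + 2 else q')"
    proof -
      have "{E \<in> cosets_of K S. ?w E = 1} =
          (if x = 1 then insert C (insert (uminus ` C) {E \<in> cosets_of K S'. ?w E = 1})
           else {E \<in> cosets_of K S'. ?w E = 1})"
        using wm by (subst rc(1)) (auto simp: x_def)
      then show ?thesis using rc(2,3) mC by (simp add: singles_def q'_eq card_insert_if)
    qed
    define m where "m = min_weight_sum (cosets_of K S') ?w"
    have m_eq: "min_weight_sum (cosets_of K S') (\<lambda>E. card (S' \<inter> E)) = m"
      unfolding m_def min_weight_sum_def using w' by simp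
    have w1: "1 \<le> ?w E" if "E \<in> cosets_of K S'" for E
      using card_Int_coset_pos[OF K that] w'[OF that] by simp
    have heavy: "card {E \<in> cosets_of K S'. ?w E \<noteq> 1} = 2 * (p - 1) - q'" "q' \<le> 2 * (p - 1)"
    proof -
      have "{E \<in> cosets_of K S'. ?w E \<noteq> 1} = cosets_of K S' - {E \<in> cosets_of K S'. ?w E = 1}" by auto
      then show "card {E \<in> cosets_of K S'. ?w E \<noteq> 1} = 2 * (p - 1) - q'"
        unfolding q'_eq p'[symmetric] by (simp add: card_Diff_subset)
      show "q' \<le> 2 * (p - 1)" unfolding q'_eq p'[symmetric] by (intro card_mono) auto
    qed
    have n: "2 * (p - 1) + (2 * (p - 1) - q') \<le> card S'"
    proof -
      have "(\<Sum>E\<in>cosets_of K S'. 1 + (if ?w E \<noteq> 1 then 1 else 0)) \<le> (\<Sum>E\<in>cosets_of K S'. card (S' \<inter> E))"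
      proof (rule sum_mono)
        fix E assume "E \<in> cosets_of K S'"
        from w'[OF this] w1[OF this] show "1 + (if ?w E \<noteq> 1 then 1 else 0) \<le> card (S' \<inter> E)" by auto
      qed
      then show ?thesis
        unfolding card_eq_sum_cosets[OF K, of S'] heavy(1)[symmetric] sum.distrib
        by (simp add: p' sum.If_cases Int_def)
    qed
    have "coset_bound K S + 4 \<le> 8 * int \<beta>"
      unfolding coset_bound_def cS
    proof (rule peel_arithmetic[OF p0 x0 _ heavy(2) q_eq IH' _ _ n gain'])
      show "even (singles K S)" by (rule even_card_cosets(2)[OF st S])
      show "coset_bound K S' = 4 + int m + 2 * int (card S') - 4 * int (q' - 4)"
        by (simp add: coset_bound_def m_eq q'_def)
      show "(2 * (p - 1)) ^ 2 + (2 * (p - 1) - q') ^ 2 \<le> m"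
        using min_weight_sum_ge[of "cosets_of K S'" ?w] w1 unfolding m_def heavy(1) p' by simp
      show "min_weight_sum (cosets_of K S) ?w \<le> m + 4 * (q' + (2 * (p - 1) - q') * x) + 4 * x"
      proof -
        have "min_weight_sum (cosets_of K S) ?w = m + 4 * (\<Sum>E\<in>cosets_of K S'. min x (?w E)) + 4 * x"
          unfolding m_def by (subst rc(1), rule min_weight_sum_insert2)
            (use rc(2,3) mC wm in \<open>auto simp: x_def\<close>)
        moreover have "(\<Sum>E\<in>cosets_of K S'. min x (?w E)) \<le> q' + (2 * (p - 1) - q') * x"
          using sum_min_le[of "cosets_of K S'" x ?w] x0 w1 unfolding q'_eq p' by simp
        ultimately show ?thesis by simp
      qed
      show "\<beta> * (p - \<mu>) < p * (p - 1)" if "\<mu> < p"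
      proof (rule ccontr)
        assume neg: "\<not> ?thesis"
        have dense: "card P + card (S + K) \<le> card (P + insert 0 S)"
          if "is_subgroup P" "K \<subset> P" "\<not> S \<subseteq> P" for P
        proof -
          have "coset_closed K S S" using S(1) by (simp add: coset_closed_def)
          then show ?thesis using spr that unfolding spread_def by blast
        qed
        have "0 \<in> B" using set_plus_intro[OF zero_mem_subset_sums is_subgroupD(1)[OF K], of Y] by (simp add: B_def)
        then have "card B \<noteq> 0" by auto
        then have "0 < \<beta>" using \<beta> by simp
        moreover have "min (2 * card B) (card K * (2 * p * j + 1)) \<le> card (ball K S j)" for j
          using ball_growth[OF K S(2) dense SK, of "card B" j] card_half_sums_le[OF st S(2) False Y]
          by (simp add: B_def)
        moreover have "shift_gain B t \<le> card K * \<mu>" if "t \<in> S" for t using s(2)[OF that] \<mu> by simp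
        ultimately show False
          using shift_gain_large[OF K BK \<beta>, of p S \<mu>] \<open>\<mu> < p\<close> neg by simp
      qed
    qed
    then have "int (card K) * (coset_bound K S + 4) \<le> int (card K) * (8 * int \<beta>)"
      by (rule mult_left_mono) simp
    then show ?thesis using \<beta> by (simp add: B_def mult.left_commute)
  qed
qed

section \<open>The bound for symmetric sets\<close>

text \<open>The last alternative makes the deletion of \<open>z\<close> affordable later: either its
  class survives, or there are so many single classes that their number fully counts in the
  correction term of \<open>coset_bound\<close>.\<close>

lemma not_spread_absorb:
  fixes S :: "'a::{ab_group_add,finite} set"
  assumes st: "has_stabilizer (subset_sums S + K) K" and S: "symmetric_set S" "S \<inter> K = {}"
    and ns: "\<not> spread K S"
  obtains P z where "is_subgroup P" "K \<subset> P" "z \<in> S" "z \<notin> P"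
    and "subset_sums (S - {z, - z}) + P \<subseteq> subset_sums S + K"
    and "2 \<le> card (S \<inter> (z +o K)) \<or> 8 \<le> singles K S"
proof -
  note K = has_stabilizerD(1)[OF st]
  obtain T P where T: "coset_closed K S T" and P: "is_subgroup P" "K \<subset> P" and TP: "\<not> T \<subseteq> P"
    and dense: "card (P + insert 0 T) < card P + card (T + K)"
    using ns by (auto simp: spread_def not_le)
  have TS: "T \<subseteq> S" "symmetric_set T" using T by (auto simp: coset_closed_def)
  have TK: "T \<inter> K = {}" using TS(1) S(2) by blast
  have stT: "has_stabilizer (subset_sums T + K) K" by (rule has_stabilizer_subset[OF st TS(1)])
  have KP: "K \<subseteq> P" using P(2) by blast
  have double: "z + z \<notin> P" if "z \<in> T" "z \<notin> P" for z
    using strictly_dense_subgroup_double[OF stT TK P(1) KP that dense] .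
  have absorb: "subset_sums (S - {z, - z}) + P \<subseteq> subset_sums S + K" if z: "z \<in> T" "z \<notin> P" for z
  proof -
    have sub: "subset_sums (T - {z, - z}) + P \<subseteq> subset_sums T + K"
      using dense by (intro dense_subgroup_absorb[OF stT TS(2) TK P(1) KP z(1) double[OF z]]) simp
    have "- z \<in> T" using z(1) symmetric_set_mem[OF TS(2)] by simp
    then have "S - {z, - z} - (T - {z, - z}) = S - T" "T - {z, - z} \<subseteq> S - {z, - z}"
      using z(1) TS(1) by auto
    then have "subset_sums (S - {z, - z}) + P = (subset_sums (T - {z, - z}) + P) + subset_sums (S - T)"
      using subset_sums_Diff[of "T - {z, - z}" "S - {z, - z}"] by (simp add: ac_simps)
    also have "\<dots> \<subseteq> (subset_sums T + K) + subset_sums (S - T)" by (rule set_plus_mono_left[OF sub])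
    also have "\<dots> = subset_sums S + K" using subset_sums_Diff[OF TS(1)] by (simp add: ac_simps)
    finally show ?thesis .
  qed
  obtain z where z: "z \<in> T" "z \<notin> P" using TP by blast
  show ?thesis
  proof (cases "\<exists>z\<in>T - P. 2 \<le> card (S \<inter> (z +o K))")
    case True
    then obtain z where "z \<in> T" "z \<notin> P" "2 \<le> card (S \<inter> (z +o K))" by blast
    then show ?thesis using that[OF P, of z] absorb[of z] TS(1) by blast
  next
    case False
    have single: "card (S \<inter> (t +o K)) = 1" if "t \<in> T - P" for t
    proof -
      have "t +o K \<in> cosets_of K S" using that TS(1) by (auto simp: cosets_of_def)
      then have "1 \<le> card (S \<inter> (t +o K))" by (rule card_Int_coset_pos[OF K])
      moreover have "\<not> 2 \<le> card (S \<inter> (t +o K))" using False that by blast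
      ultimately show ?thesis by linarith
    qed
    have "cosets_of K (T - P) \<subseteq> {C \<in> cosets_of K S. card (S \<inter> C) = 1}"
      using single TS(1) by (auto simp: cosets_of_def)
    then have "card (cosets_of K (T - P)) \<le> singles K S" unfolding singles_def by (intro card_mono) auto
    \<comment> \<open>With \<open>?I\<close> for the part in \<open>P\<close>:
      \<open>|(T - P) + K| > 2 |P| - |?I|\<close>, \<open>|P| \<ge> |?I| + 2 |K|\<close> and
      \<open>|?I| \<ge> 2 |K|\<close>. Since the number of single classes is even, more than six
      means at least eight.\<close>
    moreover have "6 < card (cosets_of K (T - P))"
    proof -
      let ?I = "(T \<inter> P) + K"
      have pos: "0 < card K" by (rule card_subgroup_pos[OF K])
      have "T + K = ?I \<union> ((T - P) + K)" unfolding Un_set_plus[symmetric] by (rule arg_cong2[where f = "(+)"]) auto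
      then have c1: "card (T + K) \<le> card ?I + card ((T - P) + K)" using card_Un_le by metis
      have "(z +o P) \<union> ((- z) +o P) \<subseteq> (T - P) + P"
        using z symmetric_set_mem[OF TS(2), of z] is_subgroupD(2)[OF P(1), of "- z"]
        by (intro Un_least set_plus_mono3) auto
      moreover have "(z +o P) \<inter> ((- z) +o P) = {}"
        using double[OF z] by (intro subgroup_cosets_disjoint[OF P(1)]) (simp add: subgroup_coset_eq[OF P(1)])
      ultimately have c2: "2 * card P \<le> card ((T - P) + P)"
        using card_mono[of "(T - P) + P" "(z +o P) \<union> ((- z) +o P)"] by (simp add: card_Un_disjoint)
      have c3: "card ((T - P) + P) < card (T + K)"
        using dense card_subgroup_plus_insert[OF P(1), of T] by simp
      have "(T - P) + K \<subseteq> (T - P) + P" using KP by (intro set_plus_mono2) auto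
      then have "card ((T - P) + K) \<le> card ((T - P) + P)" by (intro card_mono) auto
      then have I0: "0 < card ?I" using c1 c3 by linarith
      define R where "R = subset_sums (T \<inter> P) + K"
      have stR: "has_stabilizer R K" unfolding R_def by (rule has_stabilizer_subset[OF stT]) simp
      have "R \<subseteq> P"
        using set_plus_mono2[OF subset_sums_subset_subgroup[OF P(1), of "T \<inter> P"] KP] P(1) by (simp add: R_def)
      moreover have "R \<noteq> P"
        using periodic_subgroup_subset_stabilizer[OF stR, of P] P by auto
      ultimately have "card R < card P" by (intro psubset_card_mono) auto
      moreover have "card K dvd card R" "card K dvd card P"
        using card_plus_subgroup[OF K, of R] card_plus_subgroup[OF K, of P] has_stabilizerD(2)[OF stR]
          subgroup_plus_subset[OF P(1) KP is_subgroupD(1)[OF K]] by simp_all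
      ultimately have "card R + card K \<le> card P" by (rule dvd_less_imp_add_le)
      moreover have "card K + card ?I \<le> card R"
        unfolding R_def by (rule subset_sums_Int_subgroup_bound[OF stT TK])
      moreover have "2 * card K \<le> card ?I"
      proof -
        have stI: "has_stabilizer (subset_sums (T \<inter> P) + K) K" using stR by (simp add: R_def)
        have "even (card (cosets_of K (T \<inter> P)))"
          by (rule even_card_cosets(1)[OF stI symmetric_set_Int_subgroup[OF TS(2) P(1)]]) (use TK in auto)
        moreover have "card (cosets_of K (T \<inter> P)) \<noteq> 0"
          using I0 card_plus_subgroup[OF K, of "T \<inter> P"] by (metis mult_0_right less_irrefl)
        ultimately have "2 \<le> card (cosets_of K (T \<inter> P))" by presburger
        then show ?thesis using card_plus_subgroup[OF K, of "T \<inter> P"] by (simp add: mult.commute)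
      qed
      ultimately have "6 * card K < card ((T - P) + K)" using c1 c2 c3 by linarith
      then show ?thesis using card_plus_subgroup[OF K, of "T - P"] pos by (simp add: mult.commute)
    qed
    moreover have "even (singles K S)" by (rule even_card_cosets(2)[OF st S])
    ultimately have "8 \<le> singles K S" by presburger
    then show ?thesis using that[OF P, of z] absorb[OF z] z TS(1) by blast
  qed
qed

section \<open>Weight sums under deletion and refinement\<close>

lemma min_weight_sum_supersets:
  assumes "finite B" "A \<subseteq> B" "\<And>c. c \<in> B - A \<Longrightarrow> f c = 0"
  shows "min_weight_sum A f = min_weight_sum B f"
proof -
  have "(\<Sum>b\<in>A. min (f a) (f b)) = (\<Sum>b\<in>B. min (f a) (f b))" for a
    using assms by (intro sum.mono_neutral_left) auto
  moreover have "(\<Sum>a\<in>A. \<Sum>b\<in>B. min (f a) (f b)) = (\<Sum>a\<in>B. \<Sum>b\<in>B. min (f a) (f b))"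
    using assms by (intro sum.mono_neutral_left) auto
  ultimately show ?thesis by (simp add: min_weight_sum_def)
qed

lemma min_weight_sum_cong:
  "(\<And>c. c \<in> A \<Longrightarrow> f c = g c) \<Longrightarrow> min_weight_sum A f = min_weight_sum A g"
  by (simp add: min_weight_sum_def)

lemma min_weight_sum_Un_le:
  assumes "finite A" "finite B" "A \<inter> B = {}"
  shows "min_weight_sum (A \<union> B) f \<le> min_weight_sum A f + 2 * card A * sum f B + min_weight_sum B f"
proof -
  have "(\<Sum>a\<in>A. \<Sum>b\<in>B. min (f a) (f b)) \<le> (\<Sum>a\<in>A. \<Sum>b\<in>B. f b)" by (intro sum_mono) simp
  then have 1: "(\<Sum>a\<in>A. \<Sum>b\<in>B. min (f a) (f b)) \<le> card A * sum f B" by simp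
  have "(\<Sum>b\<in>B. \<Sum>a\<in>A. min (f b) (f a)) = (\<Sum>a\<in>A. \<Sum>b\<in>B. min (f a) (f b))"
    by (subst sum.swap) (simp add: min.commute)
  then show ?thesis using 1 assms
    by (simp add: min_weight_sum_def sum.union_disjoint sum.distrib)
qed

text \<open>A pair loses one only if both its weights are at least \<open>x\<close>, and the four pairs on \<open>{c, d}\<close> are counted twice.\<close>

lemma min_weight_sum_decrement2:
  fixes f f0 :: "'b \<Rightarrow> nat"
  assumes fin: "finite A" and cd: "c \<in> A" "d \<in> A" "c \<noteq> d" and x: "f c = x" "f d = x" "0 < x"
    and f0: "\<And>a. a \<in> A \<Longrightarrow> f0 a = (if a = c \<or> a = d then f a - 1 else f a)"
  shows "int (min_weight_sum A f) \<le> int (min_weight_sum A f0) + 4 * int (card {a \<in> A. x \<le> f a}) - 4"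
proof -
  let ?z = "\<lambda>a. if a = c \<or> a = d then 1 else 0 :: int"
  let ?g = "\<lambda>a. if x \<le> f a then 1 else 0 :: int"
  have z: "(\<Sum>a\<in>A. ?z a) = 2"
  proof -
    have "(\<Sum>a\<in>A. ?z a) = int (card {a \<in> A. a = c \<or> a = d})" using fin by (simp add: sum.If_cases Int_def)
    moreover have "{a \<in> A. a = c \<or> a = d} = {c, d}" using cd by blast
    ultimately show ?thesis using cd(3) by simp
  qed
  have g: "(\<Sum>a\<in>A. ?g a) = int (card {a \<in> A. x \<le> f a})" using fin by (simp add: sum.If_cases Int_def)
  have "int (min (f a) (f b)) \<le> int (min (f0 a) (f0 b)) + (?z a * ?g b + ?g a * ?z b - ?z a * ?z b)"
    if "a \<in> A" "b \<in> A" for a b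
    using f0[OF that(1)] f0[OF that(2)] x by (auto simp: min_def)
  then have "(\<Sum>a\<in>A. \<Sum>b\<in>A. int (min (f a) (f b)))
      \<le> (\<Sum>a\<in>A. \<Sum>b\<in>A. int (min (f0 a) (f0 b)) + (?z a * ?g b + ?g a * ?z b - ?z a * ?z b))"
    by (intro sum_mono)
  also have "\<dots> = (\<Sum>a\<in>A. \<Sum>b\<in>A. int (min (f0 a) (f0 b)))
      + ((\<Sum>a\<in>A. ?z a) * (\<Sum>b\<in>A. ?g b) + (\<Sum>a\<in>A. ?g a) * (\<Sum>b\<in>A. ?z b) - (\<Sum>a\<in>A. ?z a) * (\<Sum>b\<in>A. ?z b))"
    by (simp only: sum.distrib sum_subtractf sum_product)
  finally show ?thesis unfolding z g by (simp add: min_weight_sum_def)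
qed

lemma cosets_of_refine:
  fixes S :: "'a::{ab_group_add,finite} set"
  assumes K: "is_subgroup K" and L: "is_subgroup L" "K \<subseteq> L"
  shows "cosets_of K S = (\<Union>E\<in>cosets_of L S. cosets_of K (S \<inter> E))"
    and "E \<in> cosets_of L S \<Longrightarrow> C \<in> cosets_of K (S \<inter> E) \<Longrightarrow> C \<subseteq> E"
    and "E \<in> cosets_of L S \<Longrightarrow> E' \<in> cosets_of L S \<Longrightarrow> E \<noteq> E' \<Longrightarrow>
      cosets_of K (S \<inter> E) \<inter> cosets_of K (S \<inter> E') = {}"
proof -
  have mem: "s \<in> s +o L" "s \<in> s +o K" for s
    using is_subgroupD(1)[OF K] is_subgroupD(1)[OF L(1)] by (simp_all add: mem_elt_set_plus)
  show sub: "C \<subseteq> E" if E: "E \<in> cosets_of L S" and C: "C \<in> cosets_of K (S \<inter> E)" for C E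
  proof -
    obtain s where s: "s \<in> E" "C = s +o K" using C by (auto simp: cosets_of_def)
    then show ?thesis using coset_of_mem[OF L(1) E s(1)] set_plus_mono[OF L(2), of s] by simp
  qed
  show "cosets_of K S = (\<Union>E\<in>cosets_of L S. cosets_of K (S \<inter> E))"
    unfolding cosets_of_def using mem(1) by blast
  show "cosets_of K (S \<inter> E) \<inter> cosets_of K (S \<inter> E') = {}"
    if "E \<in> cosets_of L S" "E' \<in> cosets_of L S" "E \<noteq> E'"
  proof (rule ccontr)
    assume "\<not> ?thesis"
    then obtain C where C: "C \<in> cosets_of K (S \<inter> E)" "C \<in> cosets_of K (S \<inter> E')" by blast
    then obtain s where "s \<in> C" using mem(2) by (auto simp: cosets_of_def)
    then have "s \<in> E" "s \<in> E'" using sub[OF that(1) C(1)] sub[OF that(2) C(2)] by auto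
    then show False using coset_of_mem[OF L(1) that(1)] coset_of_mem[OF L(1) that(2)] that(3) by metis
  qed
qed

text \<open>Each coset of \<open>L\<close> contains at most \<open>k\<close> of the cosets of
  \<open>K\<close> met by \<open>S\<close>, which bounds the contribution of a pair of
  \<open>L\<close>-cosets by \<open>k\<close> times the smaller weight. For two cosets of weight one
  the contribution is 1 instead of \<open>k\<close>; the resulting surplus pays, through
  \<open>singles_slack\<close>, for the correction term modulo \<open>L\<close>.\<close>

lemma min_weight_sum_refine:
  fixes S :: "'a::{ab_group_add,finite} set"
  assumes K: "is_subgroup K" and L: "is_subgroup L" "K \<subseteq> L" and k: "card L = card K * k"
  shows "min_weight_sum (cosets_of K S) (\<lambda>C. card (S \<inter> C)) + (k - 1) * singles L S ^ 2
    \<le> k * min_weight_sum (cosets_of L S) (\<lambda>E. card (S \<inter> E))"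
proof -
  let ?w = "\<lambda>C. card (S \<inter> C)"
  let ?F = "\<lambda>E. cosets_of K (S \<inter> E)"
  let ?LS = "cosets_of L S"
  have pos: "0 < card K" by (rule card_subgroup_pos[OF K])
  have k1: "1 \<le> k" using card_subgroup_pos[OF L(1)] k by (cases k) auto
  note ref = cosets_of_refine[where S = S, OF K L]
  have wE: "(\<Sum>C\<in>?F E. ?w C) = ?w E" if "E \<in> ?LS" for E
  proof -
    have "card ((S \<inter> E) \<inter> C) = ?w C" if "C \<in> ?F E" for C
      using ref(2)[OF \<open>E \<in> ?LS\<close> that] by (intro arg_cong[where f = card]) blast
    then show ?thesis using card_eq_sum_cosets[OF K, of "S \<inter> E"] by simp
  qed
  have t: "card (?F E) \<le> k" "card (?F E) \<le> ?w E" if "E \<in> ?LS" for E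
  proof -
    have "\<Union>(?F E) \<subseteq> E" using ref(2)[OF that] by blast
    then have "(S \<inter> E) + K \<subseteq> E" by (simp add: Union_cosets_of)
    then have "card ((S \<inter> E) + K) \<le> card E" by (intro card_mono) auto
    moreover have "card E = card L" using that by (auto simp: cosets_of_def)
    ultimately have "card K * card (?F E) \<le> card K * k" by (simp add: card_plus_subgroup[OF K] k)
    then show "card (?F E) \<le> k" using pos by simp
    show "card (?F E) \<le> ?w E" unfolding cosets_of_def by (rule card_image_le) simp
  qed
  define s where "s E = (if ?w E = 1 then 1 else 0 :: nat)" for E
  have h: "(\<Sum>C\<in>?F E. \<Sum>C'\<in>?F E'. min (?w C) (?w C')) + (k - 1) * (s E * s E') \<le> k * min (?w E) (?w E')"
    if E: "E \<in> ?LS" "E' \<in> ?LS" for E E'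
  proof -
    have "(\<Sum>C\<in>?F E. \<Sum>C'\<in>?F E'. min (?w C) (?w C')) \<le> (\<Sum>C\<in>?F E. \<Sum>C'\<in>?F E'. ?w C')"
      by (intro sum_mono) simp
    also have "\<dots> = card (?F E) * ?w E'" using wE[OF E(2)] by simp
    finally have 1: "(\<Sum>C\<in>?F E. \<Sum>C'\<in>?F E'. min (?w C) (?w C')) \<le> card (?F E) * ?w E'" .
    have "(\<Sum>C\<in>?F E. \<Sum>C'\<in>?F E'. min (?w C) (?w C')) \<le> (\<Sum>C\<in>?F E. \<Sum>C'\<in>?F E'. ?w C)"
      by (intro sum_mono) simp
    also have "\<dots> = card (?F E') * ?w E" using wE[OF E(1)] by (simp add: sum_distrib_left[symmetric])
    finally have 2: "(\<Sum>C\<in>?F E. \<Sum>C'\<in>?F E'. min (?w C) (?w C')) \<le> card (?F E') * ?w E" .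
    show ?thesis
    proof (cases "?w E = 1 \<and> ?w E' = 1")
      case True
      then have "card (?F E) * ?w E' \<le> 1" using t(2)[OF E(1)] by simp
      then show ?thesis using 1 True k1 by (simp add: s_def)
    next
      case False
      have "card (?F E) * ?w E' \<le> k * ?w E'" "card (?F E') * ?w E \<le> k * ?w E"
        using t(1)[OF E(1)] t(1)[OF E(2)] by (simp_all add: mult_le_mono1)
      then have "(\<Sum>C\<in>?F E. \<Sum>C'\<in>?F E'. min (?w C) (?w C')) \<le> min (k * ?w E) (k * ?w E')"
        using 1 2 by (intro min.boundedI) linarith+
      then have "(\<Sum>C\<in>?F E. \<Sum>C'\<in>?F E'. min (?w C) (?w C')) \<le> k * min (?w E) (?w E')"
        by (simp only: nat_mult_min_right)
      then show ?thesis using False by (auto simp: s_def)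
    qed
  qed
  have split: "(\<Sum>C\<in>cosets_of K S. g C) = (\<Sum>E\<in>?LS. \<Sum>C\<in>?F E. g C)" for g :: "'a set \<Rightarrow> nat"
    unfolding ref(1) using ref(3) by (intro sum.UNION_disjoint) auto
  have "min_weight_sum (cosets_of K S) ?w = (\<Sum>E\<in>?LS. \<Sum>C\<in>?F E. \<Sum>E'\<in>?LS. \<Sum>C'\<in>?F E'. min (?w C) (?w C'))"
    by (simp add: min_weight_sum_def split)
  also have "\<dots> = (\<Sum>E\<in>?LS. \<Sum>E'\<in>?LS. \<Sum>C\<in>?F E. \<Sum>C'\<in>?F E'. min (?w C) (?w C'))"
    by (intro sum.cong refl sum.swap)
  finally have eq: "min_weight_sum (cosets_of K S) ?w
      = (\<Sum>E\<in>?LS. \<Sum>E'\<in>?LS. \<Sum>C\<in>?F E. \<Sum>C'\<in>?F E'. min (?w C) (?w C'))" .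
  have singles: "singles L S = (\<Sum>E\<in>?LS. s E)" by (simp add: s_def singles_def sum.If_cases Int_def)
  have "(k - 1) * singles L S ^ 2 = (\<Sum>E\<in>?LS. \<Sum>E'\<in>?LS. (k - 1) * (s E * s E'))"
    unfolding singles power2_eq_square sum_product unfolding sum_distrib_left ..
  then have "min_weight_sum (cosets_of K S) ?w + (k - 1) * singles L S ^ 2
      = (\<Sum>E\<in>?LS. \<Sum>E'\<in>?LS. (\<Sum>C\<in>?F E. \<Sum>C'\<in>?F E'. min (?w C) (?w C')) + (k - 1) * (s E * s E'))"
    by (simp add: eq sum.distrib)
  also have "\<dots> \<le> (\<Sum>E\<in>?LS. \<Sum>E'\<in>?LS. k * min (?w E) (?w E'))" by (intro sum_mono h)
  also have "\<dots> = k * min_weight_sum ?LS ?w" by (simp add: min_weight_sum_def sum_distrib_left)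
  finally show ?thesis .
qed

text \<open>For \<open>q = s + 4\<close> this is \<open>16 s \<le> (s + 4)^2\<close>, that is
  \<open>0 \<le> (s - 4)^2\<close>, together with \<open>k \<le> 4 (k - 1)\<close>.\<close>

lemma singles_slack:
  fixes k :: int and q :: nat
  assumes "2 \<le> k"
  shows "4 * k * int (q - 4) \<le> (k - 1) * int q ^ 2"
proof (cases "q \<le> 4")
  case False
  define s where "s = int q - 4"
  have s: "0 \<le> s" "int q = s + 4" "int (q - 4) = s" using False by (simp_all add: s_def)
  have "0 \<le> (s - 4) ^ 2" by simp
  then have "16 * s \<le> (s + 4) ^ 2" by (simp add: power2_eq_square algebra_simps)
  then have "(k - 1) * (16 * s) \<le> (k - 1) * (s + 4) ^ 2" using assms by (intro mult_left_mono) auto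
  moreover have "16 * s \<le> 12 * (k * s)" using mult_right_mono[OF assms s(1)] s(1) by linarith
  ultimately show ?thesis unfolding s(2,3) by (simp add: algebra_simps)
qed (use assms in simp)

text \<open>
  Compares \<open>coset_bound\<close> of \<open>S\<close> modulo \<open>K\<close> with those of the part in \<open>L\<close> modulo \<open>K\<close> (subscript \<open>in\<close>, \<open>Pin\<close>
  cosets) and of the \<open>N\<close> elements outside \<open>L\<close> other than \<open>z\<close> and \<open>-z\<close>, modulo \<open>L\<close>. The \<open>\<Theta>\<close>s are values of
  \<open>min_weight_sum\<close> and the \<open>q\<close>s of \<open>singles\<close>; \<open>k = |L| / |K|\<close>, \<open>r |K|\<close> is the number of sums inside \<open>L\<close>, and
  \<open>g\<close> counts the cosets meeting \<open>S\<close> at least as often as \<open>z + K\<close> does.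
\<close>

lemma absorb_arithmetic:
  fixes k r Pin N \<tau> \<Theta> \<Theta>0 \<Theta>in \<Theta>out \<Theta>L nin g P :: int and q qin qout qL :: nat
  assumes kr: "r + 1 \<le> k" and r: "1 + Pin \<le> r" "4 + \<Theta>in + 2 * nin - 4 * int (qin - 4) \<le> 4 * r"
    and \<Theta>: "\<Theta> \<le> \<Theta>0 + 4 * g - 4" "\<Theta>0 \<le> \<Theta>in + 2 * Pin * N + \<Theta>out" "\<Theta>out + (k - 1) * int qL ^ 2 \<le> k * \<Theta>L"
    and N: "0 \<le> N" "2 * \<tau> - int qout \<le> N" "0 \<le> Pin"
    and cases: "g \<le> P - int q \<and> P \<le> Pin + \<tau> \<and> qin + qout \<le> q + 2
      \<or> g \<le> P \<and> P \<le> Pin + \<tau> + 2 \<and> q = qin + qout + 2 \<and> 8 \<le> q"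
  shows "4 + \<Theta> + 2 * (nin + N + 2) - 4 * int (q - 4) \<le> k * (4 + \<Theta>L + 2 * N - 4 * int (qL - 4)) + 4 * r"
proof -
  \<comment> \<open>Since \<open>k \<ge> Pin + 2\<close>, the term \<open>2 k N\<close> on the right
    pays for the cross terms \<open>2 Pin N\<close> and leaves at least \<open>2 N\<close> to spare
    after the linear term.\<close>
  have "2 * N * 1 \<le> 2 * N * (k - 1 - Pin)" using kr r N by (intro mult_left_mono) auto
  moreover have "4 * k * int (qL - 4) \<le> (k - 1) * int qL ^ 2" using kr r N by (intro singles_slack) simp
  ultimately have main: "4 * k + 4 * r - 4 - \<Theta>in - 2 * nin - 4 * g + 2 * N + 4 * int (q - 4)
      \<le> k * (4 + \<Theta>L + 2 * N - 4 * int (qL - 4)) + 4 * r - (4 + \<Theta> + 2 * (nin + N + 2) - 4 * int (q - 4))"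
    using \<Theta> by (simp add: algebra_simps)
  have lower: "8 + 4 * Pin - 4 * int (qin - 4) \<le> 4 * k + 4 * r - 4 - \<Theta>in - 2 * nin"
    using kr r by linarith
  from cases have "0 \<le> 8 + 4 * Pin - 4 * int (qin - 4) - 4 * g + 2 * N + 4 * int (q - 4)"
  proof
    assume "g \<le> P - int q \<and> P \<le> Pin + \<tau> \<and> qin + qout \<le> q + 2"
    then show ?thesis using N by linarith
  next
    assume "g \<le> P \<and> P \<le> Pin + \<tau> + 2 \<and> q = qin + qout + 2 \<and> 8 \<le> q"
    then show ?thesis using N by linarith
  qed
  then show ?thesis using main lower by linarith
qed

section \<open>Assembling the bound after an absorption\<close>

text \<open>The sums inside \<open>L\<close> never leave a coset of \<open>L\<close>. So with one
  sum outside the union \<open>D\<close> of such cosets, a whole translate of them is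
  outside.\<close>

lemma card_extra_translate:
  fixes S :: "'a::{ab_group_add,finite} set"
  assumes L: "is_subgroup L" "K \<subseteq> L" and D: "D + L = D" "D \<subseteq> subset_sums S + K" "D \<noteq> subset_sums S + K"
  obtains u where "u +o (subset_sums (S \<inter> L) + K) \<subseteq> (subset_sums S + K) - D" "u \<in> subset_sums (S - L)"
proof -
  define R where "R = subset_sums (S \<inter> L) + K"
  have "subset_sums S = subset_sums (S \<inter> L) + subset_sums (S - L)"
    using subset_sums_Diff[of "S \<inter> L" S] by (simp add: Diff_Int)
  then have A: "subset_sums S + K = subset_sums (S - L) + R" by (simp add: R_def ac_simps)
  have RL: "R \<subseteq> L"
    using set_plus_mono2[OF subset_sums_subset_subgroup[OF L(1), of "S \<inter> L"] L(2)] L(1) by (simp add: R_def)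
  obtain a where "a \<in> subset_sums S + K" "a \<notin> D" using D(2,3) by blast
  then obtain u r where u: "u \<in> subset_sums (S - L)" "r \<in> R" "u + r \<notin> D" unfolding A by (auto elim: set_plus_elim)
  have "u + r' \<notin> D" if "r' \<in> R" for r'
  proof
    assume "u + r' \<in> D"
    moreover have "r - r' \<in> L" using that u(2) RL is_subgroupD(4)[OF L(1)] by blast
    ultimately have "(u + r') + (r - r') \<in> D" by (rule periodic_plus_mem[OF D(1)])
    then show False using u(3) by simp
  qed
  moreover have "u + r' \<in> subset_sums S + K" if "r' \<in> R" for r' unfolding A using u(1) that by blast
  ultimately have "u +o R \<subseteq> (subset_sums S + K) - D" by (auto simp: elt_set_plus_subset_iff)
  then show ?thesis using that u(1) by (simp add: R_def)
qed

text \<open>\<open>L\<close> is the stabilizer of the absorbed set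
  \<open>D = subset_sums (S - {z, - z}) + P\<close>, in which the elements inside \<open>L\<close>
  leave no trace. If \<open>z \<in> L\<close>, then \<open>z\<close> and \<open>- z\<close> could be
  put back without leaving \<open>D\<close>, and the sums of \<open>S\<close> would be periodic
  under \<open>L\<close>, which is larger than \<open>K\<close>.\<close>

lemma absorb_stabilizer:
  fixes S :: "'a::{ab_group_add,finite} set"
  assumes st: "has_stabilizer (subset_sums S + K) K" and S: "symmetric_set S" and P: "is_subgroup P" "K \<subset> P"
    and z: "z \<in> S" and sub: "subset_sums (S - {z, - z}) + P \<subseteq> subset_sums S + K"
  obtains L where "K \<subset> L" "z \<notin> L"
    and "has_stabilizer (subset_sums (S - {z, - z} - L) + L) L"
    and "subset_sums (S - {z, - z} - L) + L \<subset> subset_sums S + K"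
proof -
  let ?S0 = "S - {z, - z}"
  define D where "D = subset_sums ?S0 + P"
  have D0: "D \<noteq> {}" using set_plus_intro[OF zero_mem_subset_sums is_subgroupD(1)[OF P(1)], of ?S0] by (auto simp: D_def)
  obtain L where L: "has_stabilizer D L" using stabilizer_exists[OF D0] by blast
  note Ls = has_stabilizerD(1)[OF L] and DL = has_stabilizerD(2)[OF L]
  have "D + P = D" using P(1) by (simp add: D_def add.assoc)
  then have PL: "P \<subseteq> L" by (rule periodic_subgroup_subset_stabilizer[OF L])
  then have KL: "K \<subset> L" using P(2) by blast
  have neq: "D \<noteq> subset_sums S + K"
  proof
    assume "D = subset_sums S + K"
    then have "L \<subseteq> K" using periodic_subgroup_subset_stabilizer[OF st, of L] DL by simp
    then show False using KL by blast
  qed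
  have zL: "z \<notin> L"
  proof
    assume zL: "z \<in> L"
    have mz: "- z \<in> L" using zL is_subgroupD(2)[OF Ls] by blast
    have "subset_sums {z, - z} \<subseteq> L" using zL mz by (intro subset_sums_subset_subgroup[OF Ls]) simp
    then have "subset_sums {z, - z} + K \<subseteq> L + L" using KL by (intro set_plus_mono2) auto
    then have "subset_sums ?S0 + (subset_sums {z, - z} + K) \<subseteq> D + L"
      using Ls plus_subgroup_superset[OF P(1), of "subset_sums ?S0"] unfolding D_def
      by (intro set_plus_mono2) auto
    moreover have "subset_sums S + K = subset_sums ?S0 + (subset_sums {z, - z} + K)"
      using subset_sums_Diff[of "{z, - z}" S] z symmetric_set_mem[OF S, of z] by (simp add: ac_simps)
    ultimately have "subset_sums S + K \<subseteq> D" using DL by simp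
    then show False using sub neq by (auto simp: D_def)
  qed
  have "D = subset_sums (?S0 - L) + L"
  proof -
    have "subset_sums (?S0 \<inter> L) + L = L"
    proof -
      have "L + subset_sums (?S0 \<inter> L) = L"
        by (rule subgroup_plus_subset[OF Ls subset_sums_subset_subgroup[OF Ls]]) auto
      then show ?thesis by (simp add: add.commute)
    qed
    moreover have "subset_sums ?S0 = subset_sums (?S0 - L) + subset_sums (?S0 \<inter> L)"
      using subset_sums_Diff[of "?S0 \<inter> L" ?S0] by (simp add: Diff_Int add.commute)
    ultimately have "subset_sums ?S0 + L = subset_sums (?S0 - L) + L" by (simp add: add.assoc)
    moreover have "D = subset_sums ?S0 + L"
    proof -
      have "P + L = L" using subgroup_plus_subset[OF Ls PL is_subgroupD(1)[OF P(1)]] by (simp add: add.commute)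
      then show ?thesis using DL by (simp add: D_def add.assoc)
    qed
    ultimately show ?thesis by simp
  qed
  then show ?thesis using that[OF KL zL] L sub neq by (auto simp: D_def)
qed

lemma cosets_of_Int_subgroup:
  assumes L: "is_subgroup L" "K \<subseteq> L"
  shows "C \<in> cosets_of K (S \<inter> L) \<Longrightarrow> C \<subseteq> L" "C \<in> cosets_of K (S - L) \<Longrightarrow> C \<inter> L = {}"
proof -
  assume "C \<in> cosets_of K (S \<inter> L)"
  then obtain s where s: "s \<in> L" "C = s +o K" by (auto simp: cosets_of_def)
  then show "C \<subseteq> L" using set_plus_mono[OF L(2), of s] subgroup_elt_plus[OF L(1) s(1)] by simp
next
  assume "C \<in> cosets_of K (S - L)"
  then obtain s where s: "s \<notin> L" "C = s +o K" by (auto simp: cosets_of_def)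
  have False if "x \<in> C" "x \<in> L" for x
  proof -
    have "x - s \<in> L" using that(1) s(2) L(2) by (auto simp: mem_elt_set_plus)
    then have "x - (x - s) \<in> L" by (rule is_subgroupD(4)[OF L(1) that(2)])
    then show False using s(1) by simp
  qed
  then show "C \<inter> L = {}" by blast
qed

text \<open>\<open>K\<close> varies in the induction: the part in \<open>L\<close> is treated modulo
  \<open>K\<close>, the part outside modulo \<open>L\<close>. The sums of the latter form
  \<open>D\<close>, and a translate of the sums \<open>R\<close> of the former is disjoint from
  \<open>D\<close>, so the two bounds add up.\<close>

theorem coset_bound_sums:
  fixes S :: "'a::{ab_group_add,finite} set"
  assumes "has_stabilizer (subset_sums S + K) K" "symmetric_set S" "S \<inter> K = {}"
  shows "int (card K) * coset_bound K S \<le> 4 * int (card (subset_sums S + K))"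
  using assms
proof (induction "card S" arbitrary: S K rule: less_induct)
  case less
  note st = less.prems(1) and S = less.prems(2,3)
  note K = has_stabilizerD(1)[OF st]
  show ?case
  proof (cases "spread K S")
    case True
    obtain Y where Y: "is_half S Y" using half_exists_relative[OF st S(2,1)] by blast
    let ?B = "subset_sums Y + K"
    have A: "subset_sums S + K = ?B + uminus ` ?B" by (rule subset_sums_half[OF Y K])
    have "0 \<in> ?B" using set_plus_intro[OF zero_mem_subset_sums is_subgroupD(1)[OF K], of Y] by simp
    moreover have "?B + K = ?B" using K by (simp add: add.assoc)
    ultimately have "2 * card ?B \<le> card (subset_sums S + K) + card K"
      using card_difference_set[of ?B K] st unfolding A by blast
    then show ?thesis using coset_bound_half[OF st S True Y] by (simp add: algebra_simps)
  next
    case False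
    obtain P z where P: "is_subgroup P" "K \<subset> P" and z: "z \<in> S" "z \<notin> P"
      and absorb: "subset_sums (S - {z, - z}) + P \<subseteq> subset_sums S + K"
      and zw: "2 \<le> card (S \<inter> (z +o K)) \<or> 8 \<le> singles K S"
      using not_spread_absorb[OF st S False] by blast
    obtain L where KL: "K \<subset> L" and zL: "z \<notin> L"
      and stD: "has_stabilizer (subset_sums (S - {z, - z} - L) + L) L"
      and DA: "subset_sums (S - {z, - z} - L) + L \<subset> subset_sums S + K"
      using absorb_stabilizer[OF st S(1) P z(1) absorb] by blast
    note L = has_stabilizerD(1)[OF stD]
    have KL': "K \<subseteq> L" using KL by blast
    define S0 where "S0 = S - {z, - z}"
    define S4 where "S4 = S0 - L"
    define Sin where "Sin = S \<inter> L"
    define D where "D = subset_sums S4 + L"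
    define R where "R = subset_sums Sin + K"
    have mz: "- z \<in> S" "- z \<notin> L" using z(1) zL symmetric_set_mem[OF S(1)] is_subgroupD(2)[OF L, of "- z"] by auto
    have S0_eq: "S0 = Sin \<union> S4" "Sin \<inter> S4 = {}" using zL mz by (auto simp: S0_def S4_def Sin_def)
    have zz: "z + z \<notin> K" using double_notin_stabilizer[OF st z(1)] z(1) S(2) by blast
    have zmz: "z \<noteq> - z" using zz is_subgroupD(1)[OF K] by (metis add.right_inverse)
    have cS: "card S = card Sin + card S4 + 2"
    proof -
      have "card S = card S0 + card {z, - z}"
      proof -
        have "{z, - z} \<subseteq> S" using z(1) mz(1) by simp
        then show ?thesis
          using card_Diff_subset[of "{z, - z}" S] card_mono[of S "{z, - z}"] by (simp add: S0_def)
      qed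
      then show ?thesis using S0_eq zmz by (simp add: card_Un_disjoint)
    qed
    have symm: "symmetric_set S4" "symmetric_set Sin"
    proof -
      have "symmetric_set L" by (rule symmetric_setI) (rule is_subgroupD(2)[OF L])
      then show "symmetric_set S4" "symmetric_set Sin"
        unfolding S4_def S0_def Sin_def using S(1) L
        by (auto intro: symmetric_set_Diff symmetric_set_pair symmetric_set_Int_subgroup)
    qed
    have stR: "has_stabilizer R K" unfolding R_def by (rule has_stabilizer_subset[OF st]) (auto simp: Sin_def)
    have stD': "has_stabilizer D L" using stD by (simp add: D_def S4_def S0_def)
    have IH_D: "int (card L) * coset_bound L S4 \<le> 4 * int (card D)"
      unfolding D_def by (rule less.hyps[OF _ _ symm(1)]) (use cS stD' in \<open>auto simp: D_def S4_def\<close>)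
    have IH_R: "int (card K) * coset_bound K Sin \<le> 4 * int (card R)"
      unfolding R_def by (rule less.hyps[OF _ _ symm(2)]) (use cS stR S(2) in \<open>auto simp: R_def Sin_def\<close>)
    have pos: "0 < card K" by (rule card_subgroup_pos[OF K])
    have dvdK: "card K dvd card X" if "X + K = X" for X :: "'a set"
      using card_plus_subgroup[OF K, of X] that by simp
    have LK: "L + K = L" by (rule subgroup_plus_subset[OF L KL' is_subgroupD(1)[OF K]])
    obtain k where k: "card L = card K * k" using dvdK[OF LK] by (rule dvdE)
    obtain r where r: "card R = card K * r" using dvdK[OF has_stabilizerD(2)[OF stR]] by (rule dvdE)
    have rk: "r + 1 \<le> k"
    proof -
      have "R \<subseteq> L"
        using set_plus_mono2[OF subset_sums_subset_subgroup[OF L, of Sin] KL'] L by (simp add: R_def Sin_def)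
      moreover have "R \<noteq> L" using periodic_subgroup_subset_stabilizer[OF stR, of L] L KL by auto
      ultimately have "card R < card L" by (intro psubset_card_mono) auto
      then show ?thesis using k r by simp
    qed
    have r1: "1 + card (cosets_of K Sin) \<le> r"
    proof -
      have "card K + card (Sin + K) \<le> card R"
        unfolding R_def Sin_def by (rule subset_sums_Int_subgroup_bound[OF st S(2)])
      then have "card K * (1 + card (cosets_of K Sin)) \<le> card K * r"
        by (simp add: card_plus_subgroup[OF K] r)
      then show ?thesis using pos by (simp only: mult_le_cancel1)
    qed
    have r4: "coset_bound K Sin \<le> 4 * int r"
    proof -
      have "int (card K) * coset_bound K Sin \<le> int (card K) * (4 * int r)" using IH_R r by simp
      then show ?thesis using pos by simp
    qed
    have DR: "card D + card R \<le> card (subset_sums S + K)"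
    proof -
      have "D + L = D" using L by (simp add: D_def add.assoc)
      moreover have D: "D \<subseteq> subset_sums S + K" "D \<noteq> subset_sums S + K"
        using DA unfolding D_def S4_def S0_def by blast+
      ultimately obtain u where u: "u +o R \<subseteq> (subset_sums S + K) - D"
        unfolding R_def Sin_def by (rule card_extra_translate[OF L KL'])
      have "D \<union> (u +o R) \<subseteq> subset_sums S + K" "D \<inter> (u +o R) = {}" using u D(1) by auto
      then show ?thesis using card_mono[of "subset_sums S + K" "D \<union> (u +o R)"] by (simp add: card_Un_disjoint)
    qed
    let ?w = "\<lambda>C. card (S \<inter> C)" and ?v = "\<lambda>C. card (S0 \<inter> C)"
    let ?C = "cosets_of K S"
    define c where "c = z +o K"
    define d where "d = uminus ` c"
    have mc: "d = (- z) +o K" by (simp add: d_def c_def uminus_coset[OF K])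
    have cc: "c \<in> ?C" "d \<in> ?C" using z(1) mz(1) unfolding mc cosets_of_def by (auto simp: c_def)
    have c_neq: "c \<noteq> d" using uminus_coset_neq[OF st S(2) cc(1)] by (metis d_def)
    have wm: "?w d = ?w c" unfolding d_def by (rule card_Int_uminus_coset[OF S(1)])
    have x0: "0 < ?w c" using card_Int_coset_pos[OF K cc(1)] by simp
    have mem0: "s \<in> s +o K" for s using is_subgroupD(1)[OF K] by (simp add: mem_elt_set_plus)
    have zc: "z \<in> E \<longleftrightarrow> E = c" "- z \<in> E \<longleftrightarrow> E = d" if E: "E \<in> ?C" for E
    proof -
      show "z \<in> E \<longleftrightarrow> E = c" unfolding c_def using coset_of_mem[OF K E, of z] mem0[of z] by metis
      show "- z \<in> E \<longleftrightarrow> E = d" unfolding mc using coset_of_mem[OF K E, of "- z"] mem0[of "- z"] by metis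
    qed
    have w0: "?v E = (if E = c \<or> E = d then ?w E - 1 else ?w E)" if E: "E \<in> ?C" for E
    proof (cases "E = c \<or> E = d")
      case True
      then have "S0 \<inter> E = (S \<inter> E) - {if E = c then z else - z}" "(if E = c then z else - z) \<in> S \<inter> E"
        using zc[OF E] c_neq z(1) mz(1) by (auto simp: S0_def)
      then show ?thesis using True by simp
    next
      case False
      then have "S0 \<inter> E = S \<inter> E" using zc[OF E] by (auto simp: S0_def)
      then show ?thesis using False by simp
    qed
    define G where "G = {E \<in> ?C. ?w c \<le> ?w E}"
    have T1: "int (min_weight_sum ?C ?w) \<le> int (min_weight_sum ?C ?v) + 4 * int (card G) - 4"
      unfolding G_def using cc c_neq wm x0 w0 by (intro min_weight_sum_decrement2) auto
    have sub0: "cosets_of K Sin \<subseteq> ?C" "cosets_of K S4 \<subseteq> ?C" by (auto simp: cosets_of_def Sin_def S4_def S0_def)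
    have disj: "cosets_of K Sin \<inter> cosets_of K S4 = {}"
    proof -
      have False if "E \<in> cosets_of K Sin" "E \<in> cosets_of K S4" for E
      proof -
        have "E \<subseteq> L" "E \<inter> L = {}"
          using that cosets_of_Int_subgroup[OF L KL'] unfolding Sin_def S4_def by blast+
        moreover have "E \<noteq> {}" using that(1) mem0 by (auto simp: cosets_of_def)
        ultimately show False by blast
      qed
      then show ?thesis by blast
    qed
    have win: "card (Sin \<inter> E) = ?v E" if "E \<in> cosets_of K Sin" for E
    proof -
      have "E \<subseteq> L" using that cosets_of_Int_subgroup(1)[OF L KL'] unfolding Sin_def by blast
      then have "Sin \<inter> E = S0 \<inter> E" unfolding S0_eq(1) by (auto simp: S4_def)
      then show ?thesis by simp
    qed
    have w4: "card (S4 \<inter> E) = ?v E" if "E \<in> cosets_of K S4" for E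
    proof -
      have "E \<inter> L = {}" using that cosets_of_Int_subgroup(2)[OF L KL'] unfolding S4_def by blast
      then have "S4 \<inter> E = S0 \<inter> E" unfolding S0_eq(1) by (auto simp: Sin_def)
      then show ?thesis by simp
    qed
    have C0: "cosets_of K S0 = cosets_of K Sin \<union> cosets_of K S4"
      unfolding S0_eq(1) by (auto simp: cosets_of_def)
    have zero: "?v E = 0" if "E \<in> ?C - cosets_of K S0" for E
    proof -
      have "S0 \<inter> E = {}"
      proof (rule ccontr)
        assume "S0 \<inter> E \<noteq> {}"
        then obtain t where t: "t \<in> S0" "t \<in> E" by blast
        then have "E = t +o K" using coset_of_mem[OF K] that by blast
        then show False using t(1) that by (auto simp: cosets_of_def)
      qed
      then show ?thesis by simp
    qed
    have T2: "min_weight_sum ?C ?v \<le> min_weight_sum (cosets_of K Sin) (\<lambda>E. card (Sin \<inter> E))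
        + 2 * card (cosets_of K Sin) * card S4 + min_weight_sum (cosets_of K S4) (\<lambda>E. card (S4 \<inter> E))"
    proof -
      have "min_weight_sum ?C ?v = min_weight_sum (cosets_of K S0) ?v"
        using zero sub0 unfolding C0 by (intro min_weight_sum_supersets[symmetric]) auto
      also have "\<dots> \<le> min_weight_sum (cosets_of K Sin) ?v + 2 * card (cosets_of K Sin) * sum ?v (cosets_of K S4)
          + min_weight_sum (cosets_of K S4) ?v"
        unfolding C0 by (rule min_weight_sum_Un_le) (use disj in auto)
      also have "sum ?v (cosets_of K S4) = card S4"
        unfolding card_eq_sum_cosets[OF K, of S4] using w4 by simp
      also have "min_weight_sum (cosets_of K Sin) ?v = min_weight_sum (cosets_of K Sin) (\<lambda>E. card (Sin \<inter> E))"
        using win by (intro min_weight_sum_cong) simp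
      also have "min_weight_sum (cosets_of K S4) ?v = min_weight_sum (cosets_of K S4) (\<lambda>E. card (S4 \<inter> E))"
        using w4 by (intro min_weight_sum_cong) simp
      finally show ?thesis .
    qed
    have T3: "min_weight_sum (cosets_of K S4) (\<lambda>E. card (S4 \<inter> E)) + (k - 1) * singles L S4 ^ 2
        \<le> k * min_weight_sum (cosets_of L S4) (\<lambda>E. card (S4 \<inter> E))"
      by (rule min_weight_sum_refine[OF K L KL' k])
    have N: "2 * int (card (cosets_of K S4)) - int (singles K S4) \<le> int (card S4)"
    proof -
      have "(\<Sum>E\<in>cosets_of K S4. 2) \<le> (\<Sum>E\<in>cosets_of K S4. card (S4 \<inter> E) + (if card (S4 \<inter> E) = 1 then 1 else 0))"
        using card_Int_coset_pos[OF K, of _ S4] by (intro sum_mono) force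
      also have "\<dots> = card S4 + singles K S4"
        unfolding sum.distrib card_eq_sum_cosets[OF K, of S4, symmetric] by (simp add: singles_def sum.If_cases Int_def)
      finally show ?thesis by simp
    qed
    have s0: "singles K Sin + singles K S4 = card {E \<in> cosets_of K S0. ?v E = 1}"
    proof -
      have "{E \<in> cosets_of K S0. ?v E = 1} = {E \<in> cosets_of K Sin. card (Sin \<inter> E) = 1} \<union> {E \<in> cosets_of K S4. card (S4 \<inter> E) = 1}"
        unfolding C0 using win w4 by auto
      then show ?thesis using disj unfolding singles_def by (subst card_Un_disjoint[symmetric]) auto
    qed
    have P0: "card (cosets_of K S0) = card (cosets_of K Sin) + card (cosets_of K S4)"
      unfolding C0 using disj by (simp add: card_Un_disjoint)
    have C0sub: "cosets_of K S0 \<subseteq> ?C" using sub0 by (simp add: C0)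
    have C_sub: "?C \<subseteq> cosets_of K S0 \<union> {c, d}"
    proof
      fix E assume "E \<in> ?C"
      then obtain t where t: "t \<in> S" "E = t +o K" by (auto simp: cosets_of_def)
      show "E \<in> cosets_of K S0 \<union> {c, d}"
      proof (cases "t = z \<or> t = - z")
        case True
        then show ?thesis using t(2) by (auto simp: c_def mc)
      next
        case False
        then show ?thesis using t by (auto simp: cosets_of_def S0_def)
      qed
    qed
    have cases: "int (card G) \<le> int (card ?C) - int (singles K S) \<and>
          int (card ?C) \<le> int (card (cosets_of K Sin)) + int (card (cosets_of K S4)) \<and>
          singles K Sin + singles K S4 \<le> singles K S + 2
        \<or> int (card G) \<le> int (card ?C) \<and>
          int (card ?C) \<le> int (card (cosets_of K Sin)) + int (card (cosets_of K S4)) + 2 \<and>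
          singles K S = singles K Sin + singles K S4 + 2 \<and> 8 \<le> singles K S"
    proof (cases "2 \<le> ?w c")
      case True
      \<comment> \<open>The class of \<open>z\<close> has another element: no class disappears,
        \<open>G\<close> contains no single class, and at most two classes become single.\<close>
      have "G \<subseteq> ?C - {E \<in> ?C. ?w E = 1}" using True by (auto simp: G_def)
      then have "card G \<le> card (?C - {E \<in> ?C. ?w E = 1})" by (intro card_mono) auto
      also have "\<dots> = card ?C - singles K S" unfolding singles_def by (intro card_Diff_subset) auto
      finally have g: "card G \<le> card ?C - singles K S" .
      have sq: "singles K S \<le> card ?C" unfolding singles_def by (intro card_mono) auto
      have "c \<in> cosets_of K S0" "d \<in> cosets_of K S0"
        using zero[of c] zero[of "d"] w0[OF cc(1)] w0[OF cc(2)] True wm cc by auto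
      then have "?C = cosets_of K S0" using C_sub C0sub by blast
      then have p: "card ?C = card (cosets_of K Sin) + card (cosets_of K S4)" using P0 by simp
      have "{E \<in> cosets_of K S0. ?v E = 1} \<subseteq> {E \<in> ?C. ?w E = 1} \<union> {c, d}"
      proof
        fix E assume E: "E \<in> {E \<in> cosets_of K S0. ?v E = 1}"
        then have EC: "E \<in> ?C" using C0sub by blast
        show "E \<in> {E \<in> ?C. ?w E = 1} \<union> {c, d}"
          using w0[OF EC] E EC by (cases "E = c \<or> E = d") auto
      qed
      then have "card {E \<in> cosets_of K S0. ?v E = 1} \<le> card ({E \<in> ?C. ?w E = 1} \<union> {c, d})"
        by (intro card_mono) auto
      also have "\<dots> \<le> card {E \<in> ?C. ?w E = 1} + card {c, d}" by (rule card_Un_le)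
      also have "\<dots> = singles K S + 2" using c_neq by (simp add: singles_def)
      finally show ?thesis using g sq p s0 by (intro disjI1 conjI) linarith+
    next
      case False
      \<comment> \<open>The class of \<open>z\<close> is single: it disappears together with its
        negative, \<open>G\<close> may contain all classes, and the eight single classes have to
        pay.\<close>
      then have w1: "?w c = 1" using x0 by simp
      have g: "card G \<le> card ?C" unfolding G_def by (intro card_mono) auto
      have "card ?C \<le> card (cosets_of K S0 \<union> {c, d})" by (intro card_mono C_sub) auto
      also have "\<dots> \<le> card (cosets_of K S0) + card {c, d}" by (rule card_Un_le)
      finally have p: "card ?C \<le> card (cosets_of K S0) + 2" using c_neq by simp
      have z0: "?v c = 0" "?v d = 0" using w0[OF cc(1)] w0[OF cc(2)] w1 wm by simp_all
      have notin: "E \<notin> cosets_of K S0" if "?v E = 0" for E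
        using card_Int_coset_pos[OF K, of E S0] that by auto
      have "{E \<in> ?C. ?w E = 1} = insert c (insert d {E \<in> cosets_of K S0. ?v E = 1})"
      proof (rule set_eqI)
        fix E
        show "E \<in> {E \<in> ?C. ?w E = 1} \<longleftrightarrow> E \<in> insert c (insert d {E \<in> cosets_of K S0. ?v E = 1})"
        proof (cases "E = c \<or> E = d")
          case True
          then show ?thesis using cc w1 wm by auto
        next
          case False
          then have "E \<in> ?C \<longleftrightarrow> E \<in> cosets_of K S0" using C_sub C0sub by blast
          moreover have "?v E = ?w E" if "E \<in> ?C" using w0[OF that] False by simp
          ultimately show ?thesis using False by auto
        qed
      qed
      then have "singles K S = card {E \<in> cosets_of K S0. ?v E = 1} + 2"
        unfolding singles_def using c_neq notin[OF z0(1)] notin[OF z0(2)] by (simp add: card_insert_if)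
      moreover have "8 \<le> singles K S" using zw False unfolding c_def by simp
      ultimately show ?thesis using g p P0 s0 by (intro disjI2 conjI) linarith+
    qed
    have "coset_bound K S \<le> int k * coset_bound L S4 + 4 * int r"
    proof -
      have "4 + int (min_weight_sum ?C ?w) + 2 * (int (card Sin) + int (card S4) + 2) - 4 * int (singles K S - 4)
        \<le> int k * (4 + int (min_weight_sum (cosets_of L S4) (\<lambda>E. card (S4 \<inter> E))) + 2 * int (card S4) - 4 * int (singles L S4 - 4)) + 4 * int r"
      proof (rule absorb_arithmetic[OF _ _ _ T1 _ _ _ N _ cases])
        show "int r + 1 \<le> int k" "1 + int (card (cosets_of K Sin)) \<le> int r" using rk r1 by simp_all
        show "4 + int (min_weight_sum (cosets_of K Sin) (\<lambda>E. card (Sin \<inter> E))) + 2 * int (card Sin) - 4 * int (singles K Sin - 4) \<le> 4 * int r"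
          using r4 by (simp add: coset_bound_def)
        show "int (min_weight_sum ?C ?v) \<le> int (min_weight_sum (cosets_of K Sin) (\<lambda>E. card (Sin \<inter> E)))
            + 2 * int (card (cosets_of K Sin)) * int (card S4) + int (min_weight_sum (cosets_of K S4) (\<lambda>E. card (S4 \<inter> E)))"
          using of_nat_le_iff[where 'a = int, THEN iffD2, OF T2] by simp
        show "int (min_weight_sum (cosets_of K S4) (\<lambda>E. card (S4 \<inter> E))) + (int k - 1) * (int (singles L S4))\<^sup>2
            \<le> int k * int (min_weight_sum (cosets_of L S4) (\<lambda>E. card (S4 \<inter> E)))"
        proof -
          have k1: "int (k - 1) = int k - 1" using rk by simp
          show ?thesis
            using of_nat_le_iff[where 'a = int, THEN iffD2, OF T3] unfolding of_nat_add of_nat_mult of_nat_power k1 .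
        qed
      qed auto
      then show ?thesis unfolding coset_bound_def cS by simp
    qed
    then have "int (card K) * coset_bound K S \<le> int (card K) * (int k * coset_bound L S4 + 4 * int r)"
      by (rule mult_left_mono) simp
    also have "\<dots> = int (card L) * coset_bound L S4 + 4 * int (card R)"
      by (simp add: k r algebra_simps)
    also have "\<dots> \<le> 4 * int (card D + card R)" using IH_D by simp
    also have "\<dots> \<le> 4 * int (card (subset_sums S + K))" using DR by simp
    finally show ?thesis .
  qed
qed

section \<open>Groups of odd order\<close>

lemma has_stabilizer_zero:
  fixes A :: "'a::{ab_group_add,finite} set"
  assumes "aperiodic A"
  shows "has_stabilizer (A + {0}) {0}"
proof -
  have "g = 0" if "g +o A \<subseteq> A" for g
  proof -
    have "(\<lambda>x. x + g) ` A = A"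
      using elt_set_plus_eq_if_subset[OF that] by (simp add: elt_set_plus_eq_image add.commute)
    then show ?thesis using assms by (simp add: aperiodic_def)
  qed
  then show ?thesis by (simp add: has_stabilizer_def)
qed

lemma cosets_of_zero: "cosets_of {0} S = (\<lambda>s. {s}) ` S"
  by (auto simp: cosets_of_def elt_set_plus_def)

lemma coset_statistics_zero:
  fixes S :: "'a::{ab_group_add,finite} set"
  shows "card (cosets_of {0} S) = card S" "singles {0} S = card S"
    and "min_weight_sum (cosets_of {0} S) (\<lambda>C. card (S \<inter> C)) = card S ^ 2"
proof -
  show c: "card (cosets_of {0} S) = card S"
    unfolding cosets_of_zero by (rule card_image) simp
  have w: "card (S \<inter> C) = 1" if "C \<in> cosets_of {0} S" for C
    using that by (auto simp: cosets_of_zero)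
  then have "{C \<in> cosets_of {0} S. card (S \<inter> C) = 1} = cosets_of {0} S" by blast
  then show "singles {0} S = card S" using c by (simp add: singles_def)
  show "min_weight_sum (cosets_of {0} S) (\<lambda>C. card (S \<inter> C)) = card S ^ 2"
    using w c by (simp add: min_weight_sum_def power2_eq_square)
qed

lemma coset_bound_zero:
  fixes S :: "'a::{ab_group_add,finite} set"
  shows "coset_bound {0} S = 4 + int (card S) ^ 2 + 2 * int (card S) - 4 * int (card S - 4)"
  by (simp add: coset_bound_def coset_statistics_zero)

lemma odd_card_subgroup:
  fixes L :: "'a::{ab_group_add,finite} set"
  assumes "odd (card (UNIV :: 'a set))" "is_subgroup L"
  shows "odd (card L)" "odd (card (cosets_of L (UNIV :: 'a set)))"
proof -
  have "(UNIV :: 'a set) + L = UNIV" using plus_subgroup_superset[OF assms(2), of UNIV] by blast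
  then have "card (UNIV :: 'a set) = card L * card (cosets_of L (UNIV :: 'a set))"
    using card_plus_subgroup[OF assms(2), of UNIV] by simp
  then show "odd (card L)" "odd (card (cosets_of L (UNIV :: 'a set)))" using assms(1) by auto
qed

text \<open>Otherwise translation by \<open>u\<close> is an involution without fixed points on the
  cosets of \<open>L\<close>, whose number is odd.\<close>

lemma double_mem_subgroup_odd:
  fixes L :: "'a::{ab_group_add,finite} set"
  assumes "odd (card (UNIV :: 'a set))" and L: "is_subgroup L" and u: "u + u \<in> L"
  shows "u \<in> L"
proof (rule ccontr)
  assume neg: "u \<notin> L"
  have "even (card (cosets_of L (UNIV :: 'a set)))"
  proof (rule even_card_involution[where f = "(+o) u"])
    fix C assume "C \<in> cosets_of L (UNIV :: 'a set)"
    then obtain x where x: "C = x +o L" by (auto simp: cosets_of_def)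
    show "u +o C \<in> cosets_of L UNIV" by (auto simp: x set_plus_rearrange2 cosets_of_def)
    have "u +o (u +o C) = (u + u + x) +o L" by (simp add: x set_plus_rearrange2 add.assoc)
    then show "u +o (u +o C) = C" using u by (simp add: x subgroup_coset_eq[OF L])
    show "u +o C \<noteq> C" using neg by (simp add: x set_plus_rearrange2 subgroup_coset_eq[OF L])
  qed simp
  then show False using odd_card_subgroup(2)[OF assms(1) L] by simp
qed

text \<open>Used to sharpen estimates: two odd cardinals that differ do so by at least two.\<close>

lemma odd_card_symmetric:
  fixes A :: "'a::{ab_group_add,finite} set"
  assumes "odd (card (UNIV :: 'a set))" "symmetric_set A" "0 \<in> A"
  shows "odd (card A)"
proof -
  have "- a \<noteq> a" if "a \<noteq> 0" for a :: 'a
  proof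
    assume "- a = a"
    then have "a + a \<in> {0}" by (metis add.right_inverse singletonI)
    then show False using double_mem_subgroup_odd[OF assms(1) is_subgroup_zero] that by blast
  qed
  then have "even (card (A - {0}))"
    using symmetric_set_mem[OF assms(2)] by (intro even_card_involution[where f = uminus]) auto
  moreover have "card A = Suc (card (A - {0}))" using assms(3) by (metis card.remove finite)
  ultimately show ?thesis by simp
qed

lemma symmetric_subset_sums: "symmetric_set S \<Longrightarrow> symmetric_set (subset_sums S)"
  using subset_sums_uminus[of S] by (simp add: symmetric_set_def)

lemma symmetric_set_plus: "symmetric_set A \<Longrightarrow> symmetric_set B \<Longrightarrow> symmetric_set (A + B)"
  for A B :: "'a::ab_group_add set"
  by (simp add: symmetric_set_def uminus_set_plus)

section \<open>Absorption in odd order\<close>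

text \<open>Here \<open>k = |L|\<close>, \<open>r\<close> counts the sums inside \<open>L\<close>,
  and \<open>P\<close> and \<open>N\<close> the elements inside and outside. Compared with
  \<open>absorb_arithmetic\<close>, two translates of the inner sums lie outside \<open>D\<close>,
  hence \<open>8 r\<close>, and parity gives \<open>r + 2 \<le> k\<close>.\<close>

lemma absorb_arithmetic_odd:
  fixes k r P N \<Theta> :: int and q p :: nat
  assumes k: "r + 2 \<le> k" "1 + P \<le> r" "4 + P ^ 2 + 2 * P - 4 * int (p - 4) \<le> 4 * r" and P: "P = int p"
    and \<Theta>: "N ^ 2 + (k - 1) * int q ^ 2 \<le> k * \<Theta>" and N: "0 \<le> N"
  shows "(N + P + 2) ^ 2 + 2 * (N + P + 2) + 4 \<le> k * (4 + \<Theta> + 2 * N - 4 * int (q - 4)) + 8 * r"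
proof -
  have "4 * k * int (q - 4) \<le> (k - 1) * int q ^ 2" using k P by (intro singles_slack) simp
  moreover have "0 \<le> 2 * N * (k - P - 3)" using k N by (intro mult_nonneg_nonneg) auto
  moreover have "P ^ 2 + 6 * P + 12 \<le> 4 * k + 8 * r"
  proof (cases "p \<le> 4")
    case True
    have "0 \<le> P ^ 2" by simp
    then show ?thesis using k True P by simp
  next
    case False
    have "0 \<le> (P - 3) ^ 2" by simp
    then have "0 \<le> P ^ 2 - 6 * P + 9" by (simp add: power2_eq_square algebra_simps)
    then show ?thesis using k False P by simp
  qed
  ultimately show ?thesis using \<Theta> by (simp add: power2_eq_square algebra_simps)
qed

lemma absorb_bound_odd:
  fixes S :: "'a::{ab_group_add,finite} set"
  assumes odd: "odd (card (UNIV :: 'a set))"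
    and st: "has_stabilizer (subset_sums S + {0}) {0}" and S: "symmetric_set S" "0 \<notin> S"
    and P: "is_subgroup P" "P \<noteq> {0}" and z: "z \<in> S" and absorb: "subset_sums (S - {z, - z}) + P \<subseteq> subset_sums S"
  shows "int (card S) ^ 2 + 2 * int (card S) + 4 \<le> 4 * int (card (subset_sums S))"
proof -
  let ?A = "subset_sums S"
  have P0: "{0} \<subset> P" using P is_subgroupD(1)[OF P(1)] by blast
  have absorb': "subset_sums (S - {z, - z}) + P \<subseteq> ?A + {0}" using absorb by simp
  obtain L where L0: "{0} \<subset> L" and zL: "z \<notin> L"
    and stD: "has_stabilizer (subset_sums (S - {z, - z} - L) + L) L"
    and DA: "subset_sums (S - {z, - z} - L) + L \<subset> ?A + {0}"
    using absorb_stabilizer[OF st S(1) P(1) P0 z absorb'] by blast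
  note L = has_stabilizerD(1)[OF stD]
  define S4 where "S4 = S - {z, - z} - L"
  define Sin where "Sin = S \<inter> L"
  define D where "D = subset_sums S4 + L"
  define R where "R = subset_sums Sin"
  have stD': "has_stabilizer D L" using stD by (simp add: D_def S4_def)
  have symL: "symmetric_set L" by (rule symmetric_setI) (rule is_subgroupD(2)[OF L])
  have sym: "symmetric_set S4" "symmetric_set Sin"
    unfolding S4_def Sin_def using S(1) L symL
    by (auto intro: symmetric_set_Diff symmetric_set_pair symmetric_set_Int_subgroup)
  have mz: "- z \<in> S" "- z \<notin> L" using z zL symmetric_set_mem[OF S(1)] is_subgroupD(2)[OF L, of "- z"] by auto
  have zmz: "z \<noteq> - z"
  proof
    assume "z = - z"
    then have "z + z = 0" by (metis add.right_inverse)
    then have "z \<in> L" using double_mem_subgroup_odd[OF odd L, of z] is_subgroupD(1)[OF L] by simp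
    then show False using zL by simp
  qed
  have cS: "card S = card S4 + card Sin + 2"
  proof -
    have "S = (S4 \<union> Sin) \<union> {z, - z}" using z mz by (auto simp: S4_def Sin_def)
    moreover have "S4 \<inter> Sin = {}" "(S4 \<union> Sin) \<inter> {z, - z} = {}" using zL mz by (auto simp: S4_def Sin_def)
    ultimately have "card S = card (S4 \<union> Sin) + card {z, - z}" by (metis card_Un_disjoint finite)
    then show ?thesis using \<open>S4 \<inter> Sin = {}\<close> zmz by (simp add: card_Un_disjoint)
  qed
  have stR: "has_stabilizer (R + {0}) {0}"
    unfolding R_def by (rule has_stabilizer_subset[OF st]) (simp add: Sin_def)
  have RL: "R \<subset> L"
  proof
    show "R \<subseteq> L" unfolding R_def by (rule subset_sums_subset_subgroup[OF L]) (simp add: Sin_def)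
    show "R \<noteq> L"
    proof
      assume "R = L"
      then have "L \<subseteq> {0}" using periodic_subgroup_subset_stabilizer[OF stR, of L] L by simp
      then show False using L0 by blast
    qed
  qed
  have oddR: "odd (card R)"
    unfolding R_def by (rule odd_card_symmetric[OF odd symmetric_subset_sums[OF sym(2)]]) simp
  have rk: "card R + 2 \<le> card L"
    using psubset_card_mono[OF _ RL] oddR odd_card_subgroup(1)[OF odd L] by simp presburger
  have r1: "1 + card Sin \<le> card R"
    using card_subset_sums_ge[of Sin "{0}"] stR S(2) by (auto simp: R_def Sin_def)
  have r4: "coset_bound {0} Sin \<le> 4 * int (card R)"
    using coset_bound_sums[of Sin "{0}"] stR sym(2) S(2) by (auto simp: R_def Sin_def)
  have IH_D: "int (card L) * coset_bound L S4 \<le> 4 * int (card D)"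
    using coset_bound_sums[of S4 L] stD' sym(1) by (auto simp: D_def S4_def)
  have DL: "D + L = D" by (rule has_stabilizerD(2)[OF stD'])
  have D: "D \<subseteq> ?A + {0}" "D \<noteq> ?A + {0}" using DA unfolding D_def S4_def by blast+
  have L0': "{0} \<subseteq> L" using L0 by blast
  obtain u where u: "u +o (subset_sums (S \<inter> L) + {0}) \<subseteq> (?A + {0}) - D"
    by (rule card_extra_translate[OF L L0' DL D])
  then have uR: "u +o R \<subseteq> ?A - D" by (simp add: R_def Sin_def)
  have symA: "symmetric_set ?A" "symmetric_set D" "symmetric_set R"
    unfolding D_def R_def using S(1) sym symL by (auto intro: symmetric_subset_sums symmetric_set_plus)
  have muR: "(- u) +o R \<subseteq> ?A - D"
  proof (unfold elt_set_plus_subset_iff, rule ballI)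
    fix x assume "x \<in> R"
    then have "- x \<in> R" using symmetric_set_mem[OF symA(3)] by simp
    then have "u + - x \<in> ?A - D" using uR by (auto simp: elt_set_plus_subset_iff)
    then have "- (u + - x) \<in> ?A - D"
      by (simp only: Diff_iff symmetric_set_mem[OF symA(1)] symmetric_set_mem[OF symA(2)] simp_thms)
    then show "- u + x \<in> ?A - D" by (simp add: add.commute)
  qed
  have "u \<notin> L"
  proof
    assume "u \<in> L"
    have "0 \<in> D" using set_plus_intro[OF zero_mem_subset_sums is_subgroupD(1)[OF L], of S4] by (simp add: D_def)
    then have "0 + u \<in> D" using periodic_plus_mem[OF DL] \<open>u \<in> L\<close> by blast
    moreover have "0 \<in> R" by (simp add: R_def)
    then have "u + 0 \<in> ?A - D" using uR unfolding elt_set_plus_subset_iff by blast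
    ultimately show False by simp
  qed
  then have "u + u \<notin> L" using double_mem_subgroup_odd[OF odd L] by blast
  then have "(u +o L) \<inter> ((- u) +o L) = {}"
    by (intro subgroup_cosets_disjoint[OF L]) (simp add: subgroup_coset_eq[OF L])
  then have disj: "(u +o R) \<inter> ((- u) +o R) = {}"
    using set_plus_mono[of R L] RL by blast
  have "card (D \<union> ((u +o R) \<union> ((- u) +o R))) \<le> card ?A"
    using uR muR D(1) by (intro card_mono) auto
  moreover have "D \<inter> ((u +o R) \<union> ((- u) +o R)) = {}" using uR muR by blast
  ultimately have DR: "card D + 2 * card R \<le> card ?A" using disj by (simp add: card_Un_disjoint)
  have T3: "card S4 ^ 2 + (card L - 1) * singles L S4 ^ 2
      \<le> card L * min_weight_sum (cosets_of L S4) (\<lambda>E. card (S4 \<inter> E))"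
    using min_weight_sum_refine[OF is_subgroup_zero L L0', of "card L" S4] by (simp add: coset_statistics_zero)
  have l1: "int (card L - 1) = int (card L) - 1" using rk by simp
  have "(int (card S4) + int (card Sin) + 2) ^ 2 + 2 * (int (card S4) + int (card Sin) + 2) + 4
      \<le> int (card L) * (4 + int (min_weight_sum (cosets_of L S4) (\<lambda>E. card (S4 \<inter> E)))
          + 2 * int (card S4) - 4 * int (singles L S4 - 4)) + 8 * int (card R)"
  proof (rule absorb_arithmetic_odd[OF _ _ _ refl])
    show "int (card R) + 2 \<le> int (card L)" "1 + int (card Sin) \<le> int (card R)" using rk r1 by simp_all
    show "4 + (int (card Sin))\<^sup>2 + 2 * int (card Sin) - 4 * int (card Sin - 4) \<le> 4 * int (card R)"
      using r4 by (simp add: coset_bound_zero)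
    show "(int (card S4))\<^sup>2 + (int (card L) - 1) * (int (singles L S4))\<^sup>2
        \<le> int (card L) * int (min_weight_sum (cosets_of L S4) (\<lambda>E. card (S4 \<inter> E)))"
      using of_nat_le_iff[where 'a = int, THEN iffD2, OF T3] unfolding of_nat_add of_nat_mult of_nat_power l1 .
  qed simp
  moreover have "int (card S) = int (card S4) + int (card Sin) + 2" using cS by simp
  ultimately show ?thesis using IH_D DR unfolding coset_bound_def by simp
qed

section \<open>Strongly spread sets and their 2-atoms\<close>

text \<open>The inequality can be strict, unlike that of \<open>spread\<close>: in odd order
  \<open>z \<notin> P\<close> already implies \<open>z + z \<notin> P\<close>, so the non-strict
  density of \<open>dense_subgroup_absorb\<close> leads to an absorption.\<close>

definition strongly_spread :: "'a::ab_group_add set \<Rightarrow> bool"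
  where "strongly_spread S \<longleftrightarrow> (\<forall>T P. T \<subseteq> S \<longrightarrow> symmetric_set T \<longrightarrow> is_subgroup P \<longrightarrow> P \<noteq> {0} \<longrightarrow> \<not> T \<subseteq> P \<longrightarrow>
    card P + card T < card (P + insert 0 T))"

lemma strongly_spread_subset: "strongly_spread S \<Longrightarrow> T \<subseteq> S \<Longrightarrow> strongly_spread T"
  unfolding strongly_spread_def by blast

lemma strongly_spread_imp_spread: "strongly_spread S \<Longrightarrow> spread {0} S" for S :: "'a::ab_group_add set"
  unfolding spread_def
proof (intro allI impI)
  fix T P :: "'a set"
  assume ss: "strongly_spread S" and T: "coset_closed {0} S T" and P: "is_subgroup P" "{0} \<subset> P" "\<not> T \<subseteq> P"
  have "T \<subseteq> S" "symmetric_set T" using T by (auto simp: coset_closed_def)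
  moreover have "P \<noteq> {0}" using P(2) by blast
  ultimately have "card P + card T < card (P + insert 0 T)"
    using ss P(1,3) unfolding strongly_spread_def by blast
  then show "card P + card (T + {0}) \<le> card (P + insert 0 T)" by simp
qed

lemma not_strongly_spread_absorb:
  fixes S :: "'a::{ab_group_add,finite} set"
  assumes odd: "odd (card (UNIV :: 'a set))"
    and st: "has_stabilizer (subset_sums S + {0}) {0}" and S: "symmetric_set S" "0 \<notin> S"
    and ns: "\<not> strongly_spread S"
  obtains P z where "is_subgroup P" "P \<noteq> {0}" "z \<in> S" "subset_sums (S - {z, - z}) + P \<subseteq> subset_sums S"
proof -
  obtain T P where T: "T \<subseteq> S" "symmetric_set T" and P: "is_subgroup P" "P \<noteq> {0}" and TP: "\<not> T \<subseteq> P"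
    and dense: "card (P + insert 0 T) \<le> card P + card T"
    using ns by (auto simp: strongly_spread_def not_less)
  obtain z where z: "z \<in> T" "z \<notin> P" using TP by blast
  have zz: "z + z \<notin> P" using double_mem_subgroup_odd[OF odd P(1)] z(2) by blast
  have sub: "subset_sums (T - {z, - z}) + P \<subseteq> subset_sums T + {0}"
    by (rule dense_subgroup_absorb[OF has_stabilizer_subset[OF st T(1)] T(2) _ P(1) _ z(1) zz])
       (use T(1) S(2) is_subgroupD(1)[OF P(1)] dense in auto)
  have "- z \<in> T" using z(1) symmetric_set_mem[OF T(2)] by simp
  then have "S - {z, - z} - (T - {z, - z}) = S - T" "T - {z, - z} \<subseteq> S - {z, - z}"
    using z(1) T(1) by auto
  then have "subset_sums (S - {z, - z}) + P = (subset_sums (T - {z, - z}) + P) + subset_sums (S - T)"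
    using subset_sums_Diff[of "T - {z, - z}" "S - {z, - z}"] by (simp add: ac_simps)
  also have "\<dots> \<subseteq> (subset_sums T + {0}) + subset_sums (S - T)" by (rule set_plus_mono_left[OF sub])
  also have "\<dots> = subset_sums S" using subset_sums_Diff[OF T(1)] by simp
  finally show ?thesis using that[OF P] z(1) T(1) by blast
qed

text \<open>Two-atoms of a symmetric set: \<open>A\<close> and its reflection \<open>(a + b) - A\<close> share \<open>a\<close> and \<open>b\<close>, hence coincide.\<close>

lemma two_atom_symmetric:
  fixes B :: "'a::{ab_group_add,finite} set"
  assumes H: "is_subgroup H" and B: "B \<subseteq> H" "B \<noteq> {}" "symmetric_set B" and X: "X \<in> fragments 2 H B"
  obtains (subgroup) P where "is_subgroup P" "P \<in> fragments 2 H B" "boundary B P \<le> boundary B X"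
  | (pair) d where "d \<noteq> 0" "d \<in> H" "{0, d} \<in> fragments 2 H B" "boundary B {0, d} \<le> boundary B X"
proof -
  obtain A where A: "A \<in> fragments 2 H B"
    and min: "\<And>X. X \<in> fragments 2 H B \<Longrightarrow> boundary B A \<le> boundary B X"
    and uniq: "\<And>A'. A' \<in> fragments 2 H B \<Longrightarrow> boundary B A' = boundary B A \<Longrightarrow> card A' = card A
          \<Longrightarrow> 2 \<le> card (A \<inter> A') \<Longrightarrow> A' = A"
    by (rule atom_exists[OF H B(1,2) X]) blast
  have AH: "A \<subseteq> H" "2 \<le> card A" using A by (auto simp: fragments_def)
  then obtain a0 where a0: "a0 \<in> A" by fastforce
  have a0H: "- a0 \<in> H" using a0 AH(1) is_subgroupD(2)[OF H] by blast
  define P where "P = (- a0) +o A"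
  have P: "P \<in> fragments 2 H B" "boundary B P = boundary B A"
    unfolding P_def by (rule fragments_translate[OF H a0H A])+
  have P0: "0 \<in> P" using a0 by (simp add: P_def mem_elt_set_plus)
  have le: "boundary B P \<le> boundary B X" using min[OF X] P(2) by simp
  show ?thesis
  proof (cases "card A = 2")
    case True
    then have "card P = 2" by (simp add: P_def)
    then obtain x y where xy: "P = {x, y}" "x \<noteq> y" by (auto simp: card_2_iff)
    then obtain d where d: "P = {0, d}" "d \<noteq> 0" using P0 by auto
    have "d \<in> H" using d(1) P(1) by (auto simp: fragments_def)
    then show ?thesis using pair[of d] d P(1) le by simp
  next
    case False
    have reflect: "(a + b) +o uminus ` A = A" if ab: "a \<in> A" "b \<in> A" "a \<noteq> b" for a b
    proof (rule uniq)
      have "a + b \<in> H" using ab AH(1) is_subgroupD(3)[OF H] by blast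
      moreover have mA: "uminus ` A \<in> fragments 2 H B" "boundary B (uminus ` A) = boundary B A"
      proof -
        have eq: "uminus ` A + B = uminus ` (A + B)"
          using B(3) by (simp add: symmetric_set_def uminus_set_plus)
        have "H - uminus ` (A + B) = uminus ` (H - (A + B))"
          using uminus_subgroup[OF H] by (metis image_set_diff inj_uminus)
        moreover have "uminus ` A \<subseteq> H" using AH(1) uminus_subgroup[OF H] by blast
        ultimately show "uminus ` A \<in> fragments 2 H B" using A by (simp add: fragments_def eq)
        show "boundary B (uminus ` A) = boundary B A" by (simp add: boundary_def eq)
      qed
      ultimately show "(a + b) +o uminus ` A \<in> fragments 2 H B"
        "boundary B ((a + b) +o uminus ` A) = boundary B A"
        using fragments_translate[OF H _ mA(1)] by auto
      have "{a, b} \<subseteq> A \<inter> ((a + b) +o uminus ` A)" using ab by (auto simp: mem_elt_set_plus mem_uminus_image)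
      then have "card {a, b} \<le> card (A \<inter> ((a + b) +o uminus ` A))" by (intro card_mono) auto
      then show "2 \<le> card (A \<inter> ((a + b) +o uminus ` A))" using ab(3) by simp
    qed simp
    have shift: "(a - b) +o A = A" if ab: "a \<in> A" "b \<in> A" "a \<noteq> b" for a b
    proof -
      \<comment> \<open>A third element \<open>c\<close> is available; the reflections exchanging
        \<open>a\<close>, \<open>c\<close> and \<open>b\<close>, \<open>c\<close> compose to the
        translation by \<open>a - b\<close>.\<close>
      have "A - {a, b} \<noteq> {}"
      proof
        assume "A - {a, b} = {}"
        then have "A \<subseteq> {a, b}" by blast
        then have "card A \<le> card {a, b}" by (intro card_mono) auto
        then show False using False AH(2) ab(3) by simp
      qed
      then obtain c where c: "c \<in> A" "c \<noteq> a" "c \<noteq> b" by blast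
      have "A = (a + c) +o uminus ` A" using reflect[OF ab(1) c(1)] c(2) by metis
      also have "\<dots> = (a - b) +o ((b + c) +o uminus ` A)" by (simp add: set_plus_rearrange2)
      also have "(b + c) +o uminus ` A = A" using reflect[OF ab(2) c(1)] c(3) by metis
      finally show ?thesis by simp
    qed
    have "x - y \<in> P" if xy: "x \<in> P" "y \<in> P" for x y
    proof (cases "x = y")
      case False
      have "x + a0 \<in> A" "y + a0 \<in> A" using xy by (auto simp: P_def mem_elt_set_plus)
      then have "((x + a0) - (y + a0)) +o A = A" using False by (intro shift) auto
      then have "((x + a0) - (y + a0)) + a0 \<in> A" using a0 by (metis set_plus_intro2)
      then show ?thesis by (simp add: P_def mem_elt_set_plus)
    qed (use P0 in simp)
    then have "is_subgroup P" using P0 by (simp add: is_subgroup_def)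
    then show ?thesis using subgroup P(1) le by blast
  qed
qed

section \<open>Arithmetic progressions\<close>

primrec nat_multiple :: "nat \<Rightarrow> 'a::ab_group_add \<Rightarrow> 'a"
  where "nat_multiple 0 d = 0"
  | "nat_multiple (Suc i) d = nat_multiple i d + d"

lemma nat_multiple_add: "nat_multiple (i + j) d = nat_multiple i d + nat_multiple j d"
  by (induction j) (auto simp: ac_simps)

lemma nat_multiple_diff: "j \<le> i \<Longrightarrow> nat_multiple (i - j) d = nat_multiple i d - nat_multiple j d"
  using nat_multiple_add[of "i - j" j d] by simp

lemma periodic_group_closure_singleton:
  fixes X :: "'a::{ab_group_add,finite} set"
  assumes "d +o X \<subseteq> X"
  shows "X + group_closure {d} = X"
proof (cases "X = {}")
  case False
  obtain L where L: "has_stabilizer X L" using stabilizer_exists[OF False] by blast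
  have "d \<in> L" using has_stabilizerD(3)[OF L assms] .
  then have sub: "group_closure {d} \<subseteq> L" using has_stabilizerD(1)[OF L] by (intro group_closure_subset) auto
  have "X + group_closure {d} \<subseteq> X + L" using sub by (intro set_plus_mono2) auto
  then show ?thesis using has_stabilizerD(2)[OF L] plus_subgroup_superset[of "group_closure {d}" X] by auto
qed simp

text \<open>Distinctness of multiples: a coincidence makes a short progression invariant.\<close>

lemma inj_on_nat_multiple:
  fixes d :: "'a::{ab_group_add,finite}"
  assumes "t \<le> card (group_closure {d})"
  shows "inj_on (\<lambda>i. nat_multiple i d) {..<t}"
proof -
  have False if ij: "i < j" "j < t" "nat_multiple i d = nat_multiple j d" for i j
  proof -
    define l where "l = j - i"
    have l: "0 < l" "l < t" "nat_multiple l d = 0"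
      using ij by (auto simp: l_def nat_multiple_diff)
    let ?X = "(\<lambda>i. nat_multiple i d) ` {..<l}"
    have "d + nat_multiple a d \<in> ?X" if "a < l" for a
    proof (cases "Suc a = l")
      case True
      then have "d + nat_multiple a d = nat_multiple 0 d" using l(3) by (auto simp: add.commute)
      then show ?thesis using l(1) by blast
    next
      case False
      then have "Suc a < l" using that by simp
      moreover have "d + nat_multiple a d = nat_multiple (Suc a) d" by (simp add: add.commute)
      ultimately show ?thesis by blast
    qed
    then have "d +o ?X \<subseteq> ?X" by (auto simp: elt_set_plus_subset_iff)
    then have "?X + group_closure {d} = ?X" by (rule periodic_group_closure_singleton)
    moreover have "0 \<in> ?X" using l(1) by (intro image_eqI[of _ _ 0]) auto
    ultimately have "group_closure {d} \<subseteq> ?X" using set_zero_plus2[of ?X "group_closure {d}"] by simp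
    then have "card (group_closure {d}) \<le> card ?X" by (intro card_mono) auto
    also have "\<dots> \<le> l" using card_image_le[of "{..<l}" "\<lambda>i. nat_multiple i d"] by simp
    finally show False using l(2) assms by simp
  qed
  then show ?thesis by (auto simp: inj_on_def) (metis linorder_neqE_nat)
qed

text \<open>The signs of the elements only translate the set of sums, which accounts for
  \<open>a\<close>. Injectivity up to \<open>2 n\<close> is needed since \<open>i + j\<close> has to
  be compared with 0 when signs differ.\<close>

lemma subset_sums_progression:
  fixes Y :: "'a::{ab_group_add,finite} set"
  assumes inj: "inj_on (\<lambda>i. nat_multiple i d) {..<2 * n + 1}"
    and Y: "\<And>j. 1 \<le> j \<Longrightarrow> j \<le> n \<Longrightarrow> nat_multiple j d \<in> Y \<or> - nat_multiple j d \<in> Y"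
  shows "\<exists>a. \<forall>i \<le> n * (n + 1) div 2. a + nat_multiple i d \<in> subset_sums Y"
proof -
  define e where "e j = (if nat_multiple j d \<in> Y then nat_multiple j d else - nat_multiple j d)" for j
  have eY: "e j \<in> Y" if "1 \<le> j" "j \<le> n" for j using Y[OF that] by (auto simp: e_def)
  have ee: "e j = nat_multiple j d \<or> e j = - nat_multiple j d" for j by (simp add: e_def)
  have inj_e: "e j \<noteq> e i" if "1 \<le> i" "i < j" "j \<le> n" for i j
  proof
    assume eq: "e j = e i"
    have "nat_multiple j d = nat_multiple i d \<or> nat_multiple (j + i) d = nat_multiple 0 d"
    proof -
      have "nat_multiple j d = nat_multiple i d \<or> nat_multiple j d = - nat_multiple i d"
        using ee[of i] ee[of j] eq by (metis add.inverse_inverse)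
      then show ?thesis by (simp add: nat_multiple_add eq_neg_iff_add_eq_0)
    qed
    moreover have "nat_multiple j d \<noteq> nat_multiple i d" "nat_multiple (j + i) d \<noteq> nat_multiple 0 d"
      using inj_onD[OF inj, of j i] inj_onD[OF inj, of "j + i" 0] that by auto
    ultimately show False by blast
  qed
  have "\<exists>a. \<forall>i \<le> m * (m + 1) div 2. a + nat_multiple i d \<in> subset_sums (e ` {1..m})" if "m \<le> n" for m
    using that
  proof (induction m)
    case (Suc m)
    then obtain a where a: "\<And>i. i \<le> m * (m + 1) div 2 \<Longrightarrow> a + nat_multiple i d \<in> subset_sums (e ` {1..m})" by auto
    have "{1..Suc m} = insert (Suc m) {1..m}" by auto
    moreover have "e (Suc m) \<notin> e ` {1..m}"
    proof
      assume "e (Suc m) \<in> e ` {1..m}"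
      then obtain x where "1 \<le> x" "x < Suc m" "e (Suc m) = e x" by auto
      then show False using inj_e[of x "Suc m"] Suc.prems by simp
    qed
    ultimately have sums: "subset_sums (e ` {1..Suc m}) = subset_sums (e ` {1..m}) \<union> (e (Suc m) +o subset_sums (e ` {1..m}))"
      by (simp add: subset_sums_insert set_plus_zero_two)
    have tri: "Suc m * (Suc m + 1) div 2 = m * (m + 1) div 2 + Suc m"
    proof -
      have "Suc m * (Suc m + 1) = m * (m + 1) + 2 * Suc m" by simp
      then show ?thesis by simp
    qed
    \<comment> \<open>The interval of length \<open>m (m + 1) / 2\<close> and its shift by
      \<open>m + 1\<close> leave no gap.\<close>
    have tm: "m \<le> m * (m + 1) div 2" by (cases m) auto
    define a' where "a' = (if e (Suc m) = nat_multiple (Suc m) d then a else a - nat_multiple (Suc m) d)"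
    have "a' + nat_multiple i d \<in> subset_sums (e ` {1..Suc m})" if i: "i \<le> Suc m * (Suc m + 1) div 2" for i
    proof (cases "e (Suc m) = nat_multiple (Suc m) d")
      case True
      show ?thesis
      proof (cases "i \<le> m * (m + 1) div 2")
        case le: True
        then show ?thesis using a[OF le] True by (simp only: sums a'_def if_True Un_iff simp_thms)
      next
        case False
        then have "Suc m \<le> i" "i - Suc m \<le> m * (m + 1) div 2" using tm i tri by simp_all
        then have "e (Suc m) + (a + nat_multiple (i - Suc m) d) \<in> e (Suc m) +o subset_sums (e ` {1..m})"
          using a by blast
        moreover have "e (Suc m) + (a + nat_multiple (i - Suc m) d) = a + nat_multiple i d"
          unfolding True nat_multiple_diff[OF \<open>Suc m \<le> i\<close>] by (simp add: algebra_simps)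
        ultimately show ?thesis using True by (simp only: sums a'_def if_True Un_iff simp_thms)
      qed
    next
      case False
      then have e: "e (Suc m) = - nat_multiple (Suc m) d" using ee by blast
      have a'_eq: "a' = a - nat_multiple (Suc m) d" using False by (simp add: a'_def)
      show ?thesis
      proof (cases "i \<le> m * (m + 1) div 2")
        case le: True
        have "e (Suc m) + (a + nat_multiple i d) \<in> e (Suc m) +o subset_sums (e ` {1..m})" using a[OF le] by blast
        moreover have "e (Suc m) + (a + nat_multiple i d) = a' + nat_multiple i d"
          unfolding e a'_eq by (simp add: algebra_simps)
        ultimately show ?thesis by (simp only: sums Un_iff simp_thms)
      next
        case False
        then have le: "Suc m \<le> i" "i - Suc m \<le> m * (m + 1) div 2" using tm i tri by simp_all
        have "a + nat_multiple (i - Suc m) d = a' + nat_multiple i d"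
          unfolding a'_eq nat_multiple_diff[OF le(1)] by (simp add: algebra_simps)
        then show ?thesis using a[OF le(2)] by (simp only: sums Un_iff simp_thms)
      qed
    qed
    then show ?case by blast
  qed simp
  then obtain a where "\<forall>i \<le> n * (n + 1) div 2. a + nat_multiple i d \<in> subset_sums (e ` {1..n})" by blast
  moreover have "e ` {1..n} \<subseteq> Y" using eY by auto
  ultimately show ?thesis using subset_sums_mono by blast
qed

text \<open>
  A non-full coset met by \<open>S\<close> contributes to the gain of \<open>d\<close>, and so does its negative. So if the gain is
  at most one, \<open>S\<close> is a union of cosets outside \<open>\<langle>d\<rangle>\<close>.
\<close>

lemma small_gain_subset_cyclic:
  fixes S :: "'a::{ab_group_add,finite} set"
  assumes odd: "odd (card (UNIV :: 'a set))" and S: "symmetric_set S"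
    and ss: "strongly_spread S" and d: "d \<noteq> 0" and gain: "shift_gain (insert 0 S) d \<le> 1"
  shows "S \<subseteq> group_closure {d}"
proof (rule ccontr)
  assume neg: "\<not> ?thesis"
  let ?P = "group_closure {d}" and ?S = "insert 0 S"
  have P: "is_subgroup ?P" and dP: "d \<in> ?P" by (auto intro: group_closure.base)
  have sym: "- x \<in> ?S \<longleftrightarrow> x \<in> ?S" for x using symmetric_set_mem[OF S] by auto
  have closed: "d + s \<in> ?S" if s: "s \<in> ?S" "s \<notin> ?P" for s
  proof (rule ccontr)
    assume ns: "d + s \<notin> ?S"
    let ?X = "?S \<inter> ((- s) +o ?P)"
    have "\<exists>t\<in>?X. d + t \<notin> ?S"
    proof (rule ccontr)
      assume no: "\<not> ?thesis"
      have "d +o ?X \<subseteq> ?X"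
      proof (unfold elt_set_plus_subset_iff, rule ballI)
        fix t assume t: "t \<in> ?X"
        have "t + s \<in> ?P" using t by (simp add: mem_elt_set_plus)
        then have "d + (t + s) \<in> ?P" by (rule is_subgroupD(3)[OF P dP])
        then show "d + t \<in> ?X" using no t by (simp add: mem_elt_set_plus add.assoc)
      qed
      then have per: "?X + ?P = ?X" by (rule periodic_group_closure_singleton)
      have "- s \<in> ?X" using s(1) sym[of s] is_subgroupD(1)[OF P] by (simp add: mem_elt_set_plus)
      then have "- s + - d \<in> ?X" using periodic_plus_mem[OF per] is_subgroupD(2)[OF P dP] by blast
      then have "- (d + s) \<in> ?S" by (simp add: add.commute)
      then show False using ns sym by blast
    qed
    then obtain t where tX: "t \<in> ?X" and t3: "d + t \<notin> ?S" by blast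
    have t: "t \<in> ?S" "t + s \<in> ?P" "d + t \<notin> ?S"
      using IntD1[OF tX] IntD2[OF tX] t3 by (simp_all add: mem_elt_set_plus)
    have "t \<noteq> s" using t(2) s(2) double_mem_subgroup_odd[OF odd P] by blast
    moreover have "{d + s, d + t} \<subseteq> (d +o ?S) - ?S"
      using set_plus_intro2[OF s(1), of d] set_plus_intro2[OF t(1), of d] t(3) ns by simp
    then have "card {d + s, d + t} \<le> shift_gain ?S d" unfolding shift_gain_def by (intro card_mono) auto
    ultimately show False using gain by simp
  qed
  have "d +o (S - ?P) \<subseteq> S - ?P"
  proof (unfold elt_set_plus_subset_iff, rule ballI)
    fix s assume s: "s \<in> S - ?P"
    have "d + s \<notin> ?P"
    proof
      assume "d + s \<in> ?P"
      then have "(d + s) - d \<in> ?P" by (rule is_subgroupD(4)[OF P _ dP])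
      then show False using s by simp
    qed
    moreover have "d + s \<in> ?S" using closed s by blast
    ultimately show "d + s \<in> S - ?P" using is_subgroupD(1)[OF P] by auto
  qed
  then have "(S - ?P) + ?P = S - ?P" by (rule periodic_group_closure_singleton)
  then have "card (?P + ?S) = card ?P + card (S - ?P)" using card_subgroup_plus_insert[OF P, of S] by simp
  also have "\<dots> \<le> card ?P + card S" by (simp add: card_mono)
  also have "\<dots> < card (?P + ?S)"
    using ss S P neg d dP unfolding strongly_spread_def by blast
  finally show False by simp
qed

text \<open>The set \<open>insert 0 S\<close> is too small to contain a coset of the group generated
  by \<open>d\<close>. Hence exactly one element \<open>e\<close> leaves it under addition of
  \<open>d\<close>, and by symmetry only \<open>- e\<close> under subtraction. Descending from
  \<open>e\<close> in steps of \<open>d\<close> one stays inside until \<open>- e\<close>, and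
  whatever is not reached would be invariant under \<open>d\<close>. So the set is a progression of
  \<open>2 n + 1\<close> terms from \<open>e\<close> to \<open>- e\<close>; then
  \<open>e - n d\<close> has double 0, and \<open>e = n d\<close> by odd order.\<close>

lemma small_gain_progression:
  fixes S :: "'a::{ab_group_add,finite} set"
  assumes odd: "odd (card (UNIV :: 'a set))" and S: "symmetric_set S"
    and n: "card (insert 0 S) = 2 * n + 1" and P: "2 * n + 1 < card (group_closure {d})"
    and gain: "shift_gain (insert 0 S) d \<le> 1" and j: "1 \<le> j" "j \<le> n"
  shows "nat_multiple j d \<in> S"
proof -
  let ?P = "group_closure {d}" and ?S = "insert 0 S"
  have sym: "- x \<in> ?S \<longleftrightarrow> x \<in> ?S" for x using symmetric_set_mem[OF S] by auto
  have no_period: "X = {}" if X: "d +o X \<subseteq> X" "X \<subseteq> ?S" for X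
  proof (rule ccontr)
    assume "X \<noteq> {}"
    then have "card ?P \<le> card (?P + X)" by (rule card_set_plus_ge)
    also have "?P + X = X" using periodic_group_closure_singleton[OF X(1)] by (simp add: add.commute)
    also have "card X \<le> card ?S" using X(2) by (intro card_mono) auto
    finally show False using n P by simp
  qed
  have "\<not> d +o ?S \<subseteq> ?S" using no_period[of ?S] by blast
  then obtain e where e: "e \<in> ?S" "d + e \<notin> ?S" unfolding elt_set_plus_subset_iff by blast
  have right: "d + x \<in> ?S" if "x \<in> ?S" "x \<noteq> e" for x
  proof (rule ccontr)
    assume "d + x \<notin> ?S"
    then have "{d + x, d + e} \<subseteq> (d +o ?S) - ?S"
      using set_plus_intro2[OF that(1), of d] set_plus_intro2[OF e(1), of d] e(2) by simp
    then have "card {d + x, d + e} \<le> shift_gain ?S d" unfolding shift_gain_def by (intro card_mono) auto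
    then show False using gain that(2) by simp
  qed
  have left: "x - d \<in> ?S" if x: "x \<in> ?S" "x \<noteq> - e" for x
  proof -
    have "- x \<in> ?S" "- x \<noteq> e" using x sym[of x] by auto
    then have "d + - x \<in> ?S" by (rule right)
    then have "- (d + - x) \<in> ?S" using sym by blast
    then show ?thesis by simp
  qed
  define f where "f i = e - nat_multiple i d" for i
  have f_Suc: "f (Suc i) = f i - d" for i by (simp add: f_def algebra_simps)
  have f0: "f 0 = e" by (simp add: f_def)
  have up: "f i \<in> ?S" if "\<And>l. l < i \<Longrightarrow> f l \<noteq> - e" for i
    using that
  proof (induction i)
    case 0
    show ?case using e(1) by (simp only: f0)
  next
    case (Suc i)
    then have "f i \<in> ?S" "f i \<noteq> - e" by auto
    then show ?case unfolding f_Suc by (rule left)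
  qed
  have "\<exists>i. f i = - e"
  proof (rule ccontr)
    assume no: "\<nexists>i. f i = - e"
    then have sub: "range f \<subseteq> ?S" using up by blast
    have "(- d) +o range f \<subseteq> range f"
    proof (unfold elt_set_plus_subset_iff, rule ballI)
      fix x assume "x \<in> range f"
      then obtain i where "x = f i" by blast
      then have "- d + x = f (Suc i)" by (simp add: f_Suc)
      then show "- d + x \<in> range f" by simp
    qed
    then have eq: "(- d) +o range f = range f" by (rule elt_set_plus_eq_if_subset)
    have "d +o range f = d +o ((- d) +o range f)" by (simp only: eq)
    then have "d +o range f = range f" by (simp add: set_plus_rearrange2)
    then have "range f = {}" using sub by (intro no_period) auto
    then show False by simp
  qed
  then obtain l where l: "f l = - e" "\<And>i. i < l \<Longrightarrow> f i \<noteq> - e"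
    using exists_least_iff[of "\<lambda>i. f i = - e"] by blast
  have sub: "f ` {..l} \<subseteq> ?S"
  proof (rule image_subsetI)
    fix i assume "i \<in> {..l}"
    then have "f i' \<noteq> - e" if "i' < i" for i' using l(2)[of i'] that by simp
    then show "f i \<in> ?S" by (rule up)
  qed
  have "?S - f ` {..l} = {}"
  proof (rule no_period)
    show "d +o (?S - f ` {..l}) \<subseteq> ?S - f ` {..l}"
    proof (unfold elt_set_plus_subset_iff, rule ballI)
      fix x assume x: "x \<in> ?S - f ` {..l}"
      have "e \<in> f ` {..l}" by (rule image_eqI[of _ _ 0]) (simp_all add: f0)
      then have "d + x \<in> ?S" using x by (intro right) auto
      moreover have "d + x \<notin> f ` {..l}"
      proof
        assume "d + x \<in> f ` {..l}"
        then obtain i where i: "i \<le> l" "d + x = f i" by auto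
        have x_eq: "x = f (Suc i)" unfolding f_Suc i(2)[symmetric] by simp
        show False
        proof (cases "i = l")
          case True
          then have "x = - (d + e)" using x_eq l(1) by (simp add: f_Suc)
          then show False using x e(2) sym by blast
        next
          case False
          then have "Suc i \<in> {..l}" using i(1) by simp
          then show False using x x_eq by blast
        qed
      qed
      ultimately show "d + x \<in> ?S - f ` {..l}" by blast
    qed
  qed blast
  then have S_eq: "?S = f ` {..l}" using sub by blast
  have neq: "f a \<noteq> f b" if "a < b" "b \<le> l" for a b
  proof
    assume "f a = f b"
    then have "nat_multiple (b - a) d = 0" using that(1) by (simp add: f_def nat_multiple_diff)
    moreover have "b - a \<le> l" using that by simp
    ultimately have "f (l - (b - a)) = - e" using l(1) by (simp add: f_def nat_multiple_diff)
    moreover have "l - (b - a) < l" using that by simp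
    ultimately show False using l(2) by blast
  qed
  then have inj: "inj_on f {..l}" by (intro linorder_inj_onI) auto
  then have "l = 2 * n" using n S_eq card_image[OF inj] by simp
  then have "e - (nat_multiple n d + nat_multiple n d) = - e"
    using l(1) by (simp add: f_def mult_2 nat_multiple_add)
  then have "(e - nat_multiple n d) + (e - nat_multiple n d) = 0" by (simp add: algebra_simps)
  then have "e - nat_multiple n d \<in> {0}"
    using double_mem_subgroup_odd[OF odd is_subgroup_zero, of "e - nat_multiple n d"] by simp
  then have e_eq: "e = nat_multiple n d" by simp
  have fj: "f (n - j) = nat_multiple j d" using j by (simp add: f_def e_eq nat_multiple_diff)
  have "n - j \<in> {..l}" using \<open>l = 2 * n\<close> by simp
  then have "nat_multiple j d \<in> ?S" unfolding S_eq fj[symmetric] by (rule imageI)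
  moreover have "nat_multiple j d \<noteq> 0"
  proof -
    have "f (n - j) \<noteq> f n" using j \<open>l = 2 * n\<close> by (intro neq) auto
    moreover have "f n = 0" by (simp add: f_def e_eq)
    ultimately show ?thesis unfolding fj by simp
  qed
  ultimately show ?thesis by simp
qed

section \<open>The refined growth against Olson's inequality\<close>

text \<open>Twice the sum of \<open>c j - 1\<close>; the 4 corrects the term for
  \<open>j = 0\<close> from \<open>- 1\<close> to 1.\<close>

lemma sum_ball_lower:
  fixes t :: "nat \<Rightarrow> nat"
  assumes "1 \<le> k" "1 \<le> t 0" "\<And>j. 1 \<le> j \<Longrightarrow> j < k \<Longrightarrow> c * j \<le> t j + 1"
  shows "int c * int k * (int k - 1) - 2 * int k + 4 \<le> 2 * int (\<Sum>j<k. t j)"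
  using assms(1,3)
proof (induction k rule: nat_induct_at_least)
  case base
  then show ?case using assms(2) by simp
next
  case (Suc k)
  have "c * k \<le> t k + 1" using Suc.prems Suc.hyps by simp
  then have "int c * int k \<le> int (t k) + 1" by (simp flip: of_nat_mult)
  moreover have "int c * int k * (int k - 1) - 2 * int k + 4 \<le> 2 * int (\<Sum>j<k. t j)"
    using Suc.IH Suc.prems by simp
  ultimately show ?case by (simp add: algebra_simps)
qed

text \<open>The higher powers of \<open>h\<close> cancel: the lower bounds for \<open>t\<close> and
  \<open>s\<close> make the left side exceed the right by at least \<open>4 h - 2\<close>.\<close>

lemma even_final_arithmetic:
  fixes h s t :: int
  assumes "1 \<le> h" "(4 * h + 2) * h - 1 \<le> t" "(4 * h + 2) * h * (h - 1) - 2 * h + 4 \<le> 2 * s"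
    and "2 * h * t + (2 * h - 1) * s \<le> (h * (2 * h + 1)) ^ 2"
  shows False
proof -
  have "2 * h * ((4 * h + 2) * h - 1) \<le> 2 * h * t" using assms(1,2) by (intro mult_left_mono) auto
  moreover have "(2 * h - 1) * ((4 * h + 2) * h * (h - 1) - 2 * h + 4) \<le> (2 * h - 1) * (2 * s)"
    using assms(1,3) by (intro mult_left_mono) auto
  ultimately show False using assms(1,4) by (simp add: algebra_simps power2_eq_square)
qed

text \<open>As in the even case only a linear excess remains, here \<open>3 h - 4\<close>.\<close>

lemma odd_final_arithmetic:
  fixes h s t :: int
  assumes "2 \<le> h" "8 * h * h - 2 * h - 6 \<le> 2 * t" "4 * h * h * (h - 1) - 2 * h + 4 \<le> 2 * s"
    and "h * t + (2 * h - 2) * s \<le> (h * (2 * h - 1)) ^ 2"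
  shows False
proof -
  have "h * (8 * h * h - 2 * h - 6) \<le> h * (2 * t)" using assms(1,2) by (intro mult_left_mono) auto
  moreover have "(2 * h - 2) * (4 * h * h * (h - 1) - 2 * h + 4) \<le> (2 * h - 2) * (2 * s)"
    using assms(1,3) by (intro mult_left_mono) auto
  ultimately show False using assms(1,4) by (simp add: algebra_simps power2_eq_square)
qed

text \<open>
  Without the two exceptional kinds of 2-atoms the balls grow by \<open>2n + 2\<close> instead of \<open>2n\<close> (their sizes being odd),
  which excludes the last remaining value of the number of subset sums.
\<close>

lemma extremal_value_impossible:
  fixes S :: "'a::{ab_group_add,finite} set"
  assumes odd: "odd (card (UNIV :: 'a set))"
    and st: "has_stabilizer (subset_sums S + {0}) {0}" and S: "symmetric_set S" "0 \<notin> S"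
    and ss: "strongly_spread S" and Y: "is_half S Y" and n: "card Y = n" "3 \<le> n"
    and b: "2 * card (subset_sums Y) = n * (n + 1)"
    and gain: "\<And>s. s \<in> S \<Longrightarrow> shift_gain (subset_sums Y) s \<le> n - 1"
    and big: "even n \<or> 2 * n ^ 2 + 3 * n \<le> 2 * card (group_closure S) + 5"
  shows False
proof -
  define H where "H = group_closure S"
  let ?S = "insert 0 S" and ?B = "subset_sums Y"
  have H: "is_subgroup H" and SH: "?S \<subseteq> H" using subset_group_closure[of S] by (auto simp: H_def)
  have cS: "card S = 2 * n" "card ?S = 2 * n + 1" using is_halfD(3)[OF Y] n S(2) by simp_all
  have "S \<noteq> {}" using cS n by auto
  then have "2 * card ?B \<le> card H"
    using card_half_sums_le[OF st _ _ Y] S(2) by (simp add: H_def)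
  then have bH: "n * (n + 1) \<le> card H" using b by simp
  have symS: "symmetric_set ?S" by (rule symmetric_setI) (use symmetric_set_mem[OF S(1)] in auto)
  have wide: "2 * n + 1 \<le> boundary ?S X" if X: "X \<in> fragments 2 H ?S" for X
  proof (rule ccontr)
    assume "\<not> ?thesis"
    then have bX: "boundary ?S X \<le> 2 * n" by simp
    have ne: "?S \<noteq> {}" by simp
    show False
    proof (cases rule: two_atom_symmetric[OF H SH ne symS X, case_names subgroup pair])
      case (subgroup P)
      have "card (P + ?S) \<le> card P + card S"
        using card_set_plus_boundary[of ?S P] subgroup(3) bX cS by simp
      moreover have "P \<noteq> {0}" using subgroup(2) by (auto simp: fragments_def)
      ultimately have "S \<subseteq> P" using ss S(1) subgroup(1) unfolding strongly_spread_def by (meson linorder_not_le order_refl)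
      then have "H \<subseteq> P" unfolding H_def by (rule group_closure_subset[OF subgroup(1)])
      moreover have "P \<subseteq> P + ?S" by (rule set_plus_superset) simp
      ultimately have "H - (P + ?S) = {}" by blast
      then have "card (H - (P + ?S)) = 0" by (simp only: card.empty)
      moreover have "2 \<le> card (H - (P + ?S))" using subgroup(2) unfolding fragments_def by blast
      ultimately show False by linarith
    next
      case (pair d)
      have "card ({0, d} + ?S) \<le> 2 * n + 2"
        using card_set_plus_boundary[of ?S "{0, d}"] pair(1,4) bX by simp
      then have small: "shift_gain ?S d \<le> 1"
        using card_plus_zero_two[of ?S d] cS(2) by (simp add: add.commute)
      have "S \<subseteq> group_closure {d}" by (rule small_gain_subset_cyclic[OF odd S(1) ss pair(1) small])
      then have "H \<subseteq> group_closure {d}" unfolding H_def by (intro group_closure_subset) auto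
      then have cP: "n * (n + 1) \<le> card (group_closure {d})"
        using bH card_mono[of "group_closure {d}" H] by simp
      have "n * 4 \<le> n * (n + 1)" using n(2) by (intro mult_le_mono2) simp
      then have cP': "2 * n + 1 < card (group_closure {d})" using cP n(2) by linarith
      have "\<exists>a. \<forall>i \<le> n * (n + 1) div 2. a + nat_multiple i d \<in> ?B"
      proof (rule subset_sums_progression)
        show "inj_on (\<lambda>i. nat_multiple i d) {..<2 * n + 1}" using cP' by (intro inj_on_nat_multiple) simp
        show "nat_multiple j d \<in> Y \<or> - nat_multiple j d \<in> Y" if "1 \<le> j" "j \<le> n" for j
          using small_gain_progression[OF odd S(1) cS(2) cP' small that] is_halfD(2)[OF Y]
          by (auto simp: mem_uminus_image)
      qed
      then obtain a where a: "\<And>i. i \<le> n * (n + 1) div 2 \<Longrightarrow> a + nat_multiple i d \<in> ?B" by blast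
      \<comment> \<open>One more than \<open>card ?B\<close>.\<close>
      let ?t = "n * (n + 1) div 2 + 1"
      have "inj_on (\<lambda>i. nat_multiple i d) {..<?t}" using cP n(2) by (intro inj_on_nat_multiple) simp
      then have "inj_on (\<lambda>i. a + nat_multiple i d) {..<?t}" by (simp add: inj_on_def)
      then have "card ((\<lambda>i. a + nat_multiple i d) ` {..<?t}) = ?t" by (simp add: card_image)
      moreover have "card ((\<lambda>i. a + nat_multiple i d) ` {..<?t}) \<le> card ?B" using a by (intro card_mono) auto
      ultimately show False using b by simp
    qed
  qed
  define T where "T = ball {0} S"
  have T_sub: "T j \<subseteq> H" for j using ball_properties(1)[OF is_subgroup_zero, of S j] by (simp add: T_def H_def)
  have T_sym: "symmetric_set (T j)" for j
    unfolding T_def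
  proof (induction j)
    case 0
    show ?case by (rule symmetric_setI) simp
  qed (use symS in \<open>simp add: symmetric_set_plus\<close>)
  have T_odd: "odd (card (T j))" for j
    by (rule odd_card_symmetric[OF odd T_sym]) (simp add: T_def zero_mem_ball)
  have T_Suc: "T (Suc j) = T j + ?S" for j by (simp add: T_def)
  have T1: "T 1 = ?S" by (simp add: T_def)
  have growth: "min (card H) ((2 * n + 2) * j - 1) \<le> card (T j)" if "1 \<le> j" for j
    using that
  proof (induction j rule: nat_induct_at_least)
    case base
    show ?case using cS(2) T1 by simp
  next
    case (Suc j)
    have le: "card (T (Suc j)) \<le> card H" using T_sub by (intro card_mono) auto
    have cd: "card (H - T (Suc j)) = card H - card (T (Suc j))" using T_sub by (intro card_Diff_subset) auto
    show ?case
    proof (cases "2 \<le> card (H - T (Suc j))")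
      case True
      have "card (T 1) \<le> card (T j)" unfolding T_def using Suc.hyps by (intro card_mono ball_mono) auto
      then have "2 \<le> card (T j)" using T1 cS(2) n(2) by simp
      then have "T j \<in> fragments 2 H ?S" using T_sub True by (simp add: fragments_def T_Suc)
      then have "2 * n + 1 + card (T j) \<le> card (T (Suc j))"
        using wide[of "T j"] card_set_plus_boundary[of ?S "T j"] by (simp add: T_Suc)
      then have "2 * n + 2 + card (T j) \<le> card (T (Suc j))" using T_odd[of j] T_odd[of "Suc j"] by presburger
      moreover have "card (T j) \<le> card (T (Suc j))"
        unfolding T_def by (intro card_mono ball_mono) auto
      moreover have "(2 * n + 2) * Suc j = (2 * n + 2) * j + (2 * n + 2)" by simp
      ultimately show ?thesis using Suc.IH by arith
    next
      \<comment> \<open>At most one element of \<open>H\<close> is missing; as both cardinals are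
        odd, none is.\<close>
      case False
      then have "card H \<le> card (T (Suc j)) + 1" using cd by simp
      then have "card H = card (T (Suc j))"
        using le odd_card_subgroup(1)[OF odd H] T_odd[of "Suc j"] by presburger
      then show ?thesis by simp
    qed
  qed
  have growth_small: "(2 * n + 2) * j \<le> card (T j) + 1" if "1 \<le> j" "(2 * n + 2) * j \<le> card H + 1" for j
    using growth[OF that(1)] that by simp
  have olson: "(card ?B - k * (n - 1)) * card (T k) + (n - 1) * (\<Sum>j<k. card (T j)) \<le> card ?B ^ 2"
    if "k * (n - 1) \<le> card ?B" for k
  proof (rule olson_inequality[OF _ _ that])
    show "T j \<subseteq> T k" if "j < k" for j using that by (simp add: T_def ball_mono)
    show "shift_gain ?B x \<le> j * (n - 1)" if "x \<in> T j" for j x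
      using shift_gain_ball[OF is_subgroup_zero _ gain] that by (simp add: T_def)
  qed
  have t0: "1 \<le> card (T 0)" by (simp add: T_def)
  show False
  proof (cases "even n")
    case True
    \<comment> \<open>The choice \<open>k = h\<close> gives
      \<open>(2 n + 2) h = n (n + 1) = 2 |B|\<close>, which \<open>H\<close> can
      accommodate.\<close>
    then obtain h where h: "n = 2 * h" by (rule evenE)
    have h1: "1 \<le> h" using h n(2) by simp
    have b': "card ?B = h * (2 * h + 1)" using b by (simp add: h algebra_simps)
    have bH': "(2 * n + 2) * h \<le> card H + 1" using bH by (simp add: h algebra_simps)
    have low: "(2 * n + 2) * j \<le> card (T j) + 1" if "1 \<le> j" "j \<le> h" for j
    proof (rule growth_small[OF that(1)])
      have "(2 * n + 2) * j \<le> (2 * n + 2) * h" using that(2) by (rule mult_le_mono2)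
      then show "(2 * n + 2) * j \<le> card H + 1" using bH' by linarith
    qed
    have sum: "int (2 * n + 2) * int h * (int h - 1) - 2 * int h + 4 \<le> 2 * int (\<Sum>j<h. card (T j))"

      by (rule sum_ball_lower[where t = "\<lambda>j. card (T j)", OF h1 t0 low]) simp_all
    have bk: "h * (n - 1) \<le> card ?B" "card ?B - h * (n - 1) = 2 * h"
      unfolding b' using h1 by (simp_all add: h algebra_simps diff_mult_distrib2)
    show False
    proof (rule even_final_arithmetic)
      show "1 \<le> int h" using h1 by simp
      have "int ((2 * n + 2) * h) \<le> int (card (T h) + 1)" using low[OF h1] by (simp only: of_nat_le_iff)
      then show "(4 * int h + 2) * int h - 1 \<le> int (card (T h))" by (simp add: h algebra_simps)
      show "(4 * int h + 2) * int h * (int h - 1) - 2 * int h + 4 \<le> 2 * int (\<Sum>j<h. card (T j))"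
        using sum by (simp add: h algebra_simps)
      have "int (n - 1) = 2 * int h - 1" using h1 by (simp add: h)
      then show "2 * int h * int (card (T h)) + (2 * int h - 1) * int (\<Sum>j<h. card (T j)) \<le> (int h * (2 * int h + 1))\<^sup>2"
        using of_nat_le_iff[where 'a = int, THEN iffD2, OF olson[OF bk(1)]] unfolding bk(2)
        unfolding b' of_nat_add of_nat_mult of_nat_power by simp
    qed
  next
    case False
    then obtain h' where "n = 2 * h' + 1" by (rule oddE)
    then have "n = 2 * Suc h' - 1" "2 \<le> Suc h'" using n(2) by simp_all
    then obtain h where h: "n = 2 * h - 1" "2 \<le> h" by blast
    have ni: "int n = 2 * int h - 1" using h by simp
    have "2 * int (card ?B) = int n * (int n + 1)"
      using arg_cong[OF b, of int] by (simp add: algebra_simps)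
    then have bi: "int (card ?B) = int h * (2 * int h - 1)" unfolding ni by (simp add: algebra_simps)
    have bHi: "(2 * int h - 1) * (2 * int h) \<le> int (card H)"
    proof -
      have "int (n * (n + 1)) \<le> int (card H)" using bH by (simp only: of_nat_le_iff)
      then show ?thesis by (simp add: ni algebra_simps)
    qed
    have h1: "1 \<le> h" using h(2) by simp
    \<comment> \<open>Only for \<open>j < h\<close>, since the \<open>h\<close>-th ball may already
      be cut off by \<open>H\<close>.\<close>
    have low: "(2 * n + 2) * j \<le> card (T j) + 1" if "1 \<le> j" "j < h" for j
    proof (rule growth_small[OF that(1)])
      have "int ((2 * n + 2) * j) = 4 * int h * int j" by (simp add: ni algebra_simps)
      also have "\<dots> \<le> 4 * int h * (int h - 1)" using that(2) by (intro mult_left_mono) auto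
      also have "\<dots> \<le> int (card H + 1)" using bHi by (simp add: algebra_simps)
      finally show "(2 * n + 2) * j \<le> card H + 1" by (simp only: of_nat_le_iff)
    qed
    have sum: "int (2 * n + 2) * int h * (int h - 1) - 2 * int h + 4 \<le> 2 * int (\<Sum>j<h. card (T j))"

      by (rule sum_ball_lower[where t = "\<lambda>j. card (T j)", OF h1 t0 low])
    have n1: "int (n - 1) = 2 * int h - 2" using h by simp
    have "int (h * (n - 1)) \<le> int (card ?B)" unfolding of_nat_mult n1 bi using h1 by (intro mult_left_mono) auto
    then have bk: "h * (n - 1) \<le> card ?B" by (simp only: of_nat_le_iff)
    have bki: "int (card ?B - h * (n - 1)) = int h"
      unfolding of_nat_diff[OF bk] of_nat_mult n1 bi by (simp add: algebra_simps)
    \<comment> \<open>The left side is \<open>2 n^2 + 3 n - 5\<close> for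
      \<open>n = 2 h - 1\<close>. If the ball is all of \<open>H\<close>, this is the condition in
      \<open>xi\<close>.\<close>
    have tk: "8 * int h * int h - 2 * int h - 6 \<le> 2 * int (card (T h))"
    proof -
      have g: "card H \<le> card (T h) \<or> (2 * n + 2) * h - 1 \<le> card (T h)" using growth[OF h1] by (simp add: min_def split: if_splits)
      have "int (2 * n ^ 2 + 3 * n) \<le> int (2 * card H + 5)"
        using big False unfolding H_def by (simp only: of_nat_le_iff) simp
      then have H2: "8 * int h * int h - 2 * int h - 6 \<le> 2 * int (card H)"
        by (simp add: ni power2_eq_square algebra_simps)
      from g show ?thesis
      proof
        assume "card H \<le> card (T h)"
        then show ?thesis using H2 by simp
      next
        assume "(2 * n + 2) * h - 1 \<le> card (T h)"
        then have "int ((2 * n + 2) * h) \<le> int (card (T h) + 1)" by (simp only: of_nat_le_iff)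
        then show ?thesis by (simp add: ni algebra_simps)
      qed
    qed
    show False
    proof (rule odd_final_arithmetic[OF _ tk])
      show "2 \<le> int h" using h(2) by simp
      show "4 * int h * int h * (int h - 1) - 2 * int h + 4 \<le> 2 * int (\<Sum>j<h. card (T j))"
        using sum by (simp add: ni algebra_simps)
      show "int h * int (card (T h)) + (2 * int h - 2) * int (\<Sum>j<h. card (T j)) \<le> (int h * (2 * int h - 1))\<^sup>2"
        using of_nat_le_iff[where 'a = int, THEN iffD2, OF olson[OF bk]]
        unfolding of_nat_add of_nat_mult of_nat_power bki n1 bi .
    qed
  qed
qed

section \<open>The induction for halves in odd order\<close>

lemma half_gain_arithmetic:
  fixes b m n :: int
  assumes "0 \<le> m" "m \<le> n - 2" "n * (n - 1) + 2 * m \<le> 2 * b" "b * (n - m) < n * (n - 1)"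
  shows False
proof -
  define d where "d = n - m"
  have d: "2 \<le> d" "d \<le> n" "m = n - d" using assms(1,2) by (simp_all add: d_def)
  have "(n * (n - 1) + 2 * m) * d \<le> 2 * b * d" using assms(3) d(1) by (intro mult_right_mono) auto
  moreover have "(d - 2) * (d * (d + 1)) \<le> (d - 2) * (n * (n + 1))"
    using d(1,2) by (intro mult_left_mono mult_mono) auto
  moreover have "0 \<le> d * ((d - 1) * (d - 2))" using d(1) by simp
  ultimately show False using assms(4) d(2) unfolding d_def[symmetric] d(3) by (simp add: algebra_simps)
qed

lemma half_gain_bound:
  fixes S :: "'a::{ab_group_add,finite} set"
  assumes st: "has_stabilizer (subset_sums S + {0}) {0}" and S: "0 \<notin> S" "S \<noteq> {}" "symmetric_set S"
    and ss: "strongly_spread S" and Y: "is_half S Y"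
    and gain: "\<And>s. s \<in> S \<Longrightarrow> shift_gain (subset_sums Y) s \<le> m" and m: "m < card Y"
  shows "card (subset_sums Y) * (card Y - m) < card Y * (card Y - 1)"
proof (rule ccontr)
  assume neg: "\<not> ?thesis"
  let ?B = "subset_sums Y"
  have b0: "0 < card ?B" using zero_mem_subset_sums[of Y] by (metis card_gt_0_iff empty_iff finite)
  have bH: "2 * card ?B \<le> card (group_closure (S \<union> {0}))"
    using card_half_sums_le[OF st _ S(2) Y] S(1) by simp
  have dense: "card P + card (S + {0}) \<le> card (P + insert 0 S)"
    if "is_subgroup P" "{0} \<subset> P" "\<not> S \<subseteq> P" for P
  proof -
    have "P \<noteq> {0}" using that(2) by blast
    then have "card P + card S < card (P + insert 0 S)"
      using ss S(3) that(1,3) unfolding strongly_spread_def by blast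
    then show ?thesis by simp
  qed
  have growth: "min (2 * card ?B) (card {0 :: 'a} * (2 * card Y * j + 1)) \<le> card (ball {0} S j)" for j
    by (rule ball_growth[OF is_subgroup_zero _ dense _ bH]) (use S(1) is_halfD(3)[OF Y] in auto)
  show False
    by (rule shift_gain_large[OF is_subgroup_zero _ _ b0 growth _ m]) (use gain neg in simp_all)
qed

lemma is_half_remove:
  fixes S :: "'a::{ab_group_add,finite} set"
  assumes Y: "is_half S Y" and y: "y \<in> Y"
  shows "is_half (S - {y, - y}) (Y - {y})" "card (S - {y, - y}) < card S"
proof -
  note D = is_halfD[OF Y]
  have my: "- y \<in> S" "- y \<notin> Y" using D(2,4) y by (auto simp: mem_uminus_image)
  have eq: "S - {y, - y} = (Y - {y}) \<union> uminus ` (Y - {y})"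
    using D(2,4) my(2) by (auto simp: mem_uminus_image)
  have "(Y - {y}) \<inter> uminus ` (Y - {y}) = {}" using D(4) by blast
  then have "card (S - {y, - y}) = 2 * card (Y - {y})"
    unfolding eq by (simp add: card_Un_disjoint)
  then show "is_half (S - {y, - y}) (Y - {y})" using eq by (simp add: is_half_def)
  show "card (S - {y, - y}) < card S" using D(1) y by (intro psubset_card_mono) auto
qed

lemma xi_le_1: "xi T \<le> 1"
  by (simp add: xi_def)

lemma xi_even: "even (card T) \<Longrightarrow> xi T = 1"
  by (simp add: xi_def)

text \<open>Sums with and without \<open>y\<close> lie in different cosets of the subgroup generated
  by the rest.\<close>

lemma card_subset_sums_independent:
  fixes Y :: "'a::{ab_group_add,finite} set"
  assumes "y \<in> Y" "y \<notin> group_closure (Y - {y})"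
  shows "card (subset_sums Y) = 2 * card (subset_sums (Y - {y}))"
proof -
  let ?A = "subset_sums (Y - {y})" and ?H = "group_closure (Y - {y})"
  have A: "?A \<subseteq> ?H" by (intro subset_sums_subset_subgroup subset_group_closure) simp
  have "?A \<inter> (y +o ?A) = {}"
  proof (rule ccontr)
    assume "?A \<inter> (y +o ?A) \<noteq> {}"
    then obtain x where "x \<in> ?A" "x \<in> y +o ?A" by blast
    then have "x \<in> ?H" "x - y \<in> ?H" using subsetD[OF A] by (simp_all add: mem_elt_set_plus)
    then have "x - (x - y) \<in> ?H" by (rule group_closure.diff)
    then show False using assms(2) by simp
  qed
  then show ?thesis
    unfolding subset_sums_remove[OF assms(1)] set_plus_zero_two by (simp add: card_Un_disjoint)
qed

text \<open>
  Removing an element of \<open>Y\<close> of maximal gain \<open>m\<close> gives \<open>m \<ge> n - 1\<close> by \<open>half_gain_bound\<close>, which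
  falls short of the claim only for \<open>m = n - 1\<close>, the value excluded by the refined growth, or when
  \<open>\<xi>\<close> drops to \<open>0\<close>; in the latter case the removed element is independent of the others.
\<close>

theorem odd_half_bound:
  fixes S :: "'a::{ab_group_add,finite} set"
  assumes odd: "odd (card (UNIV :: 'a set))" and "has_stabilizer (subset_sums S + {0}) {0}"
    and "symmetric_set S" "0 \<notin> S" "strongly_spread S" "is_half S Y"
  shows "card Y * (card Y + 1) + 2 * xi Y \<le> 2 * card (subset_sums Y)"
  using assms(2-)
proof (induction "card S" arbitrary: S Y rule: less_induct)
  case less
  note st = less.prems(1) and S = less.prems(2,3) and ss = less.prems(4) and Y = less.prems(5)
  define n where "n = card Y"
  define B where "B = subset_sums Y"
  have cS: "card S = 2 * n" using is_halfD(3)[OF Y] by (simp add: n_def)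
  show ?case
  proof (cases "n \<le> 2")
    \<comment> \<open>For \<open>|S| \<le> 4\<close> the correction term vanishes, and the general
      bound is already what is claimed for \<open>xi Y = 1\<close>.\<close>
    case True
    have "8 + int (card S) ^ 2 + 2 * int (card S) \<le> 8 * int (card B)"
      using coset_bound_half[OF st S(1) _ strongly_spread_imp_spread[OF ss] Y] S(2) True cS
      by (simp add: coset_bound_zero B_def)
    then have "2 + n * n + n \<le> 2 * card B"
      unfolding cS by (simp add: power2_eq_square flip: of_nat_mult of_nat_add)
    then show ?thesis using xi_le_1[of Y] by (simp add: n_def B_def)
  next
    case False
    then have n3: "3 \<le> n" by simp
    then have Sne: "S \<noteq> {}" using cS by auto
    obtain s where s: "s \<in> S" "\<And>t. t \<in> S \<Longrightarrow> shift_gain B t \<le> shift_gain B s"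
      using maximizer_exists[of S "shift_gain B"] Sne by auto
    define m where "m = shift_gain B s"
    have gain: "shift_gain B t \<le> m" if "t \<in> S" for t using s(2)[OF that] by (simp add: m_def)
    have "s \<in> Y \<or> - s \<in> Y" using s(1) is_halfD(2)[OF Y] by (auto simp: mem_uminus_image)
    then obtain y where y: "y \<in> Y" "y = s \<or> y = - s" by blast
    define Y' where "Y' = Y - {y}"
    define B' where "B' = subset_sums Y'"
    define S' where "S' = S - {y, - y}"
    have cY': "card Y' = n - 1" using y(1) by (simp add: Y'_def n_def)
    have S'S: "S' \<subseteq> S" by (auto simp: S'_def)
    have "card Y' * (card Y' + 1) + 2 * xi Y' \<le> 2 * card B'"
      unfolding B'_def
    proof (rule less.hyps)
      show "card S' < card S" "is_half S' Y'" using is_half_remove[OF Y y(1)] by (simp_all add: S'_def Y'_def)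
      show "has_stabilizer (subset_sums S' + {0}) {0}" by (rule has_stabilizer_subset[OF st S'S])
      show "symmetric_set S'" unfolding S'_def by (intro symmetric_set_Diff S symmetric_set_pair)
      show "0 \<notin> S'" using S(2) S'S by blast
      show "strongly_spread S'" by (rule strongly_spread_subset[OF ss S'S])
    qed
    then have IH: "n * (n - 1) + 2 * xi Y' \<le> 2 * card B'"
      using n3 by (simp add: cY' mult.commute)
    have step: "card B' + m \<le> card B"
      using card_subset_sums_remove_class[of "{0}" "{y}" Y s] y by (auto simp: B_def B'_def Y'_def m_def)
    have low: "n * (n - 1) + 2 * xi Y' + 2 * m \<le> 2 * card B" using IH step by linarith
    have bH: "2 * card B \<le> card (group_closure S)"
      using card_half_sums_le[OF st _ Sne Y] S(2) by (simp add: B_def)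
    have m_ge: "n - 1 \<le> m"
    proof (rule ccontr)
      assume "\<not> ?thesis"
      then have m2: "m + 2 \<le> n" by simp
      have "card B * (n - m) < n * (n - 1)"
        using half_gain_bound[OF st S(2) Sne S(1) ss Y, of m] gain m2 by (simp add: B_def n_def)
      then have "int (card B * (n - m)) < int (n * (n - 1))" by (simp only: of_nat_less_iff)
      then have lt: "int (card B) * (int n - int m) < int n * (int n - 1)"
        using m2 by (simp add: of_nat_diff)
      have "int (n * (n - 1) + 2 * m) \<le> int (2 * card B)" using low by (simp only: of_nat_le_iff)
      then have "int n * (int n - 1) + 2 * int m \<le> 2 * int (card B)"
        using m2 by (simp add: of_nat_diff)
      then show False using half_gain_arithmetic[OF _ _ _ lt] m2 by simp
    qed
    have nn: "n * (n + 1) = n * (n - 1) + 2 * n" using n3 by (simp add: algebra_simps diff_mult_distrib2)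
    have "n * (n + 1) + 2 * xi Y \<le> 2 * card B"
    proof (cases "xi Y = 1")
      \<comment> \<open>\<open>|Y'|\<close> is even, so \<open>xi Y' = 1\<close> contributes the 2
        missing when \<open>m = n - 1\<close>.\<close>
      case False
      then have "odd n" "xi Y = 0" using xi_even[of Y] xi_le_1[of Y] by (auto simp: n_def)
      then have "xi Y' = 1" using cY' n3 by (intro xi_even) simp
      then show ?thesis using low m_ge nn \<open>xi Y = 0\<close> by linarith
    next
      case xi1: True
      show ?thesis
      proof (cases "xi Y' = 1")
        case True
        \<comment> \<open>Both sides are even, so excluding equality gains two.\<close>
        have "2 * card B \<noteq> n * (n + 1)" if "m = n - 1"
        proof
          assume b: "2 * card B = n * (n + 1)"
          have big: "even n \<or> 2 * n ^ 2 + 3 * n \<le> 2 * card (group_closure S) + 5"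
            using xi1 unfolding xi_def group_closure_half[OF Y] n_def by (auto split: if_splits)
          show False
            by (rule extremal_value_impossible[OF odd st S ss Y n_def[symmetric] n3 b[unfolded B_def] _ big])
               (use gain that in \<open>simp add: B_def\<close>)
        qed
        moreover have "even (n * (n + 1))" by simp
        ultimately show ?thesis using low m_ge nn True xi1 by presburger
      next
        case False
        then have *: "odd (n - 1)" "2 * card (group_closure Y') + 5 < 2 * (n - 1) ^ 2 + 3 * (n - 1)"
          unfolding xi_def cY' by (auto split: if_splits)
        then have n4: "4 \<le> n" using n3 by presburger
        show ?thesis
        proof (cases "y \<in> group_closure Y'")
          \<comment> \<open>\<open>Y'\<close> generates a group as large as \<open>S\<close> does;
            that it is small, by \<open>xi Y' = 0\<close>, contradicts
            \<open>2 |B| \<le> |H|\<close> for the generated group \<open>H\<close>.\<close>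
          case True
          then have "Y \<subseteq> group_closure Y'" using subset_group_closure[of Y'] by (auto simp: Y'_def)
          then have "group_closure Y \<subseteq> group_closure Y'" by (intro group_closure_subset) auto
          then have "card (group_closure S) \<le> card (group_closure Y')"
            unfolding group_closure_half[OF Y] by (intro card_mono) auto
          then have "4 * card B + 5 < 2 * (n - 1) ^ 2 + 3 * (n - 1)" using *(2) bH by linarith
          moreover have "2 * (n * (n - 1)) + 4 * (n - 1) \<le> 4 * card B" using low m_ge by linarith
          moreover have "(n - 1) ^ 2 \<le> n * (n - 1)" by (simp add: power2_eq_square)
          ultimately show ?thesis using n3 by linarith
        next
          case False
          have "card B = 2 * card B'"
            unfolding B_def B'_def Y'_def
            by (rule card_subset_sums_independent[OF y(1) False[unfolded Y'_def]])
          then have "2 * (n * (n - 1)) \<le> 2 * card B" using IH by linarith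
          moreover have "n * 3 \<le> n * (n - 1)" using n4 by (intro mult_le_mono2) simp
          ultimately show ?thesis using nn xi1 n4 by linarith
        qed
      qed
    qed
    then show ?thesis by (simp add: n_def B_def)
  qed
qed

theorem theorem1p5:
  fixes S :: "'a::{ab_group_add, finite} set"
  assumes "0 \<notin> S"
    and "symmetric_set S"
    and "card S \<ge> 4"
    and "aperiodic (subset_sums S)"
  shows "real (card (subset_sums S)) \<ge> real (card S) * (real (card S) - 2) / 4 + 5
    \<and> (odd (card (UNIV :: 'a set)) \<longrightarrow>
      real (card (subset_sums S)) \<ge>
        real (card S) * (real (card S) + 2) / 4 + 2 * real (xi' S) - 1)"
proof -
  note S = assms(1,2)
  let ?A = "subset_sums S"
  have st: "has_stabilizer (?A + {0}) {0}" by (rule has_stabilizer_zero[OF assms(4)])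
  obtain Y where Y: "is_half S Y" using is_half_exists[OF _ S assms(4)] by auto
  have cS: "card S = 2 * card Y" using is_halfD(3)[OF Y] by simp
  \<comment> \<open>The truncated difference in \<open>coset_bound\<close> is exact since
    \<open>|S| \<ge> 4\<close>.\<close>
  have "int (card S) ^ 2 - 2 * int (card S) + 20 \<le> 4 * int (card ?A)"
    using coset_bound_sums[OF st S(2)] S(1) assms(3) by (simp add: coset_bound_zero of_nat_diff)
  then have "real_of_int (int (card S) ^ 2 - 2 * int (card S) + 20) \<le> real_of_int (4 * int (card ?A))"
    by (simp only: of_int_le_iff)
  then have part1: "real (card ?A) \<ge> real (card S) * (real (card S) - 2) / 4 + 5"
    by (simp add: field_simps power2_eq_square)
  have part2: "real (card ?A) \<ge> real (card S) * (real (card S) + 2) / 4 + 2 * real (xi' S) - 1"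
    if odd: "odd (card (UNIV :: 'a set))"
  proof -
    have "int (card S) ^ 2 + 2 * int (card S) + 8 * int (xi' S) - 4 \<le> 4 * int (card ?A)"
    proof (cases "strongly_spread S")
      case True
      have "2 * card (subset_sums Y) \<le> card ?A + 1"
        using card_difference_set[of "subset_sums Y" "{0}"] st subset_sums_half[OF Y is_subgroup_zero] by simp
      with odd_half_bound[OF odd st S(2,1) True Y]
      have "card Y * (card Y + 1) + 2 * xi' S \<le> card ?A + 1"
        unfolding xi'_eq[OF Y] by linarith
      then have "int (card Y * (card Y + 1) + 2 * xi' S) \<le> int (card ?A + 1)" by (simp only: of_nat_le_iff)
      then show ?thesis by (simp add: cS power2_eq_square algebra_simps)
    next
      case False
      \<comment> \<open>Absorption yields the bound with \<open>xi' S\<close> replaced by 1.\<close>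
      obtain P z where "is_subgroup P" "P \<noteq> {0}" "z \<in> S" "subset_sums (S - {z, - z}) + P \<subseteq> ?A"
        by (rule not_strongly_spread_absorb[OF odd st S(2,1) False])
      from absorb_bound_odd[OF odd st S(2,1) this] show ?thesis
        using xi_le_1[of Y] unfolding xi'_eq[OF Y] by simp
    qed
    then have "real_of_int (int (card S) ^ 2 + 2 * int (card S) + 8 * int (xi' S) - 4) \<le> real_of_int (4 * int (card ?A))"
      by (simp only: of_int_le_iff)
    then show ?thesis by (simp add: field_simps power2_eq_square)
  qed
  show ?thesis using part1 part2 by blast
qed

end
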